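(* Let $r\in\mathbb N$. For $N\ge r$ let $z_{N-r+1,N}$ be the $r$-th largest zero of the Hermite polynomial $H_N$ and define $$f_N(y):=N^{1/6}\,Q_{\lfloor N^{1/3}y\rfloor,N}(z_{N-r+1,N})\quad\text{for }y\in[0,N^{2/3}[,$$ and $f_N(y):=0$ otherwise. Let $a_r$ be the $r$-th largest zero of the Airy function $\mathsf{Ai}$. Then, as $N\to\infty$, $f_N$ converges locally uniformly on $[0,\infty[$ to $$f(y):=\frac{\mathsf{Ai}(y+a_r)}{\mathsf{Ai}'(a_r)}\qquad(y\in[0,\infty[).$$ Moreover, the covariance matrices $\Sigma_N=(\sigma_{i,j})_{i,j=1,\dots,N}$ of the freezing $\beta$-Hermite ensembles satisfy $$\lim_{N\to\infty}N^{1/3}\,\sigma_{N-r+1,N-r+1}=\int_0^\infty\frac{\mathsf{Ai}(x+a_r)^2}{\mathsf{Ai}'(a_r)^2\,x}\,dx,$$ where the numerical values of the right-hand side are $0.582\ldots$ for $r=2$, $0.472\ldots$ for $r=3$, $0.407\ldots$ for $r=4$.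
   Context: Let $z_{1,N}<\dots<z_{N,N}$ be the zeros of the physicists' Hermite polynomial $H_N$ (orthogonal with respect to $e^{-x^2}$). $(Q_{k,N})_{k=0,\dots,N-1}$ are the polynomials with $\deg Q_{k,N}=k$, positive leading coefficients, and $\sum_{i=1}^NQ_{k,N}(z_{i,N})Q_{l,N}(z_{i,N})=\delta_{k,l}$. Equivalently, $xQ_{k,N}(x)=\sqrt{\tfrac{N-k-1}2}\,Q_{k+1,N}(x)+\sqrt{\tfrac{N-k}2}\,Q_{k-1,N}(x)$ for $0\le k\le N-2$, with $Q_{-1,N}=0$, $Q_{0,N}=N^{-1/2}$. $\Sigma_N$ is the inverse of the matrix $S_N=(s_{i,j})$ with $s_{i,i}=1+\sum_{l\ne i}(z_{i,N}-z_{l,N})^{-2}$ and $s_{i,j}=-(z_{i,N}-z_{j,N})^{-2}$ for $i\ne j$ (the entries of $\Sigma_N$ depend on $N$). It is known that $S_N$ has eigenvalue $n$ with eigenvector $(Q_{n-1,N}(z_{1,N}),\dots,Q_{n-1,N}(z_{N,N}))^T$, $n=1,\dots,N$. The Airy function $\mathsf{Ai}$ is the solution of $y''(z)=z\,y(z)$ on $\mathbb R$ with $y(z)\to0$ as $z\to\infty$ and $y(0)=\frac1{3^{2/3}\Gamma(2/3)}$; its zeros are $\dots<a_3<a_2<a_1<0$. The values "$0.582\ldots$" etc. denote initial digits of decimal expansions. *)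

theory Defs
  imports
    "HOL-Probability.Probability"
    "HOL-Computational_Algebra.Polynomial"
    "Jordan_Normal_Form.Gauss_Jordan_Elimination"
begin

(* The recursion is the one read off from the Rodrigues formula
   H_n(x) = (-1)^n exp(x^2) (d/dx)^n exp(-x^2).  The lemmas below confirm that H_n has degree n,
   leading coefficient 2^n and is orthogonal with respect to the weight exp(-x^2). *)
fun hermite :: "nat \<Rightarrow> real poly" where
  "hermite 0 = 1"
| "hermite (Suc n) = [:0, 2:] * hermite n - pderiv (hermite n)"

lemma degree_lead_coeff_hermite:
  "degree (hermite n) = n \<and> lead_coeff (hermite n) = 2 ^ n"
proof (induction n)
  case 0
  then show ?case by simp
next
  case (Suc n)
  then have d: "degree (hermite n) = n" and l: "lead_coeff (hermite n) = 2 ^ n"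
    by auto
  have nz: "hermite n \<noteq> 0"
    using l by auto
  have "degree ([:0, 2:] * hermite n) = Suc n"
    using nz d by (subst degree_mult_eq) auto
  moreover have "degree (pderiv (hermite n)) < Suc n"
    using d by (simp add: degree_pderiv)
  ultimately have deg: "degree (hermite (Suc n)) = Suc n"
    using degree_add_eq_left[of "- pderiv (hermite n)" "[:0, 2:] * hermite n"]
    by (simp del: mult_pCons_left)
  have "coeff (hermite (Suc n)) (Suc n) = 2 * coeff (hermite n) n"
    using d by (simp add: coeff_pderiv coeff_eq_0)
  with deg l d show ?case
    by simp
qed

lemma integrable_poly_gaussian:
  "integrable lborel (\<lambda>x. poly p x * exp (- x\<^sup>2))" for p :: "real poly"
proof -
  have mono: "integrable lborel (\<lambda>x::real. exp (- x\<^sup>2) * x ^ k)" for k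
  proof -
    have s: "(0::real) < sqrt (1/2)" by simp
    have "integrable lborel (\<lambda>x. normal_density 0 (sqrt (1/2)) x * (x - 0) ^ k)"
      by (rule integrable_normal_moment[OF s])
    hence "integrable lborel
        (\<lambda>x. sqrt pi * (normal_density 0 (sqrt (1/2)) x * (x - 0) ^ k))"
      by (rule integrable_mult_right)
    moreover have "sqrt pi * (normal_density 0 (sqrt (1/2)) x * (x - 0) ^ k)
        = exp (- x\<^sup>2) * x ^ k" for x :: real
      by (simp add: normal_density_def)
    ultimately show ?thesis by (simp only:)
  qed
  have "integrable lborel
      (\<lambda>x. \<Sum>i\<le>degree p. coeff p i * (exp (- x\<^sup>2) * x ^ i))"
    by (intro Bochner_Integration.integrable_sum integrable_mult_right mono)
  moreover have "(\<Sum>i\<le>degree p. coeff p i * (exp (- x\<^sup>2) * x ^ i))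
      = poly p x * exp (- x\<^sup>2)" for x
    by (simp add: poly_altdef sum_distrib_right sum_distrib_left mult_ac)
  ultimately show ?thesis by simp
qed

lemma tendsto_poly_gaussian:
  fixes p :: "real poly"
  shows "((\<lambda>x. poly p x * exp (- x\<^sup>2)) \<longlongrightarrow> 0) at_top"
proof -
  have mono: "((\<lambda>x::real. x ^ k * exp (- x\<^sup>2)) \<longlongrightarrow> 0) at_top" for k
  proof (rule tendsto_sandwich[where f = "\<lambda>_. 0" and h = "\<lambda>x. x ^ k / exp x"])
    show "\<forall>\<^sub>F x in at_top. x ^ k * exp (- x\<^sup>2) \<le> x ^ k / exp (x::real)"
      using eventually_ge_at_top[of 1]
    proof eventually_elim
      case (elim x)
      then have "exp (- x\<^sup>2) \<le> exp (- x)"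
        by (simp add: power2_eq_square)
      then have "x ^ k * exp (- x\<^sup>2) \<le> x ^ k * exp (- x)"
        using elim by (intro mult_left_mono) auto
      then show ?case
        by (simp add: exp_minus divide_inverse)
    qed
    show "\<forall>\<^sub>F x in at_top. 0 \<le> x ^ k * exp (- x\<^sup>2 :: real)"
      using eventually_ge_at_top[of 0] by eventually_elim simp
  qed (auto intro: tendsto_power_div_exp_0)
  have "((\<lambda>x. \<Sum>i\<le>degree p. coeff p i * (x ^ i * exp (- x\<^sup>2)))
      \<longlongrightarrow> (\<Sum>i\<le>degree p. coeff p i * 0)) at_top"
    by (intro tendsto_sum tendsto_mult_left mono)
  moreover have "(\<Sum>i\<le>degree p. coeff p i * (x ^ i * exp (- x\<^sup>2)))
      = poly p x * exp (- x\<^sup>2)" for x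
    by (simp add: poly_altdef sum_distrib_right sum_distrib_left mult_ac)
  ultimately show ?thesis by simp
qed

lemma integral_deriv_poly_gaussian:
  fixes p :: "real poly"
  shows "(\<integral>x. poly (pderiv p - [:0, 2:] * p) x * exp (- x\<^sup>2) \<partial>lborel) = 0"
proof -
  let ?F = "\<lambda>x. poly p x * exp (- x\<^sup>2)"
  let ?f = "\<lambda>x. poly (pderiv p - [:0, 2:] * p) x * exp (- x\<^sup>2)"
  have top: "(?F \<longlongrightarrow> 0) at_top"
    by (rule tendsto_poly_gaussian)
  have "((\<lambda>x. poly (pcompose p [:0, -1:]) x * exp (- x\<^sup>2)) \<longlongrightarrow> 0) at_top"
    by (rule tendsto_poly_gaussian)
  then have bot: "(?F \<longlongrightarrow> 0) at_bot"
    by (simp add: filterlim_at_bot_mirror poly_pcompose)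
  have "(LBINT x=-\<infinity>..\<infinity>. ?f x) = 0 - 0"
  proof (rule interval_integral_FTC_integrable[where F = ?F])
    fix x :: real
    have "(?F has_real_derivative ?f x) (at x)"
      by (auto intro!: derivative_eq_intros simp: algebra_simps)
    then show "(?F has_vector_derivative ?f x) (at x)"
      by (rule has_real_derivative_iff_has_vector_derivative[THEN iffD1])
    show "isCont ?f x"
      by (intro continuous_intros)
  next
    show "set_integrable lborel (einterval (- \<infinity>) \<infinity>) ?f"
      using integrable_poly_gaussian[of "pderiv p - [:0, 2:] * p"]
      by (simp add: set_integrable_def einterval_def)
    show "((?F \<circ> real_of_ereal) \<longlongrightarrow> 0) (at_right (- \<infinity>))"
      by (subst ereal_tendsto_simps1) (rule bot)
    show "((?F \<circ> real_of_ereal) \<longlongrightarrow> 0) (at_left \<infinity>)"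
      by (subst ereal_tendsto_simps1) (rule top)
  qed auto
  then show ?thesis
    by (simp add: interval_lebesgue_integral_def set_lebesgue_integral_def einterval_def)
qed

lemma hermite_orthogonal:
  fixes q :: "real poly"
  assumes "degree q < n"
  shows "(\<integral>x. poly (hermite n) x * poly q x * exp (- x\<^sup>2) \<partial>lborel) = 0"
  using assms
proof (induction n arbitrary: q)
  case 0
  then show ?case by simp
next
  case (Suc n)
  let ?I = "\<lambda>r. \<integral>x. poly r x * exp (- x\<^sup>2) \<partial>lborel"
  have eq: "hermite (Suc n) * q
      = hermite n * pderiv q - (pderiv (hermite n * q) - [:0, 2:] * (hermite n * q))"
    by (simp add: pderiv_mult algebra_simps del: mult_pCons_left mult_pCons_right)
  have diff: "?I (r - s) = ?I r - ?I s" for r s :: "real poly"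
    using integrable_poly_gaussian[of r] integrable_poly_gaussian[of s]
    by (simp add: left_diff_distrib)
  have "?I (hermite (Suc n) * q) = ?I (hermite n * pderiv q)"
    unfolding eq by (subst diff) (use integral_deriv_poly_gaussian[of "hermite n * q"] in simp)
  also have "\<dots> = 0"
  proof (cases "degree q = 0")
    case True
    then have "pderiv q = 0"
      by (simp add: pderiv_eq_0_iff)
    then show ?thesis by simp
  next
    case False
    then have "degree (pderiv q) < n"
      using Suc.prems by (simp add: degree_pderiv)
    from Suc.IH[OF this] show ?thesis by simp
  qed
  finally show ?case by simp
qed

(* z_{i,N}, the i-th smallest zero of H_N, with i = 1, ..., N as in the source. *)
definition hermite_zero :: "nat \<Rightarrow> nat \<Rightarrow> real" where
  "hermite_zero i N = sorted_list_of_set {x. poly (hermite N) x = 0} ! (i - 1)"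

definition is_dual_hermite :: "nat \<Rightarrow> (nat \<Rightarrow> real poly) \<Rightarrow> bool" where
  "is_dual_hermite N Q \<longleftrightarrow>
     (\<forall>k<N. degree (Q k) = k \<and> lead_coeff (Q k) > 0) \<and>
     (\<forall>k<N. \<forall>l<N. (\<Sum>i=1..N. poly (Q k) (hermite_zero i N) * poly (Q l) (hermite_zero i N))
        = (if k = l then 1 else 0))"

(* Q_{k,N} = dual_hermite k N.  The conditions determine Q_{k,N} uniquely for k < N;
   the values for k \<ge> N are arbitrary and never used. *)
definition dual_hermite :: "nat \<Rightarrow> nat \<Rightarrow> real poly" where
  "dual_hermite k N = (SOME Q. is_dual_hermite N Q) k"

(* S_N.  Matrix positions are counted from 0, zeros from 1. *)
definition S_mat :: "nat \<Rightarrow> real mat" where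
  "S_mat N = mat N N (\<lambda>(i, j).
     if i = j
     then 1 + (\<Sum>l\<in>{1..N} - {Suc i}. 1 / (hermite_zero (Suc i) N - hermite_zero l N)\<^sup>2)
     else - (1 / (hermite_zero (Suc i) N - hermite_zero (Suc j) N)\<^sup>2))"

definition Sigma_mat :: "nat \<Rightarrow> real mat" where
  "Sigma_mat N = the (mat_inverse (S_mat N))"

(* sigma_{i,j} for i, j = 1, ..., N. *)
definition cov_entry :: "nat \<Rightarrow> nat \<Rightarrow> nat \<Rightarrow> real" where
  "cov_entry N i j = Sigma_mat N $$ (i - 1, j - 1)"

definition is_airy :: "(real \<Rightarrow> real) \<Rightarrow> bool" where
  "is_airy y \<longleftrightarrow>
     (\<exists>y'. \<forall>z. (y has_real_derivative y' z) (at z) \<and> (y' has_real_derivative z * y z) (at z)) \<and>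
     (y \<longlongrightarrow> 0) at_top \<and>
     y 0 = 1 / (3 powr (2/3) * Gamma (2/3))"

definition airy :: "real \<Rightarrow> real" where
  "airy = (THE y. is_airy y)"

(* a_r, the r-th largest real zero: exactly r - 1 zeros lie to the right of it. *)
definition airy_zero :: "nat \<Rightarrow> real" where
  "airy_zero r = (THE a. airy a = 0 \<and> finite {b. airy b = 0 \<and> a < b} \<and>
     Suc (card {b. airy b = 0 \<and> a < b}) = r)"

definition edge_profile :: "nat \<Rightarrow> nat \<Rightarrow> real \<Rightarrow> real" where
  "edge_profile r N y =
     (if 0 \<le> y \<and> y < real N powr (2/3)
      then real N powr (1/6) *
             poly (dual_hermite (nat \<lfloor>real N powr (1/3) * y\<rfloor>) N) (hermite_zero (N - r + 1) N)
      else 0)"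

definition edge_limit :: "nat \<Rightarrow> real \<Rightarrow> real" where
  "edge_limit r y = airy (y + airy_zero r) / deriv airy (airy_zero r)"

definition edge_variance :: "nat \<Rightarrow> real" where
  "edge_variance r =
     (LBINT x:{0<..}. (airy (x + airy_zero r))\<^sup>2 / ((deriv airy (airy_zero r))\<^sup>2 * x))"

end

theory Submission
  imports Defs "Jordan_Normal_Form.Determinant" "HOL-Real_Asymp.Real_Asymp"
begin

text \<open>
  Rescaled around \<open>sqrt (2 N)\<close>, the functions \<open>H\<^sub>N(x) exp (- x\<^sup>2 / 2)\<close> solve a perturbed Airy equation; a Wronskian
  comparison with \<open>Ai\<close> shows that their \<open>r\<close>-th largest zero tends to \<open>a\<^sub>r\<close>. At this node the recurrence of the dual
  polynomials is a difference scheme for \<open>u'' = (y + a\<^sub>r) u\<close>, \<open>u(0) = 0\<close>, \<open>u'(0) = 1\<close>, which gives \<open>f\<^sub>N \<longrightarrow> f\<close>.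
  As the vectors \<open>(Q\<^sub>k(z\<^sub>i))\<^sub>i\<close> are orthonormal eigenvectors of \<open>S\<^sub>N\<close> with eigenvalues \<open>k + 1\<close>, the variance is
  \<open>\<Sum>k. Q\<^sub>k(z)\<^sup>2 / (k + 1)\<close>, a Riemann sum of the integral of \<open>f(x)\<^sup>2 / x\<close>; a discrete energy decreases beyond
  the turning point and controls the tail.

  For the digits, the integral is split at \<open>x = - a\<^sub>r\<close>. Below this point \<open>Ai(x + a\<^sub>r)\<^sup>2 / x\<close> is integrated as a power series, whose
  terms obey a three-step recurrence that is evaluated in integer fixed-point arithmetic with rigorous error terms. Above it,
  \<open>1 / x\<close> is bounded by polynomials, whose integrals against \<open>Ai\<^sup>2\<close> have closed forms in \<open>Ai(0)\<close> and \<open>Ai'(0)\<close>.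
\<close>

subsection \<open>Hermite polynomials\<close>

text \<open>The limit profile and the variance do not change when \<open>Ai\<close> is scaled, so
  the proof works with the multiple A of \<open>Ai\<close> with A(0) = 1; -Ai'(0)/Ai(0) is then the
  only constant needed numerically, and Gamma(2/3) is never evaluated. The turning point is placed
  at sqrt (2 N + 1) because the perturbation of the Airy equation is then exactly \<epsilon> t^2
  with \<epsilon> >= 0. Its sign keeps decaying solutions nonnegative and convex to the right, so
  that decay fixes the slope at 0 up to \<epsilon> and Gronwall is needed only on a compact
  interval. Zeros are compared by counting those above a threshold. The spectrum of S_N is proved,
  not assumed: on polynomials S_N - 1 is triangular with diagonal 0, 1, 2, ..., and it is symmetric.
  Local convergence alone does not give the variance: near 0 the weight 1/x calls for a linear bound
  on the profile, and the part of the sum beyond x = Y is at most 1/Y because the vector over k has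
  norm 1, just as the integral of f^2 is 1.\<close>

lemma pderiv_hermite_Suc: "pderiv (hermite (Suc n)) = Polynomial.smult (2 * real (Suc n)) (hermite n)"
proof (induction n)
  case 0
  show ?case by (simp add: pderiv_pCons)
next
  case (Suc n)
  have two: "pderiv [:0, 2:] = [:2::real:]" by (simp add: pderiv_pCons)
  have "pderiv (hermite (Suc (Suc n)))
      = [:0, 2:] * pderiv (hermite (Suc n)) + [:2:] * hermite (Suc n) - pderiv (pderiv (hermite (Suc n)))"
    by (subst hermite.simps) (simp only: pderiv_diff pderiv_mult two mult.commute add.commute)
  also have "\<dots> = Polynomial.smult (2 * real (Suc n)) ([:0, 2:] * hermite n - pderiv (hermite n)) + Polynomial.smult 2 (hermite (Suc n))"
    unfolding Suc by (simp add: pderiv_smult smult_diff_right)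
  also have "[:0, 2:] * hermite n - pderiv (hermite n) = hermite (Suc n)" by simp
  also have "Polynomial.smult (2 * real (Suc n)) (hermite (Suc n)) + Polynomial.smult 2 (hermite (Suc n))
      = Polynomial.smult (2 * real (Suc (Suc n))) (hermite (Suc n))"
    by (simp only: smult_add_left [symmetric]) (simp add: algebra_simps)
  finally show ?case .
qed

lemma poly_hermite_Suc_Suc:
  "poly (hermite (Suc (Suc n))) x = 2 * x * poly (hermite (Suc n)) x - 2 * real (Suc n) * poly (hermite n) x"
  by (subst hermite.simps) (simp only: pderiv_hermite_Suc poly_diff poly_mult poly_smult, simp)

lemma pderiv2_hermite: "poly (pderiv (pderiv (hermite n))) x
  = 2 * x * poly (pderiv (hermite n)) x - 2 * real n * poly (hermite n) x"
proof -
  have "pderiv (hermite (Suc n)) = Polynomial.smult 2 (hermite n) + [:0,2:] * pderiv (hermite n) - pderiv (pderiv (hermite n))"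
    by (simp add: pderiv_diff pderiv_mult pderiv_pCons pderiv_smult)
  then have "2 * real (Suc n) * poly (hermite n) x = poly (Polynomial.smult 2 (hermite n) + [:0,2:] * pderiv (hermite n) - pderiv (pderiv (hermite n))) x"
    by (simp only: pderiv_hermite_Suc flip: poly_smult)
  then show ?thesis by (simp add: algebra_simps)
qed

lemma degree_hermite [simp]: "degree (hermite n) = n"
  using degree_lead_coeff_hermite by blast

lemma hermite_nonzero [simp]: "hermite n \<noteq> 0"
  using degree_lead_coeff_hermite[of n] by auto

definition hermite_roots :: "nat \<Rightarrow> real set" where
  "hermite_roots n = {x. poly (hermite n) x = 0}"

lemma finite_hermite_roots [simp]: "finite (hermite_roots n)"
  unfolding hermite_roots_def by (rule poly_roots_finite) simp

text \<open>A common zero of consecutive members would propagate down the recurrence to \<open>H\<^sub>0 = 1\<close>.\<close>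
lemma hermite_no_common_root: "poly (hermite n) x = 0 \<Longrightarrow> poly (hermite (Suc n)) x \<noteq> 0"
proof (induction n)
  case (Suc n)
  show ?case
  proof
    assume "poly (hermite (Suc (Suc n))) x = 0"
    then have "poly (hermite n) x = 0"
      using Suc.prems by (simp only: poly_hermite_Suc_Suc) simp
    with Suc show False by blast
  qed
qed simp

lemma hermite_root_simple:
  assumes "poly (hermite n) x = 0" shows "poly (pderiv (hermite n)) x \<noteq> 0"
proof (cases n)
  case (Suc k)
  have "poly (hermite k) x \<noteq> 0" using hermite_no_common_root[of k x] assms Suc by blast
  then show ?thesis by (simp only: Suc pderiv_hermite_Suc poly_smult) simp
qed (use assms in auto)

text \<open>A nonnegative function with vanishing integral is zero almost everywhere, but a nonzero
  polynomial vanishes only on a finite, hence null, set.\<close>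

lemma poly_gaussian_positive_integral:
  fixes p :: "real poly"
  assumes "p \<noteq> 0" and nonneg: "\<And>x. poly p x \<ge> 0"
  shows "(\<integral>x. poly p x * exp (- x\<^sup>2) \<partial>lborel) \<noteq> 0"
proof
  assume zero: "(\<integral>x. poly p x * exp (- x\<^sup>2) \<partial>lborel) = 0"
  have "AE x in lborel. poly p x * exp (- x\<^sup>2) = 0"
    using zero integral_nonneg_eq_0_iff_AE[OF integrable_poly_gaussian[of p]] nonneg by simp
  then have "AE x in lborel. x \<in> {x. poly p x = 0}" by simp
  moreover have "AE x in lborel. x \<notin> {x. poly p x = 0}"
    using poly_roots_finite[OF \<open>p \<noteq> 0\<close>] by (intro AE_not_in) (auto simp: finite_imp_null_set_lborel)
  ultimately have "AE x::real in lborel. False" by eventually_elim auto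
  then have "emeasure lborel (UNIV :: real set) = 0"
    by (auto dest: AE_E2)
  then show False by simp
qed

lemma prod_linear_factors_dvd:
  fixes p :: "real poly"
  assumes "finite S" "\<And>s. s \<in> S \<Longrightarrow> poly p s = 0"
  shows "(\<Prod>s\<in>S. [:-s, 1:]) dvd p"
  using assms
proof (induction S)
  case (insert s S)
  then obtain g where g: "p = (\<Prod>s\<in>S. [:-s, 1:]) * g" by (auto elim: dvdE)
  have "poly (\<Prod>s\<in>S. [:-s, 1:]) s \<noteq> 0" using insert by (auto simp: poly_prod)
  then have "poly g s = 0" using insert.prems[of s] g by simp
  then obtain h where "g = [:-s, 1:] * h" by (auto simp: poly_eq_0_iff_dvd elim: dvdE)
  then show ?case using insert.hyps g by (simp add: mult.assoc mult.left_commute del: mult_pCons_left mult_pCons_right)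
qed simp

text \<open>Split off the product q of the linear factors of all real roots. Since the roots are
  simple, the cofactor g has no real zero and keeps one sign. If q had degree below n, the integral
  of \<open>hermite n\<close> * q = q^2 g would vanish by orthogonality, which the sign of g
  forbids.\<close>

lemma card_hermite_roots: "card (hermite_roots n) = n"
proof -
  define q where "q = (\<Prod>s\<in>hermite_roots n. [:-s, 1::real:])"
  have deg_q: "degree q = card (hermite_roots n)"
    unfolding q_def by (subst degree_prod_eq_sum_degree) auto
  have root_q: "poly q x = 0 \<longleftrightarrow> x \<in> hermite_roots n" for x
    unfolding q_def by (auto simp: poly_prod)
  have "q dvd hermite n"
    unfolding q_def by (rule prod_linear_factors_dvd) (simp, simp add: hermite_roots_def)
  then obtain g where g: "hermite n = q * g" by (auto elim: dvdE)
  have g_nz: "poly g x \<noteq> 0" for x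
  proof
    assume gx: "poly g x = 0"
    then have hx: "poly (hermite n) x = 0" by (simp add: g)
    then have "poly q x = 0" by (simp add: root_q hermite_roots_def)
    with gx have "poly (pderiv (hermite n)) x = 0" by (simp add: g pderiv_mult)
    with hermite_root_simple[OF hx] show False by blast
  qed
  have one_sign: "(\<forall>x. poly g x > 0) \<or> (\<forall>x. poly g x < 0)"
  proof (rule ccontr)
    assume "\<not> ?thesis"
    then obtain a b where "poly g a > 0" "poly g b < 0"
      using g_nz by (meson linorder_neqE_linordered_idom)
    then show False
      using poly_IVT_neg[of a b g] poly_IVT_pos[of b a g] g_nz
      by (metis linorder_neqE_linordered_idom order.asym)
  qed
  have "degree q \<ge> n"
  proof (rule ccontr)
    assume "\<not> degree q \<ge> n"
    then have zero: "(\<integral>x. poly (q * q * g) x * exp (- x\<^sup>2) \<partial>lborel) = 0"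
      using hermite_orthogonal[of q n] by (simp add: g mult_ac)
    have "q \<noteq> 0" "g \<noteq> 0" using g by auto
    then have nz: "q * q * g \<noteq> 0" "- (q * q * g) \<noteq> 0" by auto
    from one_sign show False
    proof
      assume "\<forall>x. poly g x > 0"
      then show False using poly_gaussian_positive_integral[OF nz(1)] zero by (simp add: less_imp_le)
    next
      assume "\<forall>x. poly g x < 0"
      then show False using poly_gaussian_positive_integral[OF nz(2)] zero
        by (simp add: less_imp_le mult_nonneg_nonpos)
    qed
  qed
  moreover have "card (hermite_roots n) \<le> n"
    using card_poly_roots_bound[of "hermite n"] by (simp add: hermite_roots_def)
  ultimately show ?thesis by (simp add: deg_q)
qed

lemma hermite_zero_nth: "hermite_zero i N = sorted_list_of_set (hermite_roots N) ! (i - 1)"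
  by (simp add: hermite_zero_def hermite_roots_def)

lemma hermite_zero_strict_mono:
  assumes "1 \<le> i" "i < j" "j \<le> N" shows "hermite_zero i N < hermite_zero j N"
  using assms sorted_wrt_nth_less[OF strict_sorted_list_of_set[of "hermite_roots N"], of "i - 1" "j - 1"]
  by (simp add: hermite_zero_nth card_hermite_roots)

lemma bij_betw_hermite_zero: "bij_betw (\<lambda>i. hermite_zero i N) {1..N} (hermite_roots N)"
proof -
  have "bij_betw ((!) (sorted_list_of_set (hermite_roots N))) {..<N} (hermite_roots N)"
    using bij_betw_nth[of "sorted_list_of_set (hermite_roots N)" "{..<N}"]
    by (simp add: card_hermite_roots)
  moreover have "bij_betw (\<lambda>i. i - 1) {1..N} {..<N}"
    by (rule bij_betw_byWitness[where f' = Suc]) auto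
  ultimately have "bij_betw ((!) (sorted_list_of_set (hermite_roots N)) \<circ> (\<lambda>i. i - 1)) {1..N} (hermite_roots N)"
    by (rule bij_betw_trans[rotated])
  also have "(!) (sorted_list_of_set (hermite_roots N)) \<circ> (\<lambda>i. i - 1) = (\<lambda>i. hermite_zero i N)"
    by (rule ext) (simp add: hermite_zero_nth)
  finally show ?thesis .
qed

lemma hermite_zero_root: "i \<in> {1..N} \<Longrightarrow> poly (hermite N) (hermite_zero i N) = 0"
  using bij_betw_hermite_zero[of N] by (auto simp: bij_betw_def hermite_roots_def)

lemma hermite_zero_inj: "i \<in> {1..N} \<Longrightarrow> j \<in> {1..N} \<Longrightarrow> hermite_zero i N = hermite_zero j N \<longleftrightarrow> i = j"
  by (rule inj_on_eq_iff[OF bij_betw_imp_inj_on[OF bij_betw_hermite_zero]])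

text \<open>This replaces the position in a sorted list by a number of roots to the right, the form
  in which Hermite and Airy zeros are compared later.\<close>

lemma card_roots_above_hermite_zero:
  assumes "1 \<le> r" "r \<le> N"
  shows "card {x \<in> hermite_roots N. hermite_zero (N - r + 1) N < x} = r - 1"
proof -
  have "{x \<in> hermite_roots N. hermite_zero (N - r + 1) N < x} = (\<lambda>i. hermite_zero i N) ` {N - r + 2..N}"
  proof (intro equalityI subsetI)
    fix x assume x: "x \<in> {x \<in> hermite_roots N. hermite_zero (N - r + 1) N < x}"
    then obtain i where i: "i \<in> {1..N}" "x = hermite_zero i N"
      using bij_betw_imp_surj_on[OF bij_betw_hermite_zero[of N]] by blast
    have "N - r + 1 < i"
    proof (rule ccontr)
      assume "\<not> N - r + 1 < i"
      then have "i = N - r + 1 \<or> i < N - r + 1" by auto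
      then have "hermite_zero i N \<le> hermite_zero (N - r + 1) N"
        using hermite_zero_strict_mono[of i "N - r + 1" N] i assms by fastforce
      with x i show False by simp
    qed
    then show "x \<in> (\<lambda>i. hermite_zero i N) ` {N - r + 2..N}" using i by auto
  next
    fix x assume "x \<in> (\<lambda>i. hermite_zero i N) ` {N - r + 2..N}"
    then show "x \<in> {x \<in> hermite_roots N. hermite_zero (N - r + 1) N < x}"
      using hermite_zero_strict_mono[of "N - r + 1" _ N] assms hermite_zero_root[of _ N]
      by (auto simp: hermite_roots_def)
  qed
  moreover have "inj_on (\<lambda>i. hermite_zero i N) {N - r + 2..N}"
    using hermite_zero_inj[of _ N] by (intro inj_onI) auto
  ultimately show ?thesis using assms by (simp add: card_image)
qed

subsection \<open>The dual polynomials\<close>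

text \<open>Orthonormal for the weight exp (- x^2) / sqrt pi; with this scaling the Jacobi matrix of
  the three-term recurrence is symmetric.\<close>

definition hermite_fun :: "nat \<Rightarrow> real \<Rightarrow> real" where
  "hermite_fun n x = poly (hermite n) x / sqrt (2 ^ n * fact n)"

lemma hermite_fun_eq: "poly (hermite n) x = sqrt (2 ^ n * fact n) * hermite_fun n x"
  by (simp add: hermite_fun_def)

lemma hermite_fun_0 [simp]: "hermite_fun 0 x = 1"
  by (simp add: hermite_fun_def)

lemma hermite_fun_rec:
  "x * hermite_fun (Suc n) x =
     sqrt (real (n + 2) / 2) * hermite_fun (n + 2) x + sqrt (real (n + 1) / 2) * hermite_fun n x"
proof -
  define c where "c = sqrt (2 ^ n * fact n)"
  define a where "a = sqrt (real (n + 1) / 2)"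
  define b where "b = sqrt (real (n + 2) / 2)"
  have c1: "sqrt (2 ^ Suc n * fact (Suc n)) = c * 2 * a"
  proof -
    have "2 ^ Suc n * fact (Suc n) = (2 ^ n * fact n) * (2 * 2) * (real (n + 1) / 2)" by (simp add: field_simps)
    then show ?thesis by (simp only: real_sqrt_mult a_def c_def) simp
  qed
  have c2: "sqrt (2 ^ Suc (Suc n) * fact (Suc (Suc n))) = c * 4 * a * b"
  proof -
    have "2 ^ Suc (Suc n) * fact (Suc (Suc n)) = (2 ^ Suc n * fact (Suc n)) * (2 * 2) * (real (n + 2) / 2)"
      by (simp add: field_simps)
    then have "sqrt (2 ^ Suc (Suc n) * fact (Suc (Suc n))) = sqrt (2 ^ Suc n * fact (Suc n)) * 2 * b"
      by (simp only: real_sqrt_mult b_def) simp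
    then show ?thesis unfolding c1 by simp
  qed
  have pos: "c > 0" "a > 0" "b > 0" by (auto simp: a_def b_def c_def)
  have aa: "a * a = real (n + 1) / 2" by (simp add: a_def)
  from poly_hermite_Suc_Suc[of n x]
  have "c * 4 * a * b * hermite_fun (Suc (Suc n)) x
      = 2 * x * (c * 2 * a) * hermite_fun (Suc n) x - 4 * (a * a) * c * hermite_fun n x"
    unfolding hermite_fun_eq c1 c2 aa by (simp add: c_def)
  then have "(4 * a * c) * (b * hermite_fun (Suc (Suc n)) x) = (4 * a * c) * (x * hermite_fun (Suc n) x - a * hermite_fun n x)"
    by (simp add: algebra_simps)
  then have "b * hermite_fun (Suc (Suc n)) x = x * hermite_fun (Suc n) x - a * hermite_fun n x"
    using pos by simp
  then show ?thesis by (simp add: a_def b_def)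
qed

lemma hermite_fun_inverse_square: "hermite_fun n x * hermite_fun n y = poly (hermite n) x * poly (hermite n) y / (2 ^ n * fact n)"
  by (simp add: hermite_fun_def flip: real_sqrt_mult)

text \<open>Induction with the recurrence for the top polynomial. At two zeros of
  \<open>hermite (Suc n)\<close> the right-hand side vanishes, which yields the orthogonality of the
  eigenvectors belonging to different nodes.\<close>

lemma christoffel_darboux_hermite:
  "2 * (x - y) * (\<Sum>k\<le>n. hermite_fun k x * hermite_fun k y) =
     (poly (hermite (Suc n)) x * poly (hermite n) y - poly (hermite n) x * poly (hermite (Suc n)) y) / (2 ^ n * fact n)"
proof (induction n)
  case 0
  show ?case by (simp add: algebra_simps)
next
  case (Suc n)
  define D :: real where "D = 2 ^ n * fact n"
  define m where "m = real (Suc n)"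
  have D: "2 ^ Suc n * fact (Suc n) = 2 * m * D" "D \<noteq> 0" "m \<noteq> 0" by (simp_all add: D_def m_def)
  show ?case
    unfolding sum.atMost_Suc distrib_left Suc hermite_fun_inverse_square[of "Suc n"] poly_hermite_Suc_Suc D(1)
      D_def[symmetric] m_def[symmetric]
    using D(2,3) by (simp add: divide_simps del: hermite.simps) (simp add: algebra_simps del: hermite.simps)
qed

text \<open>The confluent form y = x, by a separate induction with the differentiated recurrence. It
  supplies the norms of the eigenvectors.\<close>

lemma christoffel_darboux_hermite_diag:
  "2 * (\<Sum>k\<le>n. hermite_fun k x * hermite_fun k x) =
     (poly (pderiv (hermite (Suc n))) x * poly (hermite n) x
       - poly (pderiv (hermite n)) x * poly (hermite (Suc n)) x) / (2 ^ n * fact n)"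
proof (induction n)
  case 0
  show ?case by (simp add: pderiv_pCons)
next
  case (Suc n)
  have d: "poly (pderiv (hermite (Suc (Suc n)))) x = 2 * poly (hermite (Suc n)) x
      + 2 * x * poly (pderiv (hermite (Suc n))) x - 2 * real (Suc n) * poly (pderiv (hermite n)) x"
    by (subst hermite.simps)
       (simp only: pderiv_hermite_Suc pderiv_diff pderiv_mult pderiv_smult poly_add poly_diff poly_mult poly_smult,
        simp add: pderiv_pCons algebra_simps del: hermite.simps)
  define D :: real where "D = 2 ^ n * fact n"
  define m where "m = real (Suc n)"
  have D: "2 ^ Suc n * fact (Suc n) = 2 * m * D" "D \<noteq> 0" "m \<noteq> 0" by (simp_all add: D_def m_def)
  show ?case
    unfolding sum.atMost_Suc distrib_left Suc hermite_fun_inverse_square[of "Suc n"] poly_hermite_Suc_Suc d D(1)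
      D_def[symmetric] m_def[symmetric]
    using D(2,3) by (simp add: divide_simps del: hermite.simps) (simp add: algebra_simps del: hermite.simps)
qed

text \<open>The rows of the orthogonal matrix \<open>(Q\<^sub>k\<^sub>,\<^sub>N(z\<^sub>i\<^sub>,\<^sub>N))\<close>: up to normalisation they are
  the eigenvectors \<open>(h\<^sub>0(z), \<dots>, h\<^bsub>N-1\<^esub>(z))\<close> of the Jacobi matrix of the Hermite polynomials, read backwards.\<close>
definition dual_vec :: "nat \<Rightarrow> real \<Rightarrow> nat \<Rightarrow> real" where
  "dual_vec N z k = hermite_fun (N - 1 - k) z / (sqrt N * hermite_fun (N - 1) z)"

lemma hermite_fun_pred_root_nonzero:
  assumes "z \<in> hermite_roots N" shows "hermite_fun (N - 1) z \<noteq> 0"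
proof (cases N)
  case (Suc n)
  then show ?thesis
    using assms hermite_no_common_root[of n z] by (auto simp: hermite_roots_def hermite_fun_def)
qed simp

text \<open>Christoffel-Darboux at zeros of H_N. Off the diagonal the right-hand side is 0; on it,
  H_N' = 2 N H_(N-1) leaves N h_(N-1)(z)^2, exactly the square of the denominator in
  \<open>dual_vec\<close>.\<close>

lemma sum_dual_vec:
  assumes z: "z \<in> hermite_roots N" and w: "w \<in> hermite_roots N"
  shows "(\<Sum>k<N. dual_vec N z k * dual_vec N w k) = (if z = w then 1 else 0)"
proof (cases N)
  case 0
  then show ?thesis using z by (simp add: hermite_roots_def)
next
  case (Suc n)
  have nz: "hermite_fun n z \<noteq> 0" "hermite_fun n w \<noteq> 0"
    using hermite_fun_pred_root_nonzero[OF z] hermite_fun_pred_root_nonzero[OF w] Suc by auto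
  have zero: "poly (hermite (Suc n)) z = 0" "poly (hermite (Suc n)) w = 0"
    using z w Suc by (auto simp: hermite_roots_def simp del: hermite.simps)
  have "(\<Sum>k<N. dual_vec N z k * dual_vec N w k)
      = (\<Sum>k<Suc n. hermite_fun (n - k) z * hermite_fun (n - k) w / (N * hermite_fun n z * hermite_fun n w))"
    by (simp add: dual_vec_def Suc field_simps flip: power2_eq_square)
  also have "\<dots> = (\<Sum>k\<le>n. hermite_fun k z * hermite_fun k w) / (N * hermite_fun n z * hermite_fun n w)"
    unfolding lessThan_Suc_atMost sum_divide_distrib
    by (rule sum.reindex_bij_witness[of _ "\<lambda>i. n - i" "\<lambda>i. n - i"]) auto
  also have "\<dots> = (if z = w then 1 else 0)"
  proof (cases "z = w")
    case True
    have "2 * (\<Sum>k\<le>n. hermite_fun k z * hermite_fun k z) = 2 * (real N * (hermite_fun n z * hermite_fun n z))"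
      unfolding christoffel_darboux_hermite_diag[of z n] pderiv_hermite_Suc poly_smult zero hermite_fun_inverse_square[of n]
      by (simp add: Suc)
    then have "(\<Sum>k\<le>n. hermite_fun k z * hermite_fun k z) = real N * (hermite_fun n z * hermite_fun n z)"
      by (simp only: mult_cancel_left) simp
    then show ?thesis using True nz Suc by simp
  next
    case False
    then show ?thesis
      using christoffel_darboux_hermite[of z w n] zero by (simp del: hermite.simps)
  qed
  finally show ?thesis .
qed

lemma dual_vec_0: "z \<in> hermite_roots N \<Longrightarrow> dual_vec N z 0 = 1 / sqrt N"
  using hermite_fun_pred_root_nonzero[of z N] by (simp add: dual_vec_def)

text \<open>Read backwards, the Hermite recurrence starts at index N, and the condition H_N(z) = 0
  takes over the role of Q_(-1) = 0. This is why the entries obey the recurrence only at the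
  nodes.\<close>

lemma dual_vec_rec_0:
  assumes "z \<in> hermite_roots N" "1 < N"
  shows "z * dual_vec N z 0 = sqrt (real (N - 1) / 2) * dual_vec N z 1"
proof -
  obtain n where n: "N = n + 2" using that[of "N - 2"] assms by simp
  have "hermite_fun (n + 2) z = 0"
    using assms by (simp add: hermite_fun_def hermite_roots_def n del: hermite.simps)
  then have "z * hermite_fun (n + 1) z = sqrt (real (n + 1) / 2) * hermite_fun n z"
    using hermite_fun_rec[of z n] by simp
  then have "z * hermite_fun (n + 1) z / (sqrt N * hermite_fun (n + 1) z)
     = sqrt (real (n + 1) / 2) * hermite_fun n z / (sqrt N * hermite_fun (n + 1) z)" by simp
  moreover have "hermite_fun (n + 1) z \<noteq> 0" using hermite_fun_pred_root_nonzero[OF assms(1)] n by simp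
  ultimately show ?thesis by (simp add: dual_vec_def n add.commute)
qed

lemma dual_vec_rec:
  assumes "k + 2 < N"
  shows "z * dual_vec N z (k + 1) =
    sqrt (real (N - (k + 2)) / 2) * dual_vec N z (k + 2) + sqrt (real (N - (k + 1)) / 2) * dual_vec N z k"
proof -
  obtain n where n: "N = k + 3 + n" using that[of "N - (k + 3)"] assms by simp
  define c where "c = sqrt N * hermite_fun (N - 1) z"
  have "z * hermite_fun (Suc n) z / c = (sqrt (real (n + 2) / 2) * hermite_fun (n + 2) z + sqrt (real (n + 1) / 2) * hermite_fun n z) / c"
    by (simp only: hermite_fun_rec)
  then have "z * (hermite_fun (Suc n) z / c) = sqrt (real (n + 1) / 2) * (hermite_fun n z / c) + sqrt (real (n + 2) / 2) * (hermite_fun (n + 2) z / c)"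
    by (simp add: add_divide_distrib)
  moreover have "N - 1 - (k + 1) = Suc n" "N - 1 - (k + 2) = n" "N - 1 - k = n + 2" "N - (k + 2) = n + 1" "N - (k + 1) = n + 2"
    using n by simp_all
  ultimately show ?thesis by (simp only: dual_vec_def c_def)
qed

text \<open>The recurrence of the dual polynomials solved for its top term; it serves as the witness
  that the defining conditions can be met. For k < N all square roots divided by are positive, which
  gives the positive leading coefficients.\<close>

fun dual_poly :: "nat \<Rightarrow> nat \<Rightarrow> real poly" where
  "dual_poly N 0 = [:1 / sqrt N:]"
| "dual_poly N (Suc 0) = Polynomial.smult (1 / (sqrt (real (N - 1) / 2) * sqrt N)) [:0, 1:]"
| "dual_poly N (Suc (Suc k)) = Polynomial.smult (1 / sqrt (real (N - (k + 2)) / 2))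
     ([:0, 1:] * dual_poly N (Suc k) - Polynomial.smult (sqrt (real (N - (k + 1)) / 2)) (dual_poly N k))"

lemma degree_dual_poly: "k < N \<Longrightarrow> degree (dual_poly N k) = k \<and> lead_coeff (dual_poly N k) > 0"
proof (induction N k rule: dual_poly.induct)
  case (3 N k)
  define A where "A = dual_poly N (Suc k)"
  define B where "B = dual_poly N k"
  define r where "r = [:0, 1:] * A - Polynomial.smult (sqrt (real (N - (k + 1)) / 2)) B"
  have A: "degree A = Suc k" "coeff A (Suc k) > 0" and B: "degree B = k"
    using 3 by (force simp: A_def B_def)+
  have coeff_r: "coeff r (Suc (Suc k)) = coeff A (Suc k)"
    using B by (simp add: r_def coeff_eq_0)
  have "degree r \<le> Suc (Suc k)"
    unfolding r_def using A B by (intro degree_diff_le) (auto intro: order_trans[OF degree_mult_le] simp del: mult_pCons_left)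
  with coeff_r A have "degree r = Suc (Suc k)" by (intro antisym le_degree) auto
  moreover have "dual_poly N (Suc (Suc k)) = Polynomial.smult (1 / sqrt (real (N - (k + 2)) / 2)) r"
    by (simp only: dual_poly.simps r_def A_def B_def)
  ultimately show ?case using 3(3) coeff_r A by simp
qed auto

lemma poly_dual_poly: "k < N \<Longrightarrow> z \<in> hermite_roots N \<Longrightarrow> poly (dual_poly N k) z = dual_vec N z k"
proof (induction N k rule: dual_poly.induct)
  case (1 N)
  then show ?case by (simp add: dual_vec_0)
next
  case (2 N)
  then show ?case using dual_vec_rec_0[of z N] dual_vec_0[of z N] by (simp add: field_simps)
next
  case (3 N k)
  then have "z * dual_vec N z (k + 1) - sqrt (real (N - (k + 1)) / 2) * dual_vec N z k
     = sqrt (real (N - (k + 2)) / 2) * dual_vec N z (k + 2)" using dual_vec_rec[of k N z] by simp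
  moreover have "sqrt (real (N - (k + 2)) / 2) \<noteq> 0" using 3 by simp
  ultimately show ?case using 3 by simp
qed

subsection \<open>The covariance matrix\<close>

text \<open>For a square matrix A A^T = 1 implies A^T A = 1. This turns orthogonality over the index
  k, obtained from Christoffel-Darboux, into orthogonality over the nodes, which defines the dual
  polynomials.\<close>

lemma orthonormal_rows_imp_columns:
  fixes f :: "nat \<Rightarrow> nat \<Rightarrow> real"
  assumes rows: "\<And>i j. i < n \<Longrightarrow> j < n \<Longrightarrow> (\<Sum>k<n. f i k * f j k) = (if i = j then 1 else 0)"
    and "k < n" "l < n"
  shows "(\<Sum>i<n. f i k * f i l) = (if k = l then 1 else 0)"
proof -
  define A where "A = mat n n (\<lambda>(i, k). f i k)"
  have A: "A \<in> carrier_mat n n" "A\<^sup>T \<in> carrier_mat n n" by (auto simp: A_def)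
  have "A * A\<^sup>T = 1\<^sub>m n"
    by (rule eq_matI) (use rows in \<open>auto simp: A_def scalar_prod_def atLeast0LessThan\<close>)
  then have "A\<^sup>T * A = 1\<^sub>m n" by (rule mat_mult_left_right_inverse[OF A])
  then have "(A\<^sup>T * A) $$ (k, l) = (1\<^sub>m n :: real mat) $$ (k, l)" by simp
  then show ?thesis using assms(2,3) by (simp add: A_def scalar_prod_def atLeast0LessThan)
qed

lemma hermite_zero_in_roots: "i \<in> {1..N} \<Longrightarrow> hermite_zero i N \<in> hermite_roots N"
  using hermite_zero_root[of i N] by (simp add: hermite_roots_def)

lemma is_dual_hermite_dual_poly: "is_dual_hermite N (dual_poly N)"
proof -
  have "(\<Sum>i=1..N. poly (dual_poly N k) (hermite_zero i N) * poly (dual_poly N l) (hermite_zero i N)) = (if k = l then 1 else 0)"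
    if "k < N" "l < N" for k l
  proof -
    have "(\<Sum>i<N. dual_vec N (hermite_zero (Suc i) N) k * dual_vec N (hermite_zero (Suc i) N) l) = (if k = l then 1 else 0)"
    proof (rule orthonormal_rows_imp_columns[OF _ that])
      fix i j assume "i < N" "j < N"
      then show "(\<Sum>k<N. dual_vec N (hermite_zero (Suc i) N) k * dual_vec N (hermite_zero (Suc j) N) k) = (if i = j then 1 else 0)"
        by (subst sum_dual_vec) (auto simp: hermite_zero_in_roots hermite_zero_inj)
    qed
    then show ?thesis
      using that by (simp add: sum.atLeast1_atMost_eq poly_dual_poly hermite_zero_in_roots)
  qed
  then show ?thesis unfolding is_dual_hermite_def using degree_dual_poly by blast
qed

section \<open>Uniqueness of the dual polynomials at the nodes\<close>

definition node_inner :: "nat \<Rightarrow> (real \<Rightarrow> real) \<Rightarrow> (real \<Rightarrow> real) \<Rightarrow> real" where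
  "node_inner N f g = (\<Sum>i=1..N. f (hermite_zero i N) * g (hermite_zero i N))"

lemma node_inner_self_eq_0:
  assumes "node_inner N f f = 0" "i \<in> {1..N}" shows "f (hermite_zero i N) = 0"
  using assms sum_nonneg_eq_0_iff[of "{1..N}" "\<lambda>i. f (hermite_zero i N) * f (hermite_zero i N)"]
  by (simp add: node_inner_def)

text \<open>Remove the top coefficient of p by a multiple of Q m and descend. Bounding the degree
  through vanishing coefficients lets m = 0 mean p = 0, which \<open>degree\<close> cannot
  express.\<close>

lemma dual_orthogonal_low_degree:
  assumes Q: "is_dual_hermite N Q" and "m \<le> k" "k < N" "\<And>i. i \<ge> m \<Longrightarrow> coeff p i = 0"
  shows "node_inner N (poly p) (poly (Q k)) = 0"
  using assms(2,4)
proof (induction m arbitrary: p)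
  case 0
  then have "p = 0" by (intro poly_eqI) simp
  then show ?case by (simp add: node_inner_def)
next
  case (Suc m)
  have Qm: "degree (Q m) = m" "lead_coeff (Q m) > 0" "node_inner N (poly (Q m)) (poly (Q k)) = 0"
    using Q Suc.prems(1) \<open>k < N\<close> unfolding is_dual_hermite_def node_inner_def
    by (meson Suc_le_lessD less_trans, meson Suc_le_lessD less_trans, auto)
  define c where "c = coeff p m / lead_coeff (Q m)"
  have "coeff (p - Polynomial.smult c (Q m)) i = 0" if "i \<ge> m" for i
  proof (cases "i = m")
    case False
    then show ?thesis using that Suc.prems(2)[of i] Qm by (simp add: coeff_eq_0)
  qed (use Qm in \<open>simp add: c_def\<close>)
  then have "node_inner N (poly (p - Polynomial.smult c (Q m))) (poly (Q k)) = 0"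
    using Suc by simp
  moreover have "node_inner N (poly (p - Polynomial.smult c (Q m))) (poly (Q k))
      = node_inner N (poly p) (poly (Q k)) - c * node_inner N (poly (Q m)) (poly (Q k))"
    by (simp add: node_inner_def algebra_simps sum_subtractf sum_distrib_left)
  ultimately show ?case using Qm by simp
qed

text \<open>After matching leading coefficients, d = Q k - c R k has degree below k and is
  orthogonal to both Q k and R k, hence to itself. The norms then give c^2 = 1 and the positive
  leading coefficients c = 1. Agreement at the nodes makes every choice of \<open>SOME\<close> in
  \<open>dual_hermite\<close> yield the same values there.\<close>

lemma is_dual_hermite_unique:
  assumes Q: "is_dual_hermite N Q" and R: "is_dual_hermite N R" and k: "k < N" and i: "i \<in> {1..N}"
  shows "poly (Q k) (hermite_zero i N) = poly (R k) (hermite_zero i N)"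
proof -
  have deg: "degree (Q k) = k" "degree (R k) = k" "coeff (Q k) k > 0" "coeff (R k) k > 0"
    and norm: "node_inner N (poly (Q k)) (poly (Q k)) = 1" "node_inner N (poly (R k)) (poly (R k)) = 1"
    using Q R k by (auto simp: is_dual_hermite_def node_inner_def)
  define c where "c = coeff (Q k) k / coeff (R k) k"
  have "c > 0" using deg by (simp add: c_def)
  define d where "d = Q k - Polynomial.smult c (R k)"
  have "coeff d i = 0" if "i \<ge> k" for i
    using that deg by (cases "i = k") (auto simp: d_def c_def coeff_eq_0)
  then have orth: "node_inner N (poly d) (poly (Q k)) = 0" "node_inner N (poly d) (poly (R k)) = 0"
    using dual_orthogonal_low_degree[OF Q order.refl k] dual_orthogonal_low_degree[OF R order.refl k] by auto
  have "node_inner N (poly d) (poly d) = node_inner N (poly d) (poly (Q k)) - c * node_inner N (poly d) (poly (R k))"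
    by (simp add: d_def node_inner_def algebra_simps sum_subtractf sum_distrib_left sum.distrib)
  then have "poly d (hermite_zero i N) = 0" if "i \<in> {1..N}" for i
    using node_inner_self_eq_0[of N "poly d"] orth that by simp
  then have eq: "poly (Q k) (hermite_zero i N) = c * poly (R k) (hermite_zero i N)" if "i \<in> {1..N}" for i
    using that by (auto simp: d_def)
  then have "node_inner N (poly (Q k)) (poly (Q k)) = c\<^sup>2 * node_inner N (poly (R k)) (poly (R k))"
    unfolding node_inner_def sum_distrib_left by (intro sum.cong) (auto simp: power2_eq_square)
  then have "c = 1" using norm \<open>c > 0\<close> by (simp add: power2_eq_1_iff)
  then show ?thesis using eq i by simp
qed

lemma poly_dual_hermite:
  assumes "k < N" "i \<in> {1..N}"
  shows "poly (dual_hermite k N) (hermite_zero i N) = dual_vec N (hermite_zero i N) k"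
proof -
  have "is_dual_hermite N (\<lambda>k. dual_hermite k N)"
    unfolding dual_hermite_def using someI[of "is_dual_hermite N", OF is_dual_hermite_dual_poly] by simp
  from is_dual_hermite_unique[OF this is_dual_hermite_dual_poly assms]
  show ?thesis using assms by (simp add: poly_dual_poly hermite_zero_in_roots)
qed

section \<open>The spectrum of the matrix S_N\<close>

text \<open>Stieltjes' equilibrium relation: at a simple zero z, H''(z) / H'(z) is twice the sum on
  the left, while Hermite's differential equation at z reads H''(z) = 2 z H'(z).\<close>

lemma sum_inverse_diff_hermite_roots:
  assumes z: "z \<in> hermite_roots N"
  shows "(\<Sum>w\<in>hermite_roots N - {z}. 1 / (z - w)) = z"
proof -
  define p where "p = (\<Prod>s\<in>hermite_roots N - {z}. [:-s, 1::real:])"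
  have pz: "poly p z \<noteq> 0" by (auto simp: p_def poly_prod)
  have fac: "(\<Prod>s\<in>hermite_roots N. [:-s, 1::real:]) = [:-z, 1:] * p"
    using z by (simp add: p_def prod.remove del: mult_pCons_left)
  have "(\<Prod>s\<in>hermite_roots N. [:-s, 1::real:]) dvd hermite N"
    by (rule prod_linear_factors_dvd) (simp, simp add: hermite_roots_def)
  then obtain g where g: "hermite N = [:-z, 1:] * p * g" unfolding fac by (auto elim: dvdE)
  have "degree ([:-z, 1:] * p) = N"
    unfolding fac[symmetric] by (subst degree_prod_eq_sum_degree) (auto simp: card_hermite_roots)
  then have "degree g = 0"
    using degree_hermite[of N] hermite_nonzero[of N] unfolding g by (subst (asm) degree_mult_eq) auto
  then obtain c where c: "g = [:c:]" by (metis degree_eq_zeroE)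
  then have "c \<noteq> 0" using hermite_nonzero[of N] g by auto
  have h: "hermite N = Polynomial.smult c ([:-z, 1:] * p)" by (simp add: g c)
  have "poly (pderiv (pderiv (hermite N))) z = 2 * c * poly (pderiv p) z"
    "poly (pderiv (hermite N)) z = c * poly p z"
    unfolding h pderiv_smult pderiv_mult pderiv_add by (simp_all add: pderiv_pCons)
  moreover have "poly (hermite N) z = 0" using z by (simp add: hermite_roots_def)
  ultimately have "poly (pderiv p) z = z * poly p z"
    using pderiv2_hermite[of N z] \<open>c \<noteq> 0\<close> by simp
  moreover have "poly (pderiv p) z = (\<Sum>w\<in>hermite_roots N - {z}. poly p z / (z - w))"
    unfolding p_def pderiv_prod poly_sum poly_mult poly_prod
    by (intro sum.cong refl) (simp add: pderiv_pCons prod.remove[of "hermite_roots N - {z}"])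
  ultimately have "poly p z * (\<Sum>w\<in>hermite_roots N - {z}. 1 / (z - w)) = poly p z * z"
    by (simp add: sum_distrib_left mult.commute)
  with pz show ?thesis by simp
qed

text \<open>This is S_N - 1 acting on functions on the nodes; the name refers to the Calogero-Moser
  particle system.\<close>

definition calogero :: "nat \<Rightarrow> (real \<Rightarrow> real) \<Rightarrow> real \<Rightarrow> real" where
  "calogero N f z = (\<Sum>w\<in>hermite_roots N - {z}. (f z - f w) / (z - w)\<^sup>2)"

text \<open>A discrete Hilbert transform. It arises as the commutator of \<open>calogero\<close>
  with multiplication by the argument.\<close>

definition cauchy_sum :: "nat \<Rightarrow> (real \<Rightarrow> real) \<Rightarrow> real \<Rightarrow> real" where
  "cauchy_sum N f z = (\<Sum>w\<in>hermite_roots N - {z}. f w / (z - w))"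

lemma calogero_mult_arg:
  "calogero N (\<lambda>x. x * f x) z = z * calogero N f z + cauchy_sum N f z"
  unfolding calogero_def cauchy_sum_def sum_distrib_left sum.distrib[symmetric]
proof (intro sum.cong refl)
  fix w assume "w \<in> hermite_roots N - {z}"
  then have "z - w \<noteq> 0" by simp
  moreover have "z * f z - w * f w = z * (f z - f w) + (z - w) * f w" by (simp add: algebra_simps)
  ultimately show "(z * f z - w * f w) / (z - w)\<^sup>2 = z * ((f z - f w) / (z - w)\<^sup>2) + f w / (z - w)"
    by (simp add: add_divide_distrib power2_eq_square)
qed

lemma cauchy_sum_mult_arg:
  assumes "z \<in> hermite_roots N"
  shows "cauchy_sum N (\<lambda>x. x * f x) z = z * cauchy_sum N f z + f z - (\<Sum>w\<in>hermite_roots N. f w)"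
proof -
  have "cauchy_sum N (\<lambda>x. x * f x) z = (\<Sum>w\<in>hermite_roots N - {z}. z * (f w / (z - w)) - f w)"
    unfolding cauchy_sum_def
  proof (intro sum.cong refl)
    fix w assume "w \<in> hermite_roots N - {z}"
    then have "z - w \<noteq> 0" by simp
    then show "w * f w / (z - w) = z * (f w / (z - w)) - f w" by (simp add: field_simps)
  qed
  then show ?thesis
    using assms by (simp add: cauchy_sum_def sum_subtractf sum_distrib_left sum.remove[of "hermite_roots N" z])
qed

text \<open>The start k = 0 is Stieltjes' relation. Each further factor x multiplies the result by z
  and adds z^k minus a constant, which is two degrees below the leading term.\<close>

lemma cauchy_sum_monomial:
  "\<exists>s. (\<forall>i\<ge>k. coeff s i = 0) \<and> (\<forall>z\<in>hermite_roots N. cauchy_sum N (\<lambda>x. x ^ k) z = z ^ Suc k + poly s z)"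
proof (induction k)
  case 0
  then show ?case
    by (intro exI[of _ 0]) (simp add: cauchy_sum_def sum_inverse_diff_hermite_roots)
next
  case (Suc k)
  then obtain s where s: "\<forall>i\<ge>k. coeff s i = 0"
    "\<forall>z\<in>hermite_roots N. cauchy_sum N (\<lambda>x. x ^ k) z = z ^ Suc k + poly s z" by blast
  show ?case
  proof (intro exI[of _ "[:0, 1:] * s + monom 1 k - [:\<Sum>w\<in>hermite_roots N. w ^ k:]"] conjI allI impI ballI)
    fix i assume "i \<ge> Suc k"
    then show "coeff ([:0, 1:] * s + monom 1 k - [:\<Sum>w\<in>hermite_roots N. w ^ k:]) i = 0"
      using s by (cases i) (auto simp: coeff_pCons)
  next
    fix z assume z: "z \<in> hermite_roots N"
    show "cauchy_sum N (\<lambda>x. x ^ Suc k) z = z ^ Suc (Suc k) + poly ([:0, 1:] * s + monom 1 k - [:\<Sum>w\<in>hermite_roots N. w ^ k:]) z"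
      using cauchy_sum_mult_arg[OF z, of "\<lambda>x. x ^ k"] s z by (simp add: poly_monom algebra_simps)
  qed
qed

text \<open>The commutator contributes one more z^(k+1) each time a factor x is pulled out, which is
  how the eigenvalue k builds up on the diagonal of a triangular operator.\<close>

lemma calogero_monomial:
  "\<exists>t. (\<forall>i\<ge>k. coeff t i = 0) \<and> (\<forall>z\<in>hermite_roots N. calogero N (\<lambda>x. x ^ k) z = real k * z ^ k + poly t z)"
proof (induction k)
  case 0
  then show ?case by (intro exI[of _ 0]) (simp add: calogero_def)
next
  case (Suc k)
  then obtain t where t: "\<forall>i\<ge>k. coeff t i = 0"
    "\<forall>z\<in>hermite_roots N. calogero N (\<lambda>x. x ^ k) z = real k * z ^ k + poly t z" by blast
  obtain s where s: "\<forall>i\<ge>k. coeff s i = 0"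
    "\<forall>z\<in>hermite_roots N. cauchy_sum N (\<lambda>x. x ^ k) z = z ^ Suc k + poly s z"
    using cauchy_sum_monomial by blast
  show ?case
  proof (intro exI[of _ "[:0, 1:] * t + s"] conjI allI impI ballI)
    fix i assume "i \<ge> Suc k"
    then show "coeff ([:0, 1:] * t + s) i = 0"
      using s t by (cases i) (auto simp: coeff_pCons)
  next
    fix z assume "z \<in> hermite_roots N"
    then show "calogero N (\<lambda>x. x ^ Suc k) z = real (Suc k) * z ^ Suc k + poly ([:0, 1:] * t + s) z"
      using calogero_mult_arg[of N "\<lambda>x. x ^ k" z] s t by (simp add: algebra_simps)
  qed
qed

lemma calogero_add: "calogero N (\<lambda>x. f x + g x) z = calogero N f z + calogero N g z"
  by (simp add: calogero_def add_diff_add add_divide_distrib flip: sum.distrib)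

lemma calogero_scale: "calogero N (\<lambda>x. c * f x) z = c * calogero N f z"
  by (simp add: calogero_def sum_distrib_left flip: right_diff_distrib)

lemma calogero_poly:
  assumes "\<And>i. i \<ge> m \<Longrightarrow> coeff p i = 0"
  shows "\<exists>q. (\<forall>i\<ge>m. coeff q i = 0) \<and> (\<forall>z\<in>hermite_roots N. calogero N (poly p) z = poly q z)"
  using assms
proof (induction m arbitrary: p)
  case 0
  then have "p = 0" by (intro poly_eqI) simp
  then show ?case by (intro exI[of _ 0]) (simp add: calogero_def)
next
  case (Suc m)
  define c where "c = coeff p m"
  define p' where "p' = p - monom c m"
  have "coeff p' i = 0" if "i \<ge> m" for i
    using Suc.prems[of i] that by (cases "i = m") (auto simp: p'_def c_def)
  then obtain q where q: "\<forall>i\<ge>m. coeff q i = 0" "\<forall>z\<in>hermite_roots N. calogero N (poly p') z = poly q z"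
    using Suc.IH by blast
  obtain t where t: "\<forall>i\<ge>m. coeff t i = 0"
    "\<forall>z\<in>hermite_roots N. calogero N (\<lambda>x. x ^ m) z = real m * z ^ m + poly t z"
    using calogero_monomial by blast
  have p: "poly p = (\<lambda>x. poly p' x + c * x ^ m)" by (auto simp: p'_def poly_monom)
  show ?case
    using q t unfolding p calogero_add calogero_scale
    by (intro exI[of _ "q + monom (c * m) m + Polynomial.smult c t"]) (auto simp: poly_monom algebra_simps)
qed

lemma calogero_poly_lead:
  assumes "degree p = k"
  shows "\<exists>q. (\<forall>i\<ge>k. coeff q i = 0) \<and> (\<forall>z\<in>hermite_roots N. calogero N (poly p) z = real k * poly p z + poly q z)"
proof -
  define c where "c = coeff p k"
  define p' where "p' = p - monom c k"
  have p'0: "coeff p' i = 0" if "i \<ge> k" for i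
    using assms that by (cases "i = k") (auto simp: p'_def c_def coeff_eq_0)
  then obtain q where q: "\<forall>i\<ge>k. coeff q i = 0" "\<forall>z\<in>hermite_roots N. calogero N (poly p') z = poly q z"
    using calogero_poly[of k p'] by blast
  obtain t where t: "\<forall>i\<ge>k. coeff t i = 0"
    "\<forall>z\<in>hermite_roots N. calogero N (\<lambda>x. x ^ k) z = real k * z ^ k + poly t z"
    using calogero_monomial by blast
  have p: "poly p = (\<lambda>x. poly p' x + c * x ^ k)" by (auto simp: p'_def poly_monom)
  show ?thesis
    using q t p'0 unfolding p calogero_add calogero_scale
    by (intro exI[of _ "q + Polynomial.smult c t - Polynomial.smult (real k) p'"]) (auto simp: algebra_simps)
qed

lemma sum_hermite_zero: "(\<Sum>i=1..N. f (hermite_zero i N)) = (\<Sum>z\<in>hermite_roots N. f z)"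
  using sum.reindex_bij_betw[OF bij_betw_hermite_zero] by blast

lemma node_inner_roots: "node_inner N f g = (\<Sum>z\<in>hermite_roots N. f z * g z)"
  unfolding node_inner_def by (rule sum_hermite_zero)

text \<open>Exchanging z and w in the double sum and averaging gives the symmetric Dirichlet form
  with terms (f z - f w) (g z - g w) / (z - w)^2.\<close>

lemma node_inner_calogero_commute: "node_inner N (calogero N f) g = node_inner N f (calogero N g)"
proof -
  let ?Z = "hermite_roots N"
  \<comment> \<open>The diagonal term added here is 0 / 0, which is 0.\<close>
  have full: "calogero N h z = (\<Sum>w\<in>?Z. (h z - h w) / (z - w)\<^sup>2)" if "z \<in> ?Z" for h :: "real \<Rightarrow> real" and z
    using that by (simp add: calogero_def sum.remove[of ?Z z])
  have expand: "node_inner N (calogero N f) g = (\<Sum>z\<in>?Z. \<Sum>w\<in>?Z. (f z - f w) * g z / (z - w)\<^sup>2)" for f g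
    unfolding node_inner_roots by (intro sum.cong refl) (simp add: full sum_distrib_right)
  have "2 * node_inner N (calogero N f) g = (\<Sum>z\<in>?Z. \<Sum>w\<in>?Z. (f z - f w) * (g z - g w) / (z - w)\<^sup>2)" for f g
  proof -
    have "(\<Sum>z\<in>?Z. \<Sum>w\<in>?Z. (f z - f w) * g z / (z - w)\<^sup>2) = (\<Sum>z\<in>?Z. \<Sum>w\<in>?Z. (f w - f z) * g w / (w - z)\<^sup>2)"
      by (rule sum.swap)
    then have "2 * node_inner N (calogero N f) g
      = (\<Sum>z\<in>?Z. \<Sum>w\<in>?Z. (f z - f w) * g z / (z - w)\<^sup>2 + (f w - f z) * g w / (w - z)\<^sup>2)"
      unfolding expand sum.distrib by simp
    also have "\<dots> = (\<Sum>z\<in>?Z. \<Sum>w\<in>?Z. (f z - f w) * (g z - g w) / (z - w)\<^sup>2)"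
      by (intro sum.cong refl) (simp add: power2_commute[of _ "_ :: real"] algebra_simps flip: add_divide_distrib)
    finally show ?thesis .
  qed
  from this[of f g] this[of g f] show ?thesis
    by (simp add: node_inner_def mult.commute)
qed

text \<open>Triangularity leaves a defect q of degree below k. By symmetry its squared norm is the
  inner product of Q k with the image of q, minus k times that of Q k with q; both q and its image
  have degree below k, so both products vanish. Hence q is zero at every node.\<close>

lemma calogero_eigen:
  assumes k: "k < N" and z: "z \<in> hermite_roots N"
  shows "calogero N (poly (dual_poly N k)) z = real k * poly (dual_poly N k) z"
proof -
  let ?Q = "dual_poly N k"
  obtain q where q: "\<forall>i\<ge>k. coeff q i = 0"
    "\<forall>z\<in>hermite_roots N. calogero N (poly ?Q) z = real k * poly ?Q z + poly q z"
    using calogero_poly_lead[of ?Q k N] degree_dual_poly[OF k] by blast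
  obtain q2 where q2: "\<forall>i\<ge>k. coeff q2 i = 0" "\<forall>z\<in>hermite_roots N. calogero N (poly q) z = poly q2 z"
    using calogero_poly[of k q N] q by blast
  have orth: "node_inner N (poly p) (poly ?Q) = 0" if "\<forall>i\<ge>k. coeff p i = 0" for p
    using dual_orthogonal_low_degree[OF is_dual_hermite_dual_poly order.refl k] that by blast
  have "node_inner N (poly q) (poly q) = node_inner N (calogero N (poly ?Q)) (poly q) - real k * node_inner N (poly q) (poly ?Q)"
    unfolding node_inner_roots sum_distrib_left sum_subtractf[symmetric]
    by (intro sum.cong refl) (simp add: q algebra_simps)
  also have "node_inner N (calogero N (poly ?Q)) (poly q) = node_inner N (poly ?Q) (calogero N (poly q))"
    by (rule node_inner_calogero_commute)
  also have "\<dots> = node_inner N (poly q2) (poly ?Q)"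
    unfolding node_inner_roots by (intro sum.cong refl) (simp add: q2)
  finally have "node_inner N (poly q) (poly q) = 0" using orth q(1) q2(1) by simp
  then have "poly q (hermite_zero i N) = 0" if "i \<in> {1..N}" for i
    using node_inner_self_eq_0 that by blast
  moreover obtain i where "i \<in> {1..N}" "z = hermite_zero i N"
    using bij_betw_imp_surj_on[OF bij_betw_hermite_zero] z by blast
  ultimately show ?thesis using q(2) z by simp
qed

lemma bij_betw_remove: "bij_betw f A B \<Longrightarrow> a \<in> A \<Longrightarrow> bij_betw f (A - {a}) (B - {f a})"
  by (auto simp: bij_betw_def inj_on_def)

text \<open>The spectral decomposition of the inverse: the candidate B is the sum of the rank-one
  projections onto the eigenvectors, each divided by its eigenvalue k + 1.\<close>

lemma cov_entry_eq:
  assumes "i \<in> {1..N}"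
  shows "cov_entry N i i = (\<Sum>k<N. (dual_vec N (hermite_zero i N) k)\<^sup>2 / real (k + 1))"
proof -
  define z where "z j = hermite_zero (Suc j) N" for j
  define u where "u = dual_vec N"
  have root: "z j \<in> hermite_roots N" if "j < N" for j using that by (simp add: z_def hermite_zero_in_roots)
  have z_eq: "z j = z l \<longleftrightarrow> j = l" if "j < N" "l < N" for j l using that by (simp add: z_def hermite_zero_inj)
  have bij: "bij_betw z {..<N} (hermite_roots N)"
    using bij_betw_trans[of Suc "{..<N}" "{1..N}" "\<lambda>i. hermite_zero i N" "hermite_roots N"] bij_betw_hermite_zero
    by (auto simp: z_def[abs_def] o_def bij_betw_def image_Suc_lessThan)
  define B where "B = mat N N (\<lambda>(j, l). \<Sum>k<N. u (z j) k * u (z l) k / real (k + 1))"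
  have carrier: "S_mat N \<in> carrier_mat N N" "B \<in> carrier_mat N N" by (auto simp: S_mat_def B_def)
  have eigen: "(\<Sum>l<N. S_mat N $$ (j, l) * u (z l) k) = real (k + 1) * u (z j) k" if "j < N" "k < N" for j k
  proof -
    have Scol: "S_mat N $$ (j, l) = (if l = j then 1 + (\<Sum>w\<in>hermite_roots N - {z j}. 1 / (z j - w)\<^sup>2) else - (1 / (z j - z l)\<^sup>2))"
      if "l < N" for l
    proof -
      have "hermite_zero (Suc j) N \<in> hermite_roots N" using root[OF \<open>j < N\<close>] by (simp add: z_def)
      then have "bij_betw (\<lambda>i. hermite_zero i N) ({1..N} - {Suc j}) (hermite_roots N - {z j})"
        using bij_betw_remove[OF bij_betw_hermite_zero, of "Suc j" N] \<open>j < N\<close> by (simp add: z_def)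
      then have "(\<Sum>l\<in>{1..N} - {Suc j}. 1 / (z j - hermite_zero l N)\<^sup>2) = (\<Sum>w\<in>hermite_roots N - {z j}. 1 / (z j - w)\<^sup>2)"
        by (rule sum.reindex_bij_betw)
      then show ?thesis using that \<open>j < N\<close> by (simp add: S_mat_def z_def)
    qed
    have "(\<Sum>l<N. S_mat N $$ (j, l) * u (z l) k)
       = S_mat N $$ (j, j) * u (z j) k + (\<Sum>l\<in>{..<N} - {j}. S_mat N $$ (j, l) * u (z l) k)"
      using \<open>j < N\<close> by (subst sum.remove[of _ j]) auto
    also have "(\<Sum>l\<in>{..<N} - {j}. S_mat N $$ (j, l) * u (z l) k) = (\<Sum>l\<in>{..<N} - {j}. - (u (z l) k / (z j - z l)\<^sup>2))"
      by (intro sum.cong) (auto simp: Scol)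
    also have "\<dots> = (\<Sum>w\<in>hermite_roots N - {z j}. - (u w k / (z j - w)\<^sup>2))"
      using \<open>j < N\<close> by (intro sum.reindex_bij_betw[of z] bij_betw_remove bij) auto
    also have "S_mat N $$ (j, j) * u (z j) k + \<dots> = u (z j) k + calogero N (\<lambda>x. u x k) (z j)"
      using \<open>j < N\<close> by (simp add: Scol calogero_def algebra_simps sum_distrib_left diff_divide_distrib sum_subtractf sum_negf)
    also have "calogero N (\<lambda>x. u x k) (z j) = calogero N (poly (dual_poly N k)) (z j)"
      unfolding calogero_def using root[OF \<open>j < N\<close>] \<open>k < N\<close> by (intro sum.cong) (auto simp: u_def poly_dual_poly)
    also have "\<dots> = real k * u (z j) k"
      using calogero_eigen[OF \<open>k < N\<close> root[OF \<open>j < N\<close>]] poly_dual_poly root[OF \<open>j < N\<close>] \<open>k < N\<close> by (simp add: u_def)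
    finally show ?thesis by (simp add: algebra_simps)
  qed
  have "S_mat N * B = 1\<^sub>m N"
  proof (rule eq_matI)
    fix j l assume "j < dim_row (1\<^sub>m N :: real mat)" "l < dim_col (1\<^sub>m N :: real mat)"
    then have jl: "j < N" "l < N" by auto
    have "(S_mat N * B) $$ (j, l) = (\<Sum>m<N. S_mat N $$ (j, m) * (\<Sum>k<N. u (z m) k * u (z l) k / real (k + 1)))"
      using jl carrier by (simp add: scalar_prod_def atLeast0LessThan B_def)
    also have "\<dots> = (\<Sum>k<N. (\<Sum>m<N. S_mat N $$ (j, m) * u (z m) k) * (u (z l) k / real (k + 1)))"
      unfolding sum_distrib_left sum_distrib_right by (subst sum.swap) (simp add: mult_ac)
    also have "\<dots> = (\<Sum>k<N. u (z j) k * u (z l) k)"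
      using jl by (intro sum.cong refl) (simp add: eigen del: of_nat_Suc)
    also have "\<dots> = (1\<^sub>m N :: real mat) $$ (j, l)"
      using jl by (simp add: u_def sum_dual_vec root z_eq)
    finally show "(S_mat N * B) $$ (j, l) = (1\<^sub>m N :: real mat) $$ (j, l)" .
  qed (use carrier in auto)
  moreover have "B * S_mat N = 1\<^sub>m N" using mat_mult_left_right_inverse[OF carrier] calculation by blast
  \<comment> \<open>\<open>mat_inverse\<close> returns \<open>None\<close> only for non-units, so
    this gives meaning to the \<open>the\<close> in \<open>Sigma_mat\<close>; uniqueness of inverses
    then identifies the result with B.\<close>
  ultimately have "S_mat N \<in> Units (ring_mat TYPE(real) N ())"
    using carrier by (auto simp: Units_def ring_mat_def)
  then obtain C where C: "mat_inverse (S_mat N) = Some C"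
    using mat_inverse(1)[OF carrier(1)] by fastforce
  then have C': "C * S_mat N = 1\<^sub>m N" "C \<in> carrier_mat N N" using mat_inverse(2)[OF carrier(1)] by auto
  have "C = C * (S_mat N * B)" using \<open>S_mat N * B = 1\<^sub>m N\<close> C' by simp
  also have "\<dots> = (C * S_mat N) * B" using assoc_mult_mat[OF C'(2) carrier] by simp
  also have "\<dots> = B" using C' carrier by simp
  finally have "Sigma_mat N = B" by (simp add: Sigma_mat_def C)
  then show ?thesis
    using assms by (cases i) (auto simp: cov_entry_def B_def z_def u_def power2_eq_square)
qed

subsection \<open>The Airy function\<close>

fun airy_coeff :: "real \<Rightarrow> real \<Rightarrow> nat \<Rightarrow> real" where
  "airy_coeff p q 0 = p"
| "airy_coeff p q (Suc 0) = q"
| "airy_coeff p q (Suc (Suc 0)) = 0"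
| "airy_coeff p q (Suc (Suc (Suc n))) = airy_coeff p q n / (real (n + 3) * real (n + 2))"

text \<open>With R = 2 |x| + 1, three steps of the recurrence do not increase |c n| R^n once n + 1
  >= K R^3, so this sequence is bounded by its first entries. As |x| <= R / 2, the series is
  dominated by a geometric one of ratio 1/2.\<close>

lemma summable_step3:
  fixes c :: "nat \<Rightarrow> real"
  assumes step: "\<And>n. \<bar>c (n + 3)\<bar> \<le> \<bar>c n\<bar> * K / real (n + 1)" and K: "K \<ge> 0"
  shows "summable (\<lambda>n. \<bar>c n * x ^ n\<bar>)"
proof -
  define R where "R = 2 * \<bar>x\<bar> + 1"
  have R: "R > 0" by (simp add: R_def)
  define M where "M = nat \<lceil>K * R ^ 3\<rceil>"
  define B where "B = Max ((\<lambda>n. \<bar>c n\<bar> * R ^ n) ` {..M + 2})"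
  have B: "\<bar>c n\<bar> * R ^ n \<le> B" for n
  proof (induction n rule: less_induct)
    case (less n)
    show ?case
    proof (cases "n \<le> M + 2")
      case True
      then show ?thesis by (auto simp: B_def)
    next
      case False
      then obtain k where k: "n = k + 3" "M \<le> k"
        using that[of "n - 3"] by simp
      have "K * R ^ 3 \<le> real M" by (simp add: M_def real_nat_ceiling_ge)
      then have le1: "K * R ^ 3 / real (k + 1) \<le> 1" using k by (simp add: divide_le_eq)
      have "\<bar>c n\<bar> * R ^ n \<le> (\<bar>c k\<bar> * K / real (k + 1)) * R ^ n"
        using step[of k] R k by (intro mult_right_mono) auto
      also have "\<dots> = (\<bar>c k\<bar> * R ^ k) * (K * R ^ 3 / real (k + 1))"
        by (simp add: k power_add)
      also have "\<dots> \<le> (\<bar>c k\<bar> * R ^ k) * 1"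
        using le1 R by (intro mult_left_mono) auto
      also have "\<dots> \<le> B" using less[of k] k by simp
      finally show ?thesis .
    qed
  qed
  show ?thesis
  proof (rule summable_comparison_test')
    show "summable (\<lambda>n. B * (1 / 2) ^ n)" by (intro summable_mult summable_geometric) simp
    fix n :: nat
    have "\<bar>x\<bar> ^ n \<le> (R / 2) ^ n" by (intro power_mono) (auto simp: R_def)
    then have "\<bar>c n\<bar> * \<bar>x\<bar> ^ n \<le> \<bar>c n\<bar> * (R / 2) ^ n" by (intro mult_left_mono) auto
    also have "\<dots> = (\<bar>c n\<bar> * R ^ n) * (1 / 2) ^ n" by (simp add: power_divide)
    also have "\<dots> \<le> B * (1 / 2) ^ n" using B by (intro mult_right_mono) auto
    finally show "norm \<bar>c n * x ^ n\<bar> \<le> B * (1 / 2) ^ n" by (simp add: abs_mult power_abs)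
  qed
qed

lemma abs_summable_airy_coeff: "summable (\<lambda>n. \<bar>airy_coeff p q n * x ^ n\<bar>)"
proof (rule summable_step3[where K = 1])
  fix n
  have "\<bar>airy_coeff p q (n + 3)\<bar> = \<bar>airy_coeff p q n\<bar> / (real (n + 3) * real (n + 2))"
    by (simp add: numeral_3_eq_3)
  also have "\<dots> \<le> \<bar>airy_coeff p q n\<bar> / real (n + 1)"
  proof (rule divide_left_mono)
    have "real (n + 1) * 1 \<le> real (n + 3) * real (n + 2)" by (intro mult_mono) auto
    then show "real (n + 1) \<le> real (n + 3) * real (n + 2)" by simp
  qed auto
  finally show "\<bar>airy_coeff p q (n + 3)\<bar> \<le> \<bar>airy_coeff p q n\<bar> * 1 / real (n + 1)" by simp
qed simp

lemma summable_airy_coeff: "summable (\<lambda>n. airy_coeff p q n * x ^ n)"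
  by (rule summable_rabs_cancel[OF abs_summable_airy_coeff])

definition airy_sol :: "real \<Rightarrow> real \<Rightarrow> real \<Rightarrow> real" where
  "airy_sol p q x = (\<Sum>n. airy_coeff p q n * x ^ n)"

definition airy_sol' :: "real \<Rightarrow> real \<Rightarrow> real \<Rightarrow> real" where
  "airy_sol' p q x = (\<Sum>n. diffs (airy_coeff p q) n * x ^ n)"

lemma summable_diffs_airy_coeff: "summable (\<lambda>n. diffs (airy_coeff p q) n * x ^ n)"
  by (rule termdiff_converges_all) (rule summable_airy_coeff)

lemma DERIV_airy_sol: "(airy_sol p q has_real_derivative airy_sol' p q x) (at x)"
  unfolding airy_sol_def[abs_def] airy_sol'_def
  by (rule termdiffs_strong_converges_everywhere) (rule summable_airy_coeff)

lemma DERIV_airy_sol': "(airy_sol' p q has_real_derivative x * airy_sol p q x) (at x)"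
proof -
  let ?c = "airy_coeff p q"
  have "(airy_sol' p q has_real_derivative (\<Sum>n. diffs (diffs ?c) n * x ^ n)) (at x)"
    unfolding airy_sol'_def[abs_def]
    by (rule termdiffs_strong_converges_everywhere) (rule summable_diffs_airy_coeff)
  moreover have "(\<lambda>n. diffs (diffs ?c) n * x ^ n) sums (x * airy_sol p q x)"
  proof (rule sums_Suc_imp)
    show "diffs (diffs ?c) 0 * x ^ 0 = 0" by (simp add: diffs_def)
    have "diffs (diffs ?c) (Suc n) = ?c n" for n
      by (simp add: diffs_def divide_simps)
    then show "(\<lambda>n. diffs (diffs ?c) (Suc n) * x ^ Suc n) sums (x * airy_sol p q x)"
      unfolding airy_sol_def using sums_mult[OF summable_sums[OF summable_airy_coeff[of p q x]], of x]
      by (simp add: mult_ac)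
  qed
  ultimately show ?thesis by (simp add: sums_iff)
qed

lemma airy_sol_0 [simp]: "airy_sol p q 0 = p" "airy_sol' p q 0 = q"
  unfolding airy_sol_def airy_sol'_def powser_zero by (simp_all add: diffs_def)

lemma wronskian_const:
  fixes f g :: "real \<Rightarrow> real"
  assumes "\<And>x. (f has_real_derivative f' x) (at x)" "\<And>x. (f' has_real_derivative x * f x) (at x)"
    and "\<And>x. (g has_real_derivative g' x) (at x)" "\<And>x. (g' has_real_derivative x * g x) (at x)"
  shows "f x * g' x - f' x * g x = f 0 * g' 0 - f' 0 * g 0"
proof -
  have "((\<lambda>x. f x * g' x - f' x * g x) has_real_derivative 0) (at x)" for x
    by (rule derivative_eq_intros assms refl)+ (simp add: algebra_simps)
  then show ?thesis using DERIV_isconst_all by blast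
qed

text \<open>The Wronskians of y with the two basic solutions are constant, and those two have
  Wronskian 1; eliminating y' gives the representation.\<close>

lemma airy_ode_general:
  fixes y :: "real \<Rightarrow> real"
  assumes "\<And>x. (y has_real_derivative y' x) (at x)" "\<And>x. (y' has_real_derivative x * y x) (at x)"
  shows "y x = y 0 * airy_sol 1 0 x + y' 0 * airy_sol 0 1 x"
proof -
  let ?F = "airy_sol 1 0" and ?G = "airy_sol 0 1" and ?F' = "airy_sol' 1 0" and ?G' = "airy_sol' 0 1"
  note d = DERIV_airy_sol DERIV_airy_sol'
  have "?F x * ?G' x - ?F' x * ?G x = 1"
    using wronskian_const[OF d[of 1 0] d[of 0 1], of x] by simp
  moreover have "y x * ?F' x - y' x * ?F x = - y' 0"
    using wronskian_const[OF assms d[of 1 0], of x] by simp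
  moreover have "y x * ?G' x - y' x * ?G x = y 0"
    using wronskian_const[OF assms d[of 0 1], of x] by simp
  moreover have "y x * (?F x * ?G' x - ?F' x * ?G x)
    = ?F x * (y x * ?G' x - y' x * ?G x) - ?G x * (y x * ?F' x - y' x * ?F x)"
    by (simp add: algebra_simps)
  ultimately show ?thesis by simp
qed

section \<open>The decaying solution and its rate of decay\<close>

abbreviation airyF :: "real \<Rightarrow> real" where "airyF \<equiv> airy_sol 1 0"
abbreviation airyF' :: "real \<Rightarrow> real" where "airyF' \<equiv> airy_sol' 1 0"
abbreviation airyG :: "real \<Rightarrow> real" where "airyG \<equiv> airy_sol 0 1"
abbreviation airyG' :: "real \<Rightarrow> real" where "airyG' \<equiv> airy_sol' 0 1"

lemma airy_wronskian: "airyF x * airyG' x - airyF' x * airyG x = 1"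
  using wronskian_const[OF DERIV_airy_sol[of 1 0] DERIV_airy_sol'[of 1 0] DERIV_airy_sol[of 0 1] DERIV_airy_sol'[of 0 1], of x]
  by simp

lemma airy_coeff_nonneg: "p \<ge> 0 \<Longrightarrow> q \<ge> 0 \<Longrightarrow> airy_coeff p q n \<ge> 0"
  by (induction p q n rule: airy_coeff.induct) auto

lemma airy_sol_ge_term:
  assumes "p \<ge> 0" "q \<ge> 0" "x \<ge> 0"
  shows "airy_coeff p q n * x ^ n \<le> airy_sol p q x" "diffs (airy_coeff p q) n * x ^ n \<le> airy_sol' p q x"
proof -
  show "airy_coeff p q n * x ^ n \<le> airy_sol p q x"
    unfolding airy_sol_def using sum_le_suminf[OF summable_airy_coeff[of p q x], of "{n}"] assms airy_coeff_nonneg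
    by simp
  show "diffs (airy_coeff p q) n * x ^ n \<le> airy_sol' p q x"
    unfolding airy_sol'_def using sum_le_suminf[OF summable_diffs_airy_coeff[of p q x], of "{n}"] assms airy_coeff_nonneg
    by (simp add: diffs_def)
qed

lemma airyG_ge: "x \<ge> 0 \<Longrightarrow> x \<le> airyG x"
  using airy_sol_ge_term(1)[of 0 1 x 1] by simp

lemma airyG'_ge: assumes "x \<ge> 0" shows "1 \<le> airyG' x" "x ^ 3 / 3 \<le> airyG' x"
  using airy_sol_ge_term(2)[of 0 1 x 0] airy_sol_ge_term(2)[of 0 1 x 3] assms
  by (simp_all add: diffs_def eval_nat_numeral)

lemma DERIV_airy_ratio:
  assumes "x > 0"
  shows "((\<lambda>x. airyF x / airyG x) has_real_derivative - 1 / (airyG x)\<^sup>2) (at x)"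
proof -
  have nz: "airyG x \<noteq> 0" using airyG_ge[of x] assms by linarith
  have "((\<lambda>x. airyF x / airyG x) has_real_derivative
      (airyF' x * airyG x - airyF x * airyG' x) / (airyG x * airyG x)) (at x)"
    by (rule derivative_eq_intros DERIV_airy_sol refl nz)+
  also have "airyF' x * airyG x - airyF x * airyG' x = - 1" using airy_wronskian[of x] by simp
  finally show ?thesis by (simp add: power2_eq_square)
qed

lemma airy_ratio_strict_antimono:
  assumes "0 < x" "x < y" shows "airyF y / airyG y < airyF x / airyG x"
proof (rule DERIV_neg_imp_decreasing[OF assms(2)])
  fix t assume "x \<le> t" "t \<le> y"
  then have "t > 0" "airyG t > 0" using assms airyG_ge[of t] by auto
  then show "\<exists>d. ((\<lambda>x. airyF x / airyG x) has_real_derivative d) (at t) \<and> d < 0"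
    using DERIV_airy_ratio[of t] by (intro exI[of _ "- 1 / (airyG t)\<^sup>2"]) auto
qed

text \<open>By the Wronskian identity the quantity is F'/G', and its derivative is x / G'^2. While
  F/G decreases to its infimum, F'/G' increases from below; the gap 1 / (G G') is what makes both
  the decay estimate and the numerical enclosure of \<open>airy_m\<close> possible.\<close>

lemma airy_ratio_lower_mono:
  assumes "0 < x" "x \<le> y"
  shows "airyF x / airyG x - 1 / (airyG x * airyG' x) \<le> airyF y / airyG y - 1 / (airyG y * airyG' y)"
proof (rule DERIV_nonneg_imp_nondecreasing[OF assms(2)])
  fix t assume "x \<le> t" "t \<le> y"
  then have pos: "t > 0" "airyG t > 0" "airyG' t > 0" using assms airyG_ge[of t] airyG'_ge[of t] by auto
  have "((\<lambda>x. airyG x * airyG' x) has_real_derivative airyG' t * airyG' t + t * airyG t * airyG t) (at t)"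
    by (rule derivative_eq_intros DERIV_airy_sol DERIV_airy_sol' refl)+
  from DERIV_diff[OF DERIV_airy_ratio[OF pos(1)] DERIV_inverse'[OF this]]
  have "((\<lambda>x. airyF x / airyG x - 1 / (airyG x * airyG' x)) has_real_derivative
     - 1 / (airyG t)\<^sup>2 - - (inverse (airyG t * airyG' t) * (airyG' t * airyG' t + t * airyG t * airyG t)
        * inverse (airyG t * airyG' t))) (at t)"
    using pos by (simp add: inverse_eq_divide)
  moreover have "- 1 / (airyG t)\<^sup>2 - - (inverse (airyG t * airyG' t) * (airyG' t * airyG' t + t * airyG t * airyG t)
        * inverse (airyG t * airyG' t)) = t / (airyG' t)\<^sup>2"
    using pos by (simp add: field_simps power2_eq_square)
  moreover have "t / (airyG' t)\<^sup>2 \<ge> 0" using pos by simp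
  ultimately show "\<exists>d. ((\<lambda>x. airyF x / airyG x - 1 / (airyG x * airyG' x)) has_real_derivative d) (at t) \<and> 0 \<le> d"
    by metis
qed

text \<open>The value \<open>- Ai'(0) / Ai(0)\<close>: the only slope for which \<open>F - m G\<close> stays bounded.\<close>
definition airy_m :: real where
  "airy_m = Inf ((\<lambda>x. airyF x / airyG x) ` {0<..})"

lemma airy_m_bounds:
  assumes "x > 0"
  shows "airy_m < airyF x / airyG x" "airyF x / airyG x - 1 / (airyG x * airyG' x) \<le> airy_m"
proof -
  have bound: "airyF x / airyG x - 1 / (airyG x * airyG' x) \<le> airyF y / airyG y" if "x > 0" "y > 0" for x y
  proof (cases "y \<le> x")
    case True
    have "airyF x / airyG x \<le> airyF y / airyG y"
      using True that airy_ratio_strict_antimono[of y x] by (cases "x = y") auto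
    moreover have "1 / (airyG x * airyG' x) \<ge> 0" using airyG_ge[of x] airyG'_ge[of x] that by simp
    ultimately show ?thesis by linarith
  next
    case False
    then have "airyF x / airyG x - 1 / (airyG x * airyG' x) \<le> airyF y / airyG y - 1 / (airyG y * airyG' y)"
      using airy_ratio_lower_mono that by simp
    moreover have "1 / (airyG y * airyG' y) \<ge> 0" using airyG_ge[of y] airyG'_ge[of y] that by simp
    ultimately show ?thesis by linarith
  qed
  have bdd: "bdd_below ((\<lambda>x. airyF x / airyG x) ` {0<..})"
    by (rule bdd_belowI2[where m = "airyF 1 / airyG 1 - 1 / (airyG 1 * airyG' 1)"]) (use bound in auto)
  \<comment> \<open>Evaluating at x + 1 instead of x makes the inequality strict.\<close>
  have "airy_m \<le> airyF (x + 1) / airyG (x + 1)"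
    unfolding airy_m_def using assms by (intro cINF_lower bdd) auto
  also have "\<dots> < airyF x / airyG x" using airy_ratio_strict_antimono assms by simp
  finally show "airy_m < airyF x / airyG x" .
  show "airyF x / airyG x - 1 / (airyG x * airyG' x) \<le> airy_m"
    unfolding airy_m_def using bound assms by (intro cINF_greatest) auto
qed

abbreviation airyA :: "real \<Rightarrow> real" where "airyA \<equiv> airy_sol 1 (- airy_m)"
abbreviation airyA' :: "real \<Rightarrow> real" where "airyA' \<equiv> airy_sol' 1 (- airy_m)"

lemma airyA_eq: "airyA x = airyF x - airy_m * airyG x"
  using airy_ode_general[OF DERIV_airy_sol DERIV_airy_sol', of 1 "- airy_m" x] by simp

lemma airyA_pos: assumes "x \<ge> 0" shows "airyA x > 0"
proof (cases "x = 0")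
  case False
  then have "airyG x > 0" using airyG_ge[of x] assms by linarith
  then show ?thesis using airy_m_bounds(1)[of x] False assms by (simp add: airyA_eq pos_less_divide_eq)
qed simp

text \<open>A = G (F/G - m), and the gap estimate bounds the bracket by 1 / (G G'). The true decay
  is far faster, but the cubic rate suffices for all moments t^k A^2 with k <= 4 that occur
  later.\<close>

lemma airyA_le: assumes "x > 0" shows "airyA x \<le> 1 / airyG' x" "airyA x \<le> 3 / x ^ 3"
proof -
  have pos: "airyG x > 0" "airyG' x > 0" using airyG_ge[of x] airyG'_ge[of x] assms by auto
  have "airyA x = airyG x * (airyF x / airyG x - airy_m)" using pos by (simp add: airyA_eq field_simps)
  also have "\<dots> \<le> airyG x * (1 / (airyG x * airyG' x))"
    using airy_m_bounds(2)[OF assms] pos by (intro mult_left_mono) auto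
  also have "\<dots> = 1 / airyG' x" using pos by simp
  finally show *: "airyA x \<le> 1 / airyG' x" .
  also have "\<dots> \<le> 1 / (x ^ 3 / 3)" using airyG'_ge(2)[of x] assms pos by (intro divide_left_mono) auto
  finally show "airyA x \<le> 3 / x ^ 3" by simp
qed

lemma tendsto_airyA: "(airyA \<longlongrightarrow> 0) at_top"
proof (rule tendsto_sandwich[OF _ _ tendsto_const])
  show "\<forall>\<^sub>F x in at_top. 0 \<le> airyA x"
    using eventually_ge_at_top[of 0] by eventually_elim (use airyA_pos in \<open>auto intro: less_imp_le\<close>)
  show "\<forall>\<^sub>F x in at_top. airyA x \<le> 3 / x ^ 3"
    using eventually_gt_at_top[of 0] by eventually_elim (use airyA_le in auto)
  show "((\<lambda>x::real. 3 / x ^ 3) \<longlongrightarrow> 0) at_top" by real_asymp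
qed

lemma airyA'_mono: assumes "0 \<le> x" "x \<le> y" shows "airyA' x \<le> airyA' y"
proof (rule DERIV_nonneg_imp_nondecreasing[OF assms(2)])
  fix t assume "x \<le> t" "t \<le> y"
  then show "\<exists>d. (airyA' has_real_derivative d) (at t) \<and> 0 \<le> d"
    using DERIV_airy_sol'[of 1 "- airy_m" t] airyA_pos[of t] assms by (intro exI[of _ "t * airyA t"]) auto
qed

lemma airyA_MVT: assumes "x < y" obtains t where "x < t" "t < y" "airyA y - airyA x = (y - x) * airyA' t"
  using MVT2[OF assms, of airyA airyA'] DERIV_airy_sol by blast

text \<open>By convexity a positive slope would persist and keep A above the positive value A(x),
  against A -> 0.\<close>

lemma airyA'_nonpos: assumes "x \<ge> 0" shows "airyA' x \<le> 0"
proof (rule ccontr)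
  assume "\<not> airyA' x \<le> 0"
  then have d: "airyA' x > 0" by simp
  have "airyA y \<ge> airyA x" if "y > x" for y
  proof -
    obtain t where t: "x < t" "t < y" "airyA y - airyA x = (y - x) * airyA' t" using airyA_MVT[OF \<open>y > x\<close>] by blast
    have "airyA' t > 0" using airyA'_mono[of x t] t d assms by linarith
    then have "(y - x) * airyA' t \<ge> 0" using that by (intro mult_nonneg_nonneg) auto
    then show ?thesis using t by linarith
  qed
  then have "\<forall>\<^sub>F y in at_top. airyA x \<le> airyA y"
    using eventually_gt_at_top[of x] by (rule eventually_mono[rotated])
  then have "airyA x \<le> 0"
    using tendsto_lowerbound[OF tendsto_airyA] by (simp add: trivial_limit_at_top_linorder)
  then show False using airyA_pos[OF assms] by simp
qed

text \<open>A' increases, so the slope at x is at least the mean slope over [x/2, x], and there A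
  drops by at most A(x/2) <= 24 / x^3; division by x/2 gives the 48.\<close>

lemma airyA'_abs_le: assumes "x > 0" shows "\<bar>airyA' x\<bar> \<le> 48 / x ^ 4"
proof -
  obtain t where t: "x / 2 < t" "t < x" "airyA x - airyA (x / 2) = (x - x / 2) * airyA' t"
    using airyA_MVT[of "x / 2" x] assms by auto
  have "airyA' t \<le> airyA' x" using airyA'_mono t assms by simp
  then have "(x / 2) * airyA' t \<le> (x / 2) * airyA' x" using assms by (intro mult_left_mono) auto
  then have "- ((x / 2) * airyA' x) \<le> airyA (x / 2) - airyA x" using t(3) by simp
  also have "\<dots> \<le> airyA (x / 2)" using airyA_pos[of x] assms by simp
  also have "\<dots> \<le> 3 / (x / 2) ^ 3" using airyA_le(2)[of "x / 2"] assms by simp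
  finally have "(x / 2) * \<bar>airyA' x\<bar> \<le> 3 / (x / 2) ^ 3" using airyA'_nonpos[of x] assms by simp
  then show ?thesis using assms by (simp add: field_simps eval_nat_numeral)
qed

lemma tendsto_airyA': "((\<lambda>x. x * airyA' x) \<longlongrightarrow> 0) at_top" "(airyA' \<longlongrightarrow> 0) at_top"
proof -
  show "((\<lambda>x. x * airyA' x) \<longlongrightarrow> 0) at_top"
  proof (rule Lim_null_comparison)
    show "\<forall>\<^sub>F x in at_top. norm (x * airyA' x) \<le> x * (48 / x ^ 4)"
      using eventually_gt_at_top[of 0]
    proof eventually_elim
      case (elim x)
      then have "x * \<bar>airyA' x\<bar> \<le> x * (48 / x ^ 4)" by (intro mult_left_mono airyA'_abs_le) auto
      then show ?case using elim by (simp add: abs_mult)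
    qed
    show "((\<lambda>x::real. x * (48 / x ^ 4)) \<longlongrightarrow> 0) at_top" by real_asymp
  qed
  show "(airyA' \<longlongrightarrow> 0) at_top"
  proof (rule Lim_null_comparison)
    show "\<forall>\<^sub>F x in at_top. norm (airyA' x) \<le> 48 / x ^ 4"
      using eventually_gt_at_top[of 0] by eventually_elim (use airyA'_abs_le in simp)
    show "((\<lambda>x::real. 48 / x ^ 4) \<longlongrightarrow> 0) at_top" by real_asymp
  qed
qed

lemma filterlim_airyG: "filterlim airyG at_top at_top"
  by (rule filterlim_at_top_mono[OF filterlim_ident])
     (rule eventually_mono[OF eventually_ge_at_top[of 0] airyG_ge])

section \<open>Identification of the decaying solution with \<open>airy\<close>\<close>

definition airy_value0 :: real where "airy_value0 = 1 / (3 powr (2/3) * Gamma (2/3))"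

lemma airy_value0_pos: "airy_value0 > 0"
  unfolding airy_value0_def by (intro divide_pos_pos mult_pos_pos Gamma_real_pos) auto

lemma is_airy_airyA: "is_airy (\<lambda>x. airy_value0 * airyA x)"
proof -
  have "((\<lambda>x. airy_value0 * airyA x) has_real_derivative airy_value0 * airyA' x) (at x)"
    "((\<lambda>x. airy_value0 * airyA' x) has_real_derivative x * (airy_value0 * airyA x)) (at x)" for x
    by (rule derivative_eq_intros DERIV_airy_sol DERIV_airy_sol' refl | simp)+
  moreover have "((\<lambda>x. airy_value0 * airyA x) \<longlongrightarrow> 0) at_top"
    using tendsto_mult_right_zero[OF tendsto_airyA] by blast
  ultimately show ?thesis
    unfolding is_airy_def airy_value0_def[symmetric]
    by (intro conjI exI[of _ "\<lambda>x. airy_value0 * airyA' x"]) auto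
qed

text \<open>Two candidates with the same value at 0 differ by a multiple of G, and G tends to
  infinity.\<close>

lemma is_airy_unique: assumes "is_airy y" shows "y = (\<lambda>x. airy_value0 * airyA x)"
proof -
  from assms obtain y' where d: "\<And>x. (y has_real_derivative y' x) (at x)" "\<And>x. (y' has_real_derivative x * y x) (at x)"
    and lim: "(y \<longlongrightarrow> 0) at_top" and y0: "y 0 = airy_value0"
    unfolding is_airy_def airy_value0_def by auto
  define e where "e = y' 0 + airy_m * airy_value0"
  have y: "y x = airy_value0 * airyA x + e * airyG x" for x
    using airy_ode_general[OF d, of x] by (simp add: y0 e_def airyA_eq algebra_simps)
  have "((\<lambda>x. y x - airy_value0 * airyA x) \<longlongrightarrow> 0 - airy_value0 * 0) at_top"
    by (intro tendsto_intros lim tendsto_airyA)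
  then have lim_e: "((\<lambda>x. e * airyG x) \<longlongrightarrow> 0) at_top" by (simp add: y)
  have "e = 0"
  proof (rule ccontr)
    assume "e \<noteq> 0"
    then have "((\<lambda>x. (1 / e) * (e * airyG x)) \<longlongrightarrow> (1 / e) * 0) at_top"
      by (intro tendsto_intros lim_e)
    then have "(airyG \<longlongrightarrow> 0) at_top" using \<open>e \<noteq> 0\<close> by simp
    then have "\<forall>\<^sub>F x in at_top. airyG x < 1" by (rule order_tendstoD) simp
    moreover have "\<forall>\<^sub>F x in at_top. 1 \<le> airyG x"
      using filterlim_airyG by (simp add: filterlim_at_top)
    ultimately have "\<forall>\<^sub>F x::real in at_top. False" by eventually_elim simp
    then show False by simp
  qed
  then show ?thesis using y by auto
qed

lemma airy_eq: "airy = (\<lambda>x. airy_value0 * airyA x)"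
  unfolding airy_def using is_airy_airyA is_airy_unique by (rule the_equality)

lemma DERIV_airy: "(airy has_real_derivative airy_value0 * airyA' x) (at x)"
  unfolding airy_eq by (rule derivative_eq_intros DERIV_airy_sol refl | simp)+

lemma deriv_airy: "deriv airy x = airy_value0 * airyA' x"
  by (rule DERIV_imp_deriv[OF DERIV_airy])

lemma airy_eq_0_iff: "airy x = 0 \<longleftrightarrow> airyA x = 0"
  using airy_value0_pos by (simp add: airy_eq)

lemma airyA_wronskian: "airyA x * airyG' x - airyA' x * airyG x = 1"
proof -
  have "airyA x * airyG' x - airyA' x * airyG x = airyA 0 * airyG' 0 - airyA' 0 * airyG 0"
    by (rule wronskian_const[OF DERIV_airy_sol DERIV_airy_sol' DERIV_airy_sol DERIV_airy_sol'])
  then show ?thesis by simp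
qed

lemma airyA_simple_zero: "airyA x = 0 \<Longrightarrow> airyA' x \<noteq> 0"
  using airyA_wronskian[of x] by auto

subsection \<open>Zeros of the Airy function\<close>

lemma nth_largest_exists:
  fixes S :: "real set"
  assumes fin: "\<And>p. finite {x \<in> S. p < x}" and inf: "infinite S"
  shows "\<exists>a\<in>S. card {x \<in> S. a < x} = n"
proof (induction n)
  case 0
  obtain s where s: "s \<in> S" using inf by fastforce
  define T where "T = {x \<in> S. s - 1 < x}"
  have T: "finite T" "s \<in> T" using fin s by (auto simp: T_def)
  then obtain M where M: "M \<in> T" "\<And>x. x \<in> T \<Longrightarrow> x \<le> M" using Max_in[of T] Max_ge[of T] by blast
  then have "{x \<in> S. M < x} = {}" by (auto simp: T_def) (meson less_trans linorder_not_less)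
  then have "card {x \<in> S. M < x} = 0" by (simp only: card.empty)
  then show ?case using M(1) by (intro bexI[of _ M]) (auto simp: T_def)
next
  case (Suc n)
  then obtain a where a: "a \<in> S" "card {x \<in> S. a < x} = n" by blast
  have "infinite (S - {x \<in> S. a < x} - {a})" using inf fin by simp
  then obtain s where "s \<in> S - {x \<in> S. a < x} - {a}" by (metis finite.emptyI ex_in_conv)
  then have s: "s \<in> S" "s < a" by auto
  define T where "T = {x \<in> S. s - 1 < x \<and> x < a}"
  have T: "finite T" "s \<in> T"
    using s by (auto simp: T_def intro: finite_subset[OF _ fin[of "s - 1"]])
  then obtain M where M: "M \<in> T" "\<And>x. x \<in> T \<Longrightarrow> x \<le> M" using Max_in[of T] Max_ge[of T] by blast
  then have b: "M \<in> S" "M < a" "s - 1 < M" by (auto simp: T_def)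
  have "x = a" if "x \<in> S" "M < x" "\<not> a < x" for x
  proof (rule ccontr)
    assume "x \<noteq> a"
    then have "x \<in> T" using that b by (auto simp: T_def)
    then show False using M(2) that by force
  qed
  then have "{x \<in> S. M < x} = insert a {x \<in> S. a < x}" using b a by auto
  then have "card {x \<in> S. M < x} = Suc n" using a fin by simp
  then show ?case using b by blast
qed

lemma nth_largest_unique:
  fixes S :: "real set"
  assumes fin: "\<And>p. finite {x \<in> S. p < x}" and "a \<in> S" "b \<in> S"
    and card: "card {x \<in> S. a < x} = card {x \<in> S. b < x}"
  shows "a = b"
proof (rule ccontr)
  have less: False if "a < b" "b \<in> S" "card {x \<in> S. a < x} = card {x \<in> S. b < x}" for a b
  proof -
    have "{x \<in> S. b < x} \<subset> {x \<in> S. a < x}" using that by auto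
    then have "card {x \<in> S. b < x} < card {x \<in> S. a < x}" by (rule psubset_card_mono[OF fin])
    then show False using that(3) by linarith
  qed
  assume "a \<noteq> b"
  then have "a < b \<or> b < a" by linarith
  then show False using less[OF _ assms(3) card] less[OF _ assms(2) card[symmetric]] by blast
qed

definition airyZ :: "real set" where "airyZ = {x. airyA x = 0}"

lemma airyZ_neg: "x \<in> airyZ \<Longrightarrow> x < 0"
  using airyA_pos[of x] by (auto simp: airyZ_def not_le[symmetric])

lemma isCont_airyA: "isCont (airy_sol p q) x" "isCont (airy_sol' p q) x"
  using DERIV_isCont DERIV_airy_sol DERIV_airy_sol' by blast+

lemma continuous_on_airy_sol [continuous_intros]:
  "continuous_on S (airy_sol p q)" "continuous_on S (airy_sol' p q)"
  by (simp_all add: continuous_at_imp_continuous_on isCont_airyA)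

text \<open>The zeros concerned lie in [p, 0]. An accumulation point would be a zero at which the
  difference quotients vanish arbitrarily close by, although all zeros are simple.\<close>

lemma finite_airyZ_above: "finite {x \<in> airyZ. p < x}"
proof (rule ccontr)
  assume inf: "infinite {x \<in> airyZ. p < x}"
  let ?T = "{x \<in> airyZ. p < x}"
  have sub: "?T \<subseteq> {p..0}" using airyZ_neg by force
  then obtain z where z: "z islimpt ?T"
    using Heine_Borel_imp_Bolzano_Weierstrass[of "{p..0}" ?T] inf by auto
  then have z': "z islimpt airyZ" by (rule islimpt_subset) auto
  have "closed airyZ"
    unfolding airyZ_def by (intro closed_Collect_eq continuous_intros)
  then have zero: "airyA z = 0" using z' closed_limpt[of airyZ] by (auto simp: airyZ_def)
  have "((\<lambda>x. (airyA x - airyA z) / (x - z)) \<longlongrightarrow> airyA' z) (at z)"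
    using DERIV_airy_sol[of 1 "- airy_m" z] by (simp add: has_field_derivative_iff)
  then have "\<forall>\<^sub>F x in at z. (airyA x - airyA z) / (x - z) \<noteq> 0"
    by (rule tendsto_imp_eventually_ne) (rule airyA_simple_zero[OF zero])
  then have "\<forall>\<^sub>F x in at z. x \<notin> airyZ"
    by eventually_elim (auto simp: zero airyZ_def)
  then show False using z' by (simp add: islimpt_conv_frequently_at frequently_def)
qed

text \<open>Sturm comparison with sin (t - c), which solves y'' = - y: if y were positive
  throughout, y' sin - y cos would be nonincreasing on the interval, yet it runs from - y c to y (c
  + pi).\<close>

lemma airy_ode_zero_below:
  fixes y :: "real \<Rightarrow> real"
  assumes d: "\<And>x. (y has_real_derivative y' x) (at x)" "\<And>x. (y' has_real_derivative x * y x) (at x)"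
    and c: "c + pi \<le> -1"
  shows "\<exists>x\<in>{c..c + pi}. y x \<le> 0"
proof (rule ccontr)
  assume "\<not> ?thesis"
  then have pos: "y x > 0" if "c \<le> x" "x \<le> c + pi" for x using that by force
  define \<phi> where "\<phi> t = y' t * sin (t - c) - y t * cos (t - c)" for t
  have "\<phi> (c + pi) \<le> \<phi> c"
  proof (rule DERIV_nonpos_imp_nonincreasing[of c "c + pi" \<phi>])
    fix t assume t: "c \<le> t" "t \<le> c + pi"
    have "(\<phi> has_real_derivative (1 + t) * y t * sin (t - c)) (at t)"
      unfolding \<phi>_def[abs_def]
      by (rule derivative_eq_intros d refl)+ (simp add: algebra_simps)
    moreover have "(1 + t) * y t * sin (t - c) \<le> 0"
      using t c pos[of t] sin_ge_zero[of "t - c"] by (intro mult_nonpos_nonneg) auto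
    ultimately show "\<exists>d. (\<phi> has_real_derivative d) (at t) \<and> d \<le> 0" by blast
  qed simp
  then show False using pos[of c] pos[of "c + pi"] by (simp add: \<phi>_def)
qed

lemma airyZ_unbounded_below: "\<exists>x\<in>airyZ. x < p"
proof -
  define c where "c = min p 0 - 2 - pi"
  have c: "c + pi \<le> -1" "c + pi < p" by (auto simp: c_def)
  obtain x where x: "x \<in> {c..c + pi}" "airyA x \<le> 0"
    using airy_ode_zero_below[OF DERIV_airy_sol DERIV_airy_sol' c(1)] by blast
  have "((\<lambda>x. - airyA x) has_real_derivative - airyA' t) (at t)"
    "((\<lambda>x. - airyA' x) has_real_derivative t * (- airyA t)) (at t)" for t
    by (rule derivative_eq_intros DERIV_airy_sol DERIV_airy_sol' refl | simp)+
  from airy_ode_zero_below[OF this c(1)] obtain w where w: "w \<in> {c..c + pi}" "airyA w \<ge> 0" by auto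
  have "\<exists>z. min x w \<le> z \<and> z \<le> max x w \<and> airyA z = 0"
  proof (cases "x \<le> w")
    case True
    then show ?thesis using IVT[of airyA x 0 w] x w isCont_airyA by (auto simp: min_def max_def)
  next
    case False
    then show ?thesis using IVT2[of airyA x 0 w] x w isCont_airyA by (auto simp: min_def max_def)
  qed
  then show ?thesis using x w c by (force simp: airyZ_def)
qed

lemma infinite_airyZ: "infinite airyZ"
proof
  assume fin: "finite airyZ"
  obtain x where "x \<in> airyZ" "x < Min (insert 0 airyZ)" using airyZ_unbounded_below by blast
  then show False using Min_le[of "insert 0 airyZ" x] fin by auto
qed

lemma airy_zero_cond_iff:
  assumes "r \<ge> 1"
  shows "airy a = 0 \<and> finite {b. airy b = 0 \<and> a < b} \<and> Suc (card {b. airy b = 0 \<and> a < b}) = r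
    \<longleftrightarrow> a \<in> airyZ \<and> card {x \<in> airyZ. a < x} = r - 1"
  using assms finite_airyZ_above[of a] by (auto simp: airy_eq_0_iff airyZ_def)

lemma airy_zero_eqI:
  assumes "r \<ge> 1" "a \<in> airyZ" "card {x \<in> airyZ. a < x} = r - 1"
  shows "airy_zero r = a"
  unfolding airy_zero_def airy_zero_cond_iff[OF assms(1)]
  using assms(2,3) nth_largest_unique[OF finite_airyZ_above] by (intro the_equality) auto

lemma airy_zero_props:
  assumes "r \<ge> 1"
  shows "airy_zero r \<in> airyZ" "card {x \<in> airyZ. airy_zero r < x} = r - 1"
proof -
  obtain a where "a \<in> airyZ" "card {x \<in> airyZ. a < x} = r - 1"
    using nth_largest_exists[OF finite_airyZ_above infinite_airyZ] by blast
  then show "airy_zero r \<in> airyZ" "card {x \<in> airyZ. airy_zero r < x} = r - 1"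
    using airy_zero_eqI[OF assms] by auto
qed

text \<open>Sturm comparison with \<open>\<sigma>(t) = sin (s (t - p) + \<delta>)\<close>, \<open>s\<^sup>2 = T\<close>: if it had no zero
  on \<open>[p, q]\<close>, the quantity \<open>A A' - A\<^sup>2 \<sigma>'/\<sigma>\<close> would increase from 0 to 0.\<close>
lemma airyZ_spacing:
  assumes p: "p \<in> airyZ" and q: "q \<in> airyZ" and pq: "p < q" and T: "- T \<le> p"
  shows "pi\<^sup>2 \<le> (q - p)\<^sup>2 * T"
proof (rule ccontr)
  assume "\<not> ?thesis"
  then have small: "(q - p)\<^sup>2 * T < pi\<^sup>2" by simp
  have "T > 0" using T airyZ_neg[OF p] by simp
  define s where "s = sqrt T"
  have s: "s > 0" "s\<^sup>2 = T" using \<open>T > 0\<close> by (auto simp: s_def)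
  have "((q - p) * s)\<^sup>2 < pi\<^sup>2" using small s by (simp add: power_mult_distrib)
  then have lt: "(q - p) * s < pi" by (rule power_less_imp_less_base) simp
  \<comment> \<open>Half of the slack, so that the phase runs symmetrically from \<delta> to pi -
    \<delta> and the sine stays positive up to both ends.\<close>
  define \<delta> where "\<delta> = (pi - (q - p) * s) / 2"
  have \<delta>: "\<delta> > 0" "(q - p) * s + \<delta> < pi" using lt by (auto simp: \<delta>_def field_simps)
  define \<sigma> where "\<sigma> t = sin ((t - p) * s + \<delta>)" for t
  define \<kappa> where "\<kappa> t = cos ((t - p) * s + \<delta>)" for t
  have \<sigma>_pos: "\<sigma> t > 0" if "p \<le> t" "t \<le> q" for t
  proof -
    have "(t - p) * s \<le> (q - p) * s" using that s by (intro mult_right_mono) auto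
    moreover have "0 \<le> (t - p) * s" using that s by simp
    ultimately show ?thesis unfolding \<sigma>_def using \<delta> by (intro sin_gt_zero) auto
  qed
  define \<psi> where "\<psi> t = airyA t * airyA' t - (airyA t)\<^sup>2 * (s * \<kappa> t / \<sigma> t)" for t
  have sc: "\<kappa> t * \<kappa> t = 1 - \<sigma> t * \<sigma> t" for t
    using sin_cos_squared_add[of "(t - p) * s + \<delta>"] by (simp add: \<kappa>_def \<sigma>_def power2_eq_square algebra_simps)
  \<comment> \<open>Picone's identity; both summands are nonnegative because t >= p >= - T.\<close>
  have d\<psi>: "(\<psi> has_real_derivative (airyA' t - airyA t * (s * \<kappa> t / \<sigma> t))\<^sup>2 + (t + T) * (airyA t)\<^sup>2) (at t)"
    if t: "p \<le> t" "t \<le> q" for t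
  proof -
    have nz: "\<sigma> t \<noteq> 0" using \<sigma>_pos[OF t] by simp
    have d\<sigma>: "(\<sigma> has_real_derivative s * \<kappa> t) (at t)" and d\<kappa>: "(\<kappa> has_real_derivative - (s * \<sigma> t)) (at t)"
      unfolding \<sigma>_def[abs_def] \<kappa>_def[abs_def] by (auto intro!: derivative_eq_intros)
    have quot: "((\<lambda>t. s * \<kappa> t / \<sigma> t) has_real_derivative - T - (s * \<kappa> t / \<sigma> t)\<^sup>2) (at t)"
      by (rule derivative_eq_intros d\<sigma> d\<kappa> refl nz)+
         (use nz in \<open>simp add: s(2)[symmetric] power2_eq_square field_simps sc\<close>)
    show ?thesis unfolding \<psi>_def[abs_def]
      by (rule derivative_eq_intros quot DERIV_airy_sol DERIV_airy_sol' refl)+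
         (simp add: power2_eq_square algebra_simps)
  qed
  have mono: "\<psi> x \<le> \<psi> y" if "p \<le> x" "x \<le> y" "y \<le> q" for x y
  proof (rule DERIV_nonneg_imp_nondecreasing[OF that(2)])
    fix t assume "x \<le> t" "t \<le> y"
    then have t: "p \<le> t" "t \<le> q" using that by auto
    have "(airyA' t - airyA t * (s * \<kappa> t / \<sigma> t))\<^sup>2 + (t + T) * (airyA t)\<^sup>2 \<ge> 0" using T t by simp
    then show "\<exists>d. (\<psi> has_real_derivative d) (at t) \<and> 0 \<le> d" using d\<psi>[OF t] by blast
  qed
  have ends: "\<psi> p = 0" "\<psi> q = 0" using p q by (auto simp: \<psi>_def airyZ_def)
  have zero: "\<psi> x = 0" if "x \<in> {p<..<q}" for x
    using mono[of p x] mono[of x q] ends that by auto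
  \<comment> \<open>Since \<psi> is identically 0, its derivative vanishes at an interior point.
    There t + T > 0, so A and then A' vanish together, which is impossible.\<close>
  define t where "t = (p + q) / 2"
  have t: "t \<in> {p<..<q}" using pq by (auto simp: t_def)
  have "p \<le> t" "t \<le> q" using t by auto
  have "((\<lambda>_. 0) has_real_derivative (airyA' t - airyA t * (s * \<kappa> t / \<sigma> t))\<^sup>2 + (t + T) * (airyA t)\<^sup>2) (at t)"
    by (rule has_field_derivative_transform_within_open[OF d\<psi>[OF \<open>p \<le> t\<close> \<open>t \<le> q\<close>] open_greaterThanLessThan t]) (rule zero)
  then have "(airyA' t - airyA t * (s * \<kappa> t / \<sigma> t))\<^sup>2 + (t + T) * (airyA t)\<^sup>2 = 0"
    using DERIV_unique[OF _ DERIV_const] by blast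
  moreover have "t + T > 0" using t T by auto
  ultimately have "(airyA' t - airyA t * (s * \<kappa> t / \<sigma> t))\<^sup>2 = 0 \<and> (t + T) * (airyA t)\<^sup>2 = 0"
    by (subst (asm) add_nonneg_eq_0_iff) auto
  then have "airyA t = 0" "airyA' t = 0" using \<open>t + T > 0\<close> by auto
  then show False using airyA_simple_zero by blast
qed

subsection \<open>Stability of Airy zeros\<close>

lemma gronwall_affine:
  fixes E :: "real \<Rightarrow> real"
  assumes d: "\<And>t. 0 \<le> t \<Longrightarrow> t \<le> T \<Longrightarrow> (E has_real_derivative E' t) (at t)"
    and bound: "\<And>t. 0 \<le> t \<Longrightarrow> t \<le> T \<Longrightarrow> E' t \<le> C * E t + b"
    and "C \<ge> 0" "b \<ge> 0" and t: "0 \<le> t" "t \<le> T"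
  shows "E t \<le> (E 0 + b * t) * exp (C * t)"
proof -
  define \<phi> where "\<phi> t = E t * exp (- (C * t)) - b * t" for t
  have "\<phi> t \<le> \<phi> 0"
  proof (rule DERIV_nonpos_imp_nonincreasing[of 0 t \<phi>])
    fix x assume x: "0 \<le> x" "x \<le> t"
    then have xT: "x \<le> T" using t by simp
    have "(\<phi> has_real_derivative (E' x - C * E x) * exp (- (C * x)) - b) (at x)"
      unfolding \<phi>_def[abs_def] by (rule derivative_eq_intros d x xT refl)+ (simp add: algebra_simps)
    moreover have "(E' x - C * E x) * exp (- (C * x)) \<le> b * exp (- (C * x))"
      using bound[OF x(1) xT] by (intro mult_right_mono) auto
    moreover have "b * exp (- (C * x)) \<le> b * 1"
      using assms x by (intro mult_left_mono) auto
    ultimately have "(\<phi> has_real_derivative (E' x - C * E x) * exp (- (C * x)) - b) (at x)"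
      "(E' x - C * E x) * exp (- (C * x)) - b \<le> 0" by linarith+
    then show "\<exists>y. (\<phi> has_real_derivative y) (at x) \<and> y \<le> 0" by blast
  qed (use t in auto)
  then have "E t * exp (- (C * t)) \<le> E 0 + b * t" by (simp add: \<phi>_def)
  then have "E t * exp (- (C * t)) * exp (C * t) \<le> (E 0 + b * t) * exp (C * t)"
    by (rule mult_right_mono) simp
  moreover have "E t * exp (- (C * t)) * exp (C * t) = E t"
    by (simp add: mult.assoc flip: exp_add)
  ultimately show ?thesis by simp
qed

text \<open>Gronwall for the energy y^2 + y'^2; all mixed terms are split by 2 a b <= a^2 + b^2, so
  that the coefficient enters only through its bound K and the force only through \<eta>^2.\<close>

lemma linear_ode_perturbation:
  fixes y y' q g :: "real \<Rightarrow> real"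
  assumes d: "\<And>t. 0 \<le> t \<Longrightarrow> t \<le> T \<Longrightarrow> (y has_real_derivative y' t) (at t)"
    "\<And>t. 0 \<le> t \<Longrightarrow> t \<le> T \<Longrightarrow> (y' has_real_derivative q t * y t + g t) (at t)"
    and q: "\<And>t. 0 \<le> t \<Longrightarrow> t \<le> T \<Longrightarrow> \<bar>q t\<bar> \<le> K"
    and g: "\<And>t. 0 \<le> t \<Longrightarrow> t \<le> T \<Longrightarrow> \<bar>g t\<bar> \<le> \<eta>"
    and t: "0 \<le> t" "t \<le> T"
  shows "(y t)\<^sup>2 + (y' t)\<^sup>2 \<le> ((y 0)\<^sup>2 + (y' 0)\<^sup>2 + \<eta>\<^sup>2 * T) * exp ((2 + K) * T)"
proof -
  have K: "K \<ge> 0" using q[OF order.refl] t by (meson abs_ge_zero order_trans)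
  let ?E = "\<lambda>t. (y t)\<^sup>2 + (y' t)\<^sup>2"
  have "?E t \<le> (?E 0 + \<eta>\<^sup>2 * t) * exp ((2 + K) * t)"
  proof (rule gronwall_affine[where T = T and E' = "\<lambda>t. 2 * y t * y' t + 2 * y' t * (q t * y t + g t)"])
    fix x assume x: "0 \<le> x" "x \<le> T"
    show "(?E has_real_derivative 2 * y x * y' x + 2 * y' x * (q x * y x + g x)) (at x)"
      by (rule derivative_eq_intros d x refl)+ simp
    have a: "2 * y x * y' x \<le> ?E x"
      using sum_squares_bound[of "y x" "y' x"] by simp
    have b: "2 * y' x * (q x * y x) \<le> K * ?E x"
    proof -
      have "2 * y' x * (q x * y x) \<le> \<bar>q x\<bar> * (2 * \<bar>y x\<bar> * \<bar>y' x\<bar>)"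
        using abs_ge_self[of "2 * y' x * (q x * y x)"] by (simp add: abs_mult mult_ac)
      also have "\<dots> \<le> K * ?E x"
        using q[OF x] sum_squares_bound[of "\<bar>y x\<bar>" "\<bar>y' x\<bar>"] by (intro mult_mono) auto
      finally show ?thesis .
    qed
    have c: "2 * y' x * g x \<le> (y' x)\<^sup>2 + \<eta>\<^sup>2"
    proof -
      have "2 * y' x * g x \<le> (y' x)\<^sup>2 + (g x)\<^sup>2" by (rule sum_squares_bound)
      moreover have "(g x)\<^sup>2 \<le> \<eta>\<^sup>2" using g[OF x] by (metis abs_ge_zero power2_abs power_mono)
      ultimately show ?thesis by simp
    qed
    have "0 \<le> (y x)\<^sup>2" by simp
    moreover have "(2 + K) * ?E x = ?E x + (y x)\<^sup>2 + (y' x)\<^sup>2 + K * ?E x"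
      "2 * y' x * (q x * y x + g x) = 2 * y' x * (q x * y x) + 2 * y' x * g x" by (simp_all add: algebra_simps)
    ultimately show "2 * y x * y' x + 2 * y' x * (q x * y x + g x) \<le> (2 + K) * ?E x + \<eta>\<^sup>2"
      using a b c by linarith
  qed (use K t in auto)
  also have "\<dots> \<le> (?E 0 + \<eta>\<^sup>2 * T) * exp ((2 + K) * T)"
    using t K by (intro mult_mono add_left_mono mult_left_mono) (auto intro: mult_left_mono)
  finally show ?thesis by simp
qed

section \<open>Decaying solutions of the perturbed equation\<close>

text \<open>In the edge scaling, \<open>H\<^sub>N(x) exp (- x\<^sup>2 / 2)\<close> solves this equation with \<open>\<epsilon> \<longrightarrow> 0\<close>.\<close>
definition perturbed_airy :: "real \<Rightarrow> (real \<Rightarrow> real) \<Rightarrow> (real \<Rightarrow> real) \<Rightarrow> bool" where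
  "perturbed_airy \<epsilon> y y' \<longleftrightarrow>
     (\<forall>t. (y has_real_derivative y' t) (at t)) \<and>
     (\<forall>t. (y' has_real_derivative (t + \<epsilon> * t\<^sup>2) * y t) (at t)) \<and> (y \<longlongrightarrow> 0) at_top"

context
  fixes \<epsilon> :: real and y y' :: "real \<Rightarrow> real"
  assumes eps: "\<epsilon> \<ge> 0" and y: "perturbed_airy \<epsilon> y y'"
begin

lemma perturbed_airy_D:
  "(y has_real_derivative y' t) (at t)" "(y' has_real_derivative (t + \<epsilon> * t\<^sup>2) * y t) (at t)"
  "(y \<longlongrightarrow> 0) at_top"
  using y by (auto simp: perturbed_airy_def)

text \<open>To the right of 0 the product y y' has derivative y'^2 + (t + \<epsilon> t^2) y^2 >= 0.
  If it were positive once, y^2 would increase from there on and could not tend to 0. Decay at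
  infinity is thus turned into monotonicity.\<close>

lemma perturbed_airy_decreasing_square:
  assumes "0 \<le> s" "s \<le> t" shows "(y t)\<^sup>2 \<le> (y s)\<^sup>2"
proof -
  have mono: "y s * y' s \<le> y t * y' t" if "0 \<le> s" "s \<le> t" for s t
  proof (rule DERIV_nonneg_imp_nondecreasing[of s t "\<lambda>t. y t * y' t"])
    fix x assume "s \<le> x" "x \<le> t"
    have "((\<lambda>t. y t * y' t) has_real_derivative (y' x)\<^sup>2 + (x + \<epsilon> * x\<^sup>2) * (y x)\<^sup>2) (at x)"
      by (rule derivative_eq_intros perturbed_airy_D refl)+ (simp add: power2_eq_square)
    moreover have "(y' x)\<^sup>2 + (x + \<epsilon> * x\<^sup>2) * (y x)\<^sup>2 \<ge> 0"
      using that \<open>s \<le> x\<close> eps by (intro add_nonneg_nonneg mult_nonneg_nonneg) auto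
    ultimately show "\<exists>d. ((\<lambda>t. y t * y' t) has_real_derivative d) (at x) \<and> 0 \<le> d" by blast
  qed (use that in auto)
  have dsq: "((\<lambda>t. (y t)\<^sup>2) has_real_derivative 2 * (y x * y' x)) (at x)" for x
    by (rule derivative_eq_intros perturbed_airy_D refl)+ simp
  have nonpos: "y s * y' s \<le> 0" if "0 \<le> s" for s
  proof (rule ccontr)
    assume pos: "\<not> y s * y' s \<le> 0"
    have "(y s)\<^sup>2 \<le> (y t)\<^sup>2" if "s \<le> t" for t
    proof (rule DERIV_nonneg_imp_nondecreasing[OF that])
      fix x assume "s \<le> x" "x \<le> t"
      then have "2 * (y x * y' x) \<ge> 0" using mono[of s x] pos \<open>0 \<le> s\<close> by simp
      then show "\<exists>d. ((\<lambda>t. (y t)\<^sup>2) has_real_derivative d) (at x) \<and> 0 \<le> d" using dsq by blast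
    qed
    then have "\<forall>\<^sub>F t in at_top. (y s)\<^sup>2 \<le> (y t)\<^sup>2"
      using eventually_ge_at_top[of s] by (rule eventually_mono[rotated])
    moreover have "((\<lambda>t. (y t)\<^sup>2) \<longlongrightarrow> 0\<^sup>2) at_top" by (intro tendsto_intros perturbed_airy_D)
    ultimately have "(y s)\<^sup>2 \<le> 0\<^sup>2"
      using tendsto_lowerbound trivial_limit_at_top_linorder by blast
    then have "y s = 0" by simp
    then show False using pos by simp
  qed
  show ?thesis
  proof (rule DERIV_nonpos_imp_nonincreasing[OF assms(2)])
    fix x assume "s \<le> x" "x \<le> t"
    then have "2 * (y x * y' x) \<le> 0" using nonpos[of x] assms by simp
    then show "\<exists>d. ((\<lambda>t. (y t)\<^sup>2) has_real_derivative d) (at x) \<and> d \<le> 0" using dsq by blast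
  qed
qed

lemma perturbed_airy_zero_persists: "0 \<le> s \<Longrightarrow> y s = 0 \<Longrightarrow> s \<le> t \<Longrightarrow> y t = 0"
  using perturbed_airy_decreasing_square[of s t] by simp

context
  assumes y0: "y 0 = 1"
begin

lemma perturbed_airy_bounds: assumes "t \<ge> 0" shows "0 \<le> y t" "y t \<le> 1"
proof -
  have sq: "(y t)\<^sup>2 \<le> 1"
    using perturbed_airy_decreasing_square[of 0 t] assms y0 by simp
  then show "y t \<le> 1" using abs_square_le_1[of "y t"] by simp
  show "0 \<le> y t"
  proof (rule ccontr)
    assume "\<not> 0 \<le> y t"
    then obtain s where "0 \<le> s" "s \<le> t" "y s = 0"
      using IVT2[of y t 0 0] assms y0 DERIV_isCont[OF perturbed_airy_D(1)] by auto
    then show False using perturbed_airy_zero_persists[of s t] \<open>\<not> 0 \<le> y t\<close> by simp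
  qed
qed

lemma perturbed_airy_slope: assumes "t \<ge> 0" shows "y' 0 \<le> y' t" "y' t \<le> 0"
proof -
  have mono: "y' s \<le> y' t" if "0 \<le> s" "s \<le> t" for s t
  proof (rule DERIV_nonneg_imp_nondecreasing[OF that(2)])
    fix x assume "s \<le> x" "x \<le> t"
    then have "(x + \<epsilon> * x\<^sup>2) * y x \<ge> 0"
      using that eps perturbed_airy_bounds[of x] by (intro mult_nonneg_nonneg add_nonneg_nonneg) auto
    then show "\<exists>d. (y' has_real_derivative d) (at x) \<and> 0 \<le> d" using perturbed_airy_D(2) by blast
  qed
  then show "y' 0 \<le> y' t" using assms by simp
  show "y' t \<le> 0"
  proof (rule ccontr)
    assume "\<not> y' t \<le> 0"
    then have pos: "y' t > 0" by simp
    \<comment> \<open>Over this length the nondecreasing slope would raise y by at least 2, although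
      y stays in [0, 1].\<close>
    define u where "u = t + 2 / y' t"
    have "t < u" using pos by (simp add: u_def)
    then obtain x where x: "t < x" "x < u" "y u - y t = (u - t) * y' x"
      using MVT2[of t u y y'] perturbed_airy_D(1) by blast
    have "(u - t) * y' x \<ge> (u - t) * y' t"
      using mono[of t x] x assms by (intro mult_left_mono) auto
    also have "(u - t) * y' t = 2" using pos by (simp add: u_def)
    finally show False
      using x(3) perturbed_airy_bounds[of u] perturbed_airy_bounds[of t] assms \<open>t < u\<close> by simp
  qed
qed

text \<open>\<open>V = y' A - y A'\<close> and \<open>V - \<epsilon> (t A' - A)\<close> are monotone in opposite directions and vanish at infinity.\<close>
lemma perturbed_airy_initial_slope: "- \<epsilon> \<le> y' 0 + airy_m" "y' 0 + airy_m \<le> 0"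
proof -
  define V where "V t = y' t * airyA t - y t * airyA' t" for t
  \<comment> \<open>Here t A' - A is an antiderivative of t^2 A, so U' is V' with y replaced by y -
    1. As 0 <= y <= 1, the derivatives of V and U have opposite signs.\<close>
  define U where "U t = V t - \<epsilon> * (t * airyA' t - airyA t)" for t
  have limV: "(V \<longlongrightarrow> 0) at_top"
  proof -
    have "((\<lambda>t. y' t * airyA t) \<longlongrightarrow> 0) at_top"
    proof (rule Lim_null_comparison)
      show "\<forall>\<^sub>F t in at_top. norm (y' t * airyA t) \<le> \<bar>y' 0\<bar> * airyA t"
        using eventually_ge_at_top[of 0]
      proof eventually_elim
        case (elim t)
        then have "\<bar>y' t\<bar> \<le> \<bar>y' 0\<bar>" "airyA t > 0" using perturbed_airy_slope[of t] airyA_pos[of t] by auto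
        then show ?case by (simp add: abs_mult mult_right_mono)
      qed
      show "((\<lambda>t. \<bar>y' 0\<bar> * airyA t) \<longlongrightarrow> 0) at_top" by (rule tendsto_mult_right_zero[OF tendsto_airyA])
    qed
    moreover have "((\<lambda>t. y t * airyA' t) \<longlongrightarrow> 0 * 0) at_top"
      by (intro tendsto_mult perturbed_airy_D tendsto_airyA')
    ultimately have "((\<lambda>t. y' t * airyA t - y t * airyA' t) \<longlongrightarrow> 0 - 0 * 0) at_top"
      by (rule tendsto_diff)
    then show ?thesis by (simp add: V_def[abs_def])
  qed
  have dV: "(V has_real_derivative \<epsilon> * t\<^sup>2 * y t * airyA t) (at t)" for t
    unfolding V_def[abs_def]
    by (rule derivative_eq_intros perturbed_airy_D DERIV_airy_sol DERIV_airy_sol' refl)+ (simp add: algebra_simps)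
  have dU: "(U has_real_derivative \<epsilon> * t\<^sup>2 * airyA t * (y t - 1)) (at t)" for t
    unfolding U_def[abs_def]
    by (rule derivative_eq_intros dV DERIV_airy_sol DERIV_airy_sol' refl)+ (simp add: algebra_simps power2_eq_square)
  have "V 0 \<le> V t" if "t \<ge> 0" for t
  proof (rule DERIV_nonneg_imp_nondecreasing[OF that])
    fix x :: real assume "0 \<le> x" "x \<le> t"
    then have "\<epsilon> * x\<^sup>2 * y x * airyA x \<ge> 0"
      using eps perturbed_airy_bounds[of x] airyA_pos[of x] by (intro mult_nonneg_nonneg) auto
    then show "\<exists>d. (V has_real_derivative d) (at x) \<and> 0 \<le> d" using dV by blast
  qed
  then have "\<forall>\<^sub>F t in at_top. V 0 \<le> V t"
    using eventually_ge_at_top[of 0] by (rule eventually_mono[rotated])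
  then have "V 0 \<le> 0" using tendsto_lowerbound[OF limV] trivial_limit_at_top_linorder by blast
  then show "y' 0 + airy_m \<le> 0" by (simp add: V_def y0)
  have limU: "(U \<longlongrightarrow> 0) at_top"
  proof -
    have "(U \<longlongrightarrow> 0 - \<epsilon> * (0 - 0)) at_top"
      unfolding U_def[abs_def] by (intro tendsto_intros limV tendsto_airyA' tendsto_airyA)
    then show ?thesis by simp
  qed
  have "U t \<le> U 0" if "t \<ge> 0" for t
  proof (rule DERIV_nonpos_imp_nonincreasing[OF that])
    fix x :: real assume "0 \<le> x" "x \<le> t"
    then have "\<epsilon> * x\<^sup>2 * airyA x * (y x - 1) \<le> 0"
      using eps perturbed_airy_bounds[of x] airyA_pos[of x] by (intro mult_nonneg_nonpos mult_nonneg_nonneg) auto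
    then show "\<exists>d. (U has_real_derivative d) (at x) \<and> d \<le> 0" using dU by blast
  qed
  then have "\<forall>\<^sub>F t in at_top. U t \<le> U 0"
    using eventually_ge_at_top[of 0] by (rule eventually_mono[rotated])
  then have "U 0 \<ge> 0" using tendsto_upperbound[OF limU] trivial_limit_at_top_linorder by blast
  then show "- \<epsilon> \<le> y' 0 + airy_m" by (simp add: U_def V_def y0)
qed

text \<open>After the reflection t -> - t Gronwall runs forward from the turning point. The initial
  values differ by at most \<epsilon> in the slope only, and the difference is driven by the force
  \<epsilon> x^2 A(- x).\<close>

lemma perturbed_airy_close:
  assumes "\<epsilon> \<le> 1" "T \<ge> 0" and M: "\<And>t. - T \<le> t \<Longrightarrow> t \<le> 0 \<Longrightarrow> \<bar>airyA t\<bar> \<le> M" and t: "- T \<le> t" "t \<le> 0"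
  shows "(y t - airyA t)\<^sup>2 + (y' t - airyA' t)\<^sup>2 \<le> \<epsilon>\<^sup>2 * ((1 + (T\<^sup>2 * M)\<^sup>2 * T) * exp ((2 + (T + T\<^sup>2)) * T))"
proof -
  let ?d = "\<lambda>x. y (- x) - airyA (- x)" and ?d' = "\<lambda>x. - (y' (- x) - airyA' (- x))"
  have "(?d (- t))\<^sup>2 + (?d' (- t))\<^sup>2 \<le> ((?d 0)\<^sup>2 + (?d' 0)\<^sup>2 + (\<epsilon> * T\<^sup>2 * M)\<^sup>2 * T) * exp ((2 + (T + T\<^sup>2)) * T)"
  proof (rule linear_ode_perturbation[where q = "\<lambda>x. - x + \<epsilon> * x\<^sup>2" and g = "\<lambda>x. \<epsilon> * x\<^sup>2 * airyA (- x)"])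
    fix x assume x: "0 \<le> x" "x \<le> T"
    have 1: "((\<lambda>x. y (- x)) has_real_derivative - y' (- x)) (at x)"
      "((\<lambda>x. y' (- x)) has_real_derivative - ((- x + \<epsilon> * x\<^sup>2) * y (- x))) (at x)"
      using DERIV_mirror[of y "y' (- x)" x] perturbed_airy_D(1)[of "- x"]
        DERIV_mirror[of y' "(- x + \<epsilon> * (- x)\<^sup>2) * y (- x)" x] perturbed_airy_D(2)[of "- x"] by auto
    have 2: "((\<lambda>x. airyA (- x)) has_real_derivative - airyA' (- x)) (at x)"
      "((\<lambda>x. airyA' (- x)) has_real_derivative - (- x * airyA (- x))) (at x)"
      using DERIV_mirror[of airyA "airyA' (- x)" x] DERIV_airy_sol[of 1 "- airy_m" "- x"]
        DERIV_mirror[of airyA' "- x * airyA (- x)" x] DERIV_airy_sol'[of 1 "- airy_m" "- x"] by auto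
    show "(?d has_real_derivative ?d' x) (at x)"
      by (rule derivative_eq_intros 1 2 refl)+ simp
    show "(?d' has_real_derivative (- x + \<epsilon> * x\<^sup>2) * ?d x + \<epsilon> * x\<^sup>2 * airyA (- x)) (at x)"
      by (rule derivative_eq_intros 1 2 refl)+ (simp add: algebra_simps)
    have "x\<^sup>2 \<le> T\<^sup>2" using x by (intro power_mono) auto
    then have x2: "\<epsilon> * x\<^sup>2 \<le> \<epsilon> * T\<^sup>2" "0 \<le> \<epsilon> * x\<^sup>2" "\<epsilon> * T\<^sup>2 \<le> 1 * T\<^sup>2"
      using assms eps by (auto intro: mult_left_mono) (use mult_right_mono[of \<epsilon> 1 "T\<^sup>2"] in simp)
    show "\<bar>- x + \<epsilon> * x\<^sup>2\<bar> \<le> T + T\<^sup>2" using x2 x by simp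
    show "\<bar>\<epsilon> * x\<^sup>2 * airyA (- x)\<bar> \<le> \<epsilon> * T\<^sup>2 * M"
      unfolding abs_mult using x2 x M[of "- x"] eps by (intro mult_mono) (auto simp: abs_mult)
  qed (use t in auto)
  also have "(?d 0)\<^sup>2 + (?d' 0)\<^sup>2 \<le> \<epsilon>\<^sup>2"
    using perturbed_airy_initial_slope y0 eps
    by (simp add: abs_le_square_iff[symmetric])
  then have "((?d 0)\<^sup>2 + (?d' 0)\<^sup>2 + (\<epsilon> * T\<^sup>2 * M)\<^sup>2 * T) * exp ((2 + (T + T\<^sup>2)) * T)
    \<le> (\<epsilon>\<^sup>2 + (\<epsilon> * T\<^sup>2 * M)\<^sup>2 * T) * exp ((2 + (T + T\<^sup>2)) * T)" by (intro mult_right_mono add_right_mono) auto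
  also have "\<dots> = \<epsilon>\<^sup>2 * ((1 + (T\<^sup>2 * M)\<^sup>2 * T) * exp ((2 + (T + T\<^sup>2)) * T))"
    by (simp add: algebra_simps power_mult_distrib)
  finally show ?thesis by (simp add: power2_commute)
qed

end

end

lemma perturbed_airy_uniform:
  assumes "T \<ge> 0" "e > 0"
  shows "\<exists>\<epsilon>0>0. \<forall>\<epsilon> y y'. 0 \<le> \<epsilon> \<longrightarrow> \<epsilon> \<le> \<epsilon>0 \<longrightarrow> perturbed_airy \<epsilon> y y' \<longrightarrow> y 0 = 1 \<longrightarrow>
     (\<forall>t\<in>{-T..0}. \<bar>y t - airyA t\<bar> < e \<and> \<bar>y' t - airyA' t\<bar> < e)"
proof -
  obtain M where "\<forall>x\<in>airyA ` {-T..0}. norm x \<le> M"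
    using compact_imp_bounded[OF compact_continuous_image[OF continuous_on_airy_sol(1) compact_Icc, of 1 "- airy_m" "-T" 0]]
    unfolding bounded_iff by blast
  then have M: "\<bar>airyA t\<bar> \<le> M" if "t \<in> {-T..0}" for t using that by auto
  define C where "C = (1 + (T\<^sup>2 * M)\<^sup>2 * T) * exp ((2 + (T + T\<^sup>2)) * T)"
  have "1 + (T\<^sup>2 * M)\<^sup>2 * T > 0" using assms by (intro add_pos_nonneg) auto
  then have C: "C > 0" by (simp add: C_def)
  define \<epsilon>0 where "\<epsilon>0 = min 1 (e / (2 * sqrt C))"
  show ?thesis
  proof (intro exI[of _ \<epsilon>0] conjI allI impI ballI)
    show "\<epsilon>0 > 0" using C assms by (simp add: \<epsilon>0_def)
    fix \<epsilon> y y' t assume h: "0 \<le> \<epsilon>" "\<epsilon> \<le> \<epsilon>0" "perturbed_airy \<epsilon> y y'" "y 0 = 1" "t \<in> {-T..0}"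
    have "(y t - airyA t)\<^sup>2 + (y' t - airyA' t)\<^sup>2 \<le> \<epsilon>\<^sup>2 * C"
      unfolding C_def using h M assms by (intro perturbed_airy_close) (auto simp: \<epsilon>0_def)
    also have "\<epsilon>\<^sup>2 * C \<le> (e / (2 * sqrt C))\<^sup>2 * C"
      using h C by (intro mult_right_mono power_mono) (auto simp: \<epsilon>0_def)
    also have "\<dots> = (e / 2)\<^sup>2" using C by (simp add: power_divide power_mult_distrib)
    finally have s: "(y t - airyA t)\<^sup>2 + (y' t - airyA' t)\<^sup>2 \<le> (e / 2)\<^sup>2" .
    then have "(y t - airyA t)\<^sup>2 \<le> (e / 2)\<^sup>2" "(y' t - airyA' t)\<^sup>2 \<le> (e / 2)\<^sup>2"
      using zero_le_power2[of "y t - airyA t"] zero_le_power2[of "y' t - airyA' t"] by linarith+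
    then show "\<bar>y t - airyA t\<bar> < e" "\<bar>y' t - airyA' t\<bar> < e"
      using assms(2) by (auto simp: abs_le_square_iff[symmetric])
  qed
qed

section \<open>Stability of the number of zeros\<close>

lemma compact_nonzero_bound:
  fixes f :: "real \<Rightarrow> real"
  assumes "compact K" "continuous_on K f" "\<And>x. x \<in> K \<Longrightarrow> f x \<noteq> 0"
  shows "\<exists>\<eta>>0. \<forall>x\<in>K. \<eta> \<le> \<bar>f x\<bar>"
proof (cases "K = {}")
  case False
  have "continuous_on K (\<lambda>x. \<bar>f x\<bar>)" by (intro continuous_intros assms)
  then obtain x where "x \<in> K" "\<forall>y\<in>K. \<bar>f x\<bar> \<le> \<bar>f y\<bar>"
    using continuous_attains_inf[OF assms(1) False] by blast
  then show ?thesis using assms(3)[of x] by (intro exI[of _ "\<bar>f x\<bar>"]) auto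
qed (auto intro: exI[of _ 1])

text \<open>Near each simple zero of f the sign of g' is that of f', so g is monotone there and has
  exactly one zero; away from the zeros |f| is bounded below and g has none. Closeness in the first
  derivative is what excludes additional zeros of g, and nonzero end values keep zeros from crossing
  the boundary.\<close>

lemma zero_count_stable:
  fixes f f' :: "real \<Rightarrow> real"
  assumes df: "\<And>t. (f has_real_derivative f' t) (at t)" and cont: "continuous_on UNIV f'"
    and fin: "finite {t \<in> {p..b}. f t = 0}" and simple: "\<And>t. f t = 0 \<Longrightarrow> f' t \<noteq> 0"
    and ends: "f p \<noteq> 0" "f b \<noteq> 0"
  shows "\<exists>e>0. \<forall>g g'. (\<forall>t. (g has_real_derivative g' t) (at t)) \<longrightarrow>
     (\<forall>t\<in>{p..b}. \<bar>g t - f t\<bar> < e \<and> \<bar>g' t - f' t\<bar> < e) \<longrightarrow>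
     card {t \<in> {p..b}. g t = 0} = card {t \<in> {p..b}. f t = 0}"
proof -
  define Z where "Z = {t \<in> {p..b}. f t = 0}"
  have Z: "finite Z" "\<And>z. z \<in> Z \<Longrightarrow> f z = 0 \<and> p < z \<and> z < b \<and> f' z \<noteq> 0"
    using fin ends simple by (auto simp: Z_def less_le)
  have cont_f: "continuous_on S f" for S
    using df by (meson DERIV_isCont continuous_at_imp_continuous_on)
  have ev: "\<forall>\<^sub>F \<delta> in at_right 0. \<forall>t\<in>cball z \<delta>. p < t \<and> t < b \<and> f' t * f' z > 0" if "z \<in> Z" for z
  proof -
    have "open {t. p < t \<and> t < b \<and> f' t * f' z > 0}"
      by (intro open_Collect_conj open_Collect_less continuous_intros cont)
    moreover have "z \<in> {t. p < t \<and> t < b \<and> f' t * f' z > 0}" using Z(2)[OF that]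
      by (auto simp: zero_less_mult_iff)
    ultimately obtain r where r: "r > 0" "cball z r \<subseteq> {t. p < t \<and> t < b \<and> f' t * f' z > 0}"
      using open_contains_cball by blast
    have "\<forall>t\<in>cball z \<delta>. p < t \<and> t < b \<and> f' t * f' z > 0" if "\<delta> < r" for \<delta>
    proof -
      have "cball z \<delta> \<subseteq> {t. p < t \<and> t < b \<and> f' t * f' z > 0}"
        using r(2) that by (meson less_imp_le order_trans subset_cball)
      then show ?thesis by blast
    qed
    then show ?thesis using r(1) by (auto simp: eventually_at_right_field)
  qed
  have ev_sep: "\<forall>\<^sub>F \<delta> in at_right 0. 2 * \<delta> < \<bar>z - w\<bar>" if "z \<noteq> w" for z w :: real
    unfolding eventually_at_right_field using that by (intro exI[of _ "\<bar>z - w\<bar> / 2"]) auto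
  have "\<forall>\<^sub>F \<delta> in at_right 0. \<delta> > 0 \<and> (\<forall>z\<in>Z. \<forall>t\<in>cball z \<delta>. p < t \<and> t < b \<and> f' t * f' z > 0) \<and>
     (\<forall>z\<in>Z. \<forall>w\<in>Z - {z}. 2 * \<delta> < \<bar>z - w\<bar>)"
    using Z(1) ev ev_sep by (intro eventually_conj eventually_ball_finite eventually_at_right_less ballI) auto
  then obtain \<delta> where \<delta>: "\<delta> > 0" and ball: "\<And>z t. z \<in> Z \<Longrightarrow> \<bar>t - z\<bar> \<le> \<delta> \<Longrightarrow> p < t \<and> t < b \<and> f' t * f' z > 0"
    and sep: "\<And>z w. z \<in> Z \<Longrightarrow> w \<in> Z \<Longrightarrow> z \<noteq> w \<Longrightarrow> 2 * \<delta> < \<bar>z - w\<bar>"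
    using eventually_happens'[OF trivial_limit_at_right_real] by (force simp: dist_real_def abs_minus_commute)
  define K where "K = {p..b} - (\<Union>z\<in>Z. ball z \<delta>)"
  define K' where "K' = (\<Union>z\<in>Z. cball z \<delta>)"
  have "compact K" unfolding K_def by (intro compact_diff open_UN ballI) auto
  moreover have "f t \<noteq> 0" if "t \<in> K" for t using that \<delta> by (force simp: K_def Z_def)
  ultimately obtain \<eta> where \<eta>: "\<eta> > 0" "\<And>t. t \<in> K \<Longrightarrow> \<eta> \<le> \<bar>f t\<bar>"
    using compact_nonzero_bound cont_f by metis
  have "compact K'" unfolding K'_def using Z(1) by (intro compact_UN) auto
  moreover have "f' t \<noteq> 0" if "t \<in> K'" for t
    using that ball[of _ t] by (force simp: K'_def dist_real_def abs_minus_commute)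
  ultimately obtain \<eta>' where \<eta>': "\<eta>' > 0" "\<And>t. t \<in> K' \<Longrightarrow> \<eta>' \<le> \<bar>f' t\<bar>"
    using compact_nonzero_bound continuous_on_subset[OF cont] by (metis top_greatest)
  show ?thesis
  proof (intro exI[of _ "min \<eta> \<eta>'"] conjI allI impI)
    show "min \<eta> \<eta>' > 0" using \<eta> \<eta>' by simp
    fix g g' assume dg: "\<forall>t. (g has_real_derivative g' t) (at t)"
      and close: "\<forall>t\<in>{p..b}. \<bar>g t - f t\<bar> < min \<eta> \<eta>' \<and> \<bar>g' t - f' t\<bar> < min \<eta> \<eta>'"
    have unique_zero: "\<exists>!t. \<bar>t - z\<bar> \<le> \<delta> \<and> g t = 0" if z: "z \<in> Z" for z
    proof -
      define \<sigma> where "\<sigma> = sgn (f' z)"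
      have \<sigma>: "\<bar>\<sigma>\<bar> = 1" "\<sigma> \<noteq> 0" using Z(2)[OF z] by (auto simp: \<sigma>_def abs_sgn_eq sgn_0_0)
      have pos: "\<sigma> * f' t > 0" "\<sigma> * g' t > 0" if "\<bar>t - z\<bar> \<le> \<delta>" for t
      proof -
        have "f' t * f' z > 0" and t: "t \<in> {p..b}" using ball[OF z that] by auto
        then show p: "\<sigma> * f' t > 0" unfolding \<sigma>_def by (auto simp: zero_less_mult_iff sgn_if)
        have "t \<in> K'" using that z by (auto simp: K'_def dist_real_def abs_minus_commute)
        then have "\<bar>g' t - f' t\<bar> < \<bar>f' t\<bar>" using \<eta>'(2) close t by force
        then have "\<bar>\<sigma> * g' t - \<sigma> * f' t\<bar> < \<bar>\<sigma> * f' t\<bar>"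
          using \<sigma> by (simp add: abs_mult flip: right_diff_distrib)
        then show "\<sigma> * g' t > 0" using p by linarith
      qed
      have mono_f: "\<sigma> * f s < \<sigma> * f t" if "s < t" "\<bar>s - z\<bar> \<le> \<delta>" "\<bar>t - z\<bar> \<le> \<delta>" for s t
      proof (rule DERIV_pos_imp_increasing[OF that(1)])
        fix x assume "s \<le> x" "x \<le> t"
        then have "\<bar>x - z\<bar> \<le> \<delta>" using that by linarith
        moreover have "((\<lambda>x. \<sigma> * f x) has_real_derivative \<sigma> * f' x) (at x)" by (rule DERIV_cmult[OF df])
        ultimately show "\<exists>y. ((\<lambda>x. \<sigma> * f x) has_real_derivative y) (at x) \<and> 0 < y" using pos by blast
      qed
      have mono_g: "\<sigma> * g s < \<sigma> * g t" if "s < t" "\<bar>s - z\<bar> \<le> \<delta>" "\<bar>t - z\<bar> \<le> \<delta>" for s t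
      proof (rule DERIV_pos_imp_increasing[OF that(1)])
        fix x assume "s \<le> x" "x \<le> t"
        then have "\<bar>x - z\<bar> \<le> \<delta>" using that by linarith
        moreover have "((\<lambda>x. \<sigma> * g x) has_real_derivative \<sigma> * g' x) (at x)" using dg by (intro DERIV_cmult) auto
        ultimately show "\<exists>y. ((\<lambda>x. \<sigma> * g x) has_real_derivative y) (at x) \<and> 0 < y" using pos by blast
      qed
      \<comment> \<open>Only open balls were removed from K, while K' consists of closed ones. The
        points at distance exactly \<delta> lie in both, so the lower bound on |f| is available
        where the monotonicity argument needs end values.\<close>
      have edge: "\<bar>\<sigma> * g t - \<sigma> * f t\<bar> < \<bar>\<sigma> * f t\<bar>" if t: "\<bar>t - z\<bar> = \<delta>" for t
      proof -
        have "t \<notin> ball w \<delta>" if "w \<in> Z" for w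
          using sep[OF z that] t by (cases "w = z") (auto simp: dist_real_def)
        moreover have tp: "t \<in> {p..b}" using ball[OF z, of t] t by auto
        ultimately have "t \<in> K" by (auto simp: K_def)
        then have "\<bar>g t - f t\<bar> < \<bar>f t\<bar>" using \<eta>(2) close tp by force
        then show ?thesis using \<sigma> by (simp add: abs_mult flip: right_diff_distrib)
      qed
      have "\<sigma> * f (z - \<delta>) < 0" "\<sigma> * f (z + \<delta>) > 0"
        using mono_f[of "z - \<delta>" z] mono_f[of z "z + \<delta>"] Z(2)[OF z] \<delta> by auto
      then have "\<sigma> * g (z - \<delta>) < 0" "\<sigma> * g (z + \<delta>) > 0"
        using edge[of "z - \<delta>"] edge[of "z + \<delta>"] \<delta> by auto
      moreover have "continuous_on {z - \<delta>..z + \<delta>} (\<lambda>t. \<sigma> * g t)"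
        using dg by (intro continuous_intros continuous_at_imp_continuous_on) (meson DERIV_isCont)
      ultimately obtain t where "z - \<delta> \<le> t" "t \<le> z + \<delta>" "\<sigma> * g t = 0"
        using IVT'[of "\<lambda>t. \<sigma> * g t" "z - \<delta>" 0 "z + \<delta>"] \<delta> by auto
      then have t: "\<bar>t - z\<bar> \<le> \<delta>" "g t = 0" using \<sigma> by auto
      have "s = t" if "\<bar>s - z\<bar> \<le> \<delta>" "g s = 0" for s
        using mono_g[of s t] mono_g[of t s] that t by (cases s t rule: linorder_cases) auto
      then show ?thesis using t by blast
    qed
    define h where "h z = (THE t. \<bar>t - z\<bar> \<le> \<delta> \<and> g t = 0)" for z
    have h: "\<bar>h z - z\<bar> \<le> \<delta>" "g (h z) = 0" if "z \<in> Z" for z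
      using theI'[OF unique_zero[OF that]] by (auto simp: h_def)
    have "inj_on h Z"
    proof (rule inj_onI, rule ccontr)
      fix z w assume zw: "z \<in> Z" "w \<in> Z" "h z = h w" "z \<noteq> w"
      then show False using sep[of z w] h(1)[of z] h(1)[of w] by auto
    qed
    moreover have "{t \<in> {p..b}. g t = 0} = h ` Z"
    proof (intro equalityI subsetI)
      fix t assume t: "t \<in> {t \<in> {p..b}. g t = 0}"
      have "t \<notin> K"
      proof
        assume "t \<in> K"
        then have "\<bar>g t - f t\<bar> < \<bar>f t\<bar>" using \<eta>(2) close t by force
        then show False using t by simp
      qed
      then obtain z where z: "z \<in> Z" "\<bar>t - z\<bar> \<le> \<delta>" using t by (force simp: K_def dist_real_def)
      then have "t = h z" using unique_zero[OF z(1)] h[OF z(1)] t by auto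
      then show "t \<in> h ` Z" using z by blast
    next
      fix t assume "t \<in> h ` Z"
      then obtain z where "z \<in> Z" "t = h z" by blast
      then show "t \<in> {t \<in> {p..b}. g t = 0}" using h[of z] ball[of z "h z"] by auto
    qed
    ultimately show "card {t \<in> {p..b}. g t = 0} = card {t \<in> {p..b}. f t = 0}"
      by (simp add: card_image Z_def)
  qed
qed

subsection \<open>Hermite zeros at the edge\<close>

text \<open>The exact turning point: w = H_N exp (- x^2 / 2) satisfies w'' = (x^2 - (2 N + 1)) w.
  With x = c + s t and 2 c s^3 = 1 the coefficient becomes t + s^4 t^2, without a constant error
  term.\<close>

definition edge_c :: "nat \<Rightarrow> real" where "edge_c N = sqrt (2 * real N + 1)"
definition edge_s :: "nat \<Rightarrow> real" where "edge_s N = (1 / (2 * edge_c N)) powr (1 / 3)"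

definition edge_wave :: "nat \<Rightarrow> real \<Rightarrow> real" where
  "edge_wave N t = poly (hermite N) (edge_c N + edge_s N * t) * exp (- ((edge_c N + edge_s N * t)\<^sup>2 / 2))"

definition edge_wave' :: "nat \<Rightarrow> real \<Rightarrow> real" where
  "edge_wave' N t = (let x = edge_c N + edge_s N * t in
     edge_s N * (poly (pderiv (hermite N)) x - x * poly (hermite N) x) * exp (- (x\<^sup>2 / 2)))"

lemma edge_c_pos: "edge_c N > 0" by (simp add: edge_c_def)
lemma edge_s_pos: "edge_s N > 0" using edge_c_pos[of N] by (simp add: edge_s_def)

lemma edge_s_cube: "edge_s N ^ 3 * (2 * edge_c N) = 1"
proof -
  have "edge_s N ^ 3 = edge_s N powr 3" using edge_s_pos[of N] by (simp add: powr_numeral)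
  also have "\<dots> = 1 / (2 * edge_c N)" using edge_c_pos[of N] by (simp add: edge_s_def powr_powr)
  finally show ?thesis using edge_c_pos[of N] by simp
qed

lemma DERIV_edge_gaussian:
  "((\<lambda>t. exp (- ((c + s * t)\<^sup>2 / 2))) has_real_derivative - (s * (c + s * t)) * exp (- ((c + s * t)\<^sup>2 / 2))) (at (t :: real))"
  by (auto intro!: derivative_eq_intros simp: power2_eq_square)

lemma DERIV_poly_affine:
  "((\<lambda>t. poly p (c + s * t)) has_real_derivative poly (pderiv p) (c + s * t) * s) (at (t :: real))"
  by (rule DERIV_chain2[OF poly_DERIV]) (auto intro!: derivative_eq_intros)

lemma DERIV_edge_wave: "(edge_wave N has_real_derivative edge_wave' N t) (at t)"
  unfolding edge_wave_def[abs_def] edge_wave'_def Let_def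
  by (rule DERIV_cong[OF DERIV_mult[OF DERIV_poly_affine DERIV_edge_gaussian]]) (simp add: algebra_simps)

lemma DERIV_edge_wave':
  "(edge_wave' N has_real_derivative (t + edge_s N ^ 4 * t\<^sup>2) * edge_wave N t) (at t)"
proof -
  define c s x where "c = edge_c N" and "s = edge_s N" and "x = c + s * t"
  have eq: "edge_wave' N = (\<lambda>t. s * (poly (pderiv (hermite N) - [:0, 1:] * hermite N) (c + s * t) * exp (- ((c + s * t)\<^sup>2 / 2))))"
    by (rule ext) (simp add: edge_wave'_def Let_def c_def s_def)
  have "(edge_wave' N has_real_derivative
     s\<^sup>2 * (poly (pderiv (pderiv (hermite N))) x - poly (hermite N) x - 2 * x * poly (pderiv (hermite N)) x
       + x\<^sup>2 * poly (hermite N) x) * exp (- (x\<^sup>2 / 2))) (at t)"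
    unfolding eq x_def
    by (rule DERIV_cong[OF DERIV_cmult[OF DERIV_mult[OF DERIV_poly_affine DERIV_edge_gaussian]]])
       (simp add: pderiv_diff pderiv_mult pderiv_pCons algebra_simps power2_eq_square)
  also have "poly (pderiv (pderiv (hermite N))) x - poly (hermite N) x - 2 * x * poly (pderiv (hermite N)) x
       + x\<^sup>2 * poly (hermite N) x = (x\<^sup>2 - c\<^sup>2) * poly (hermite N) x"
    by (simp add: pderiv2_hermite c_def edge_c_def algebra_simps)
  also have "s\<^sup>2 * ((x\<^sup>2 - c\<^sup>2) * poly (hermite N) x) * exp (- (x\<^sup>2 / 2))
     = (s ^ 3 * (2 * c) * t + s ^ 4 * t\<^sup>2) * (poly (hermite N) x * exp (- (x\<^sup>2 / 2)))"
    by (simp add: x_def algebra_simps power2_eq_square power3_eq_cube power4_eq_xxxx)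
  also have "\<dots> = (t + s ^ 4 * t\<^sup>2) * edge_wave N t"
    using edge_s_cube[of N] by (simp add: edge_wave_def c_def s_def x_def)
  finally show ?thesis by (simp add: s_def)
qed

lemma edge_wave_zero_iff: "edge_wave N t = 0 \<longleftrightarrow> edge_c N + edge_s N * t \<in> hermite_roots N"
  by (simp add: edge_wave_def hermite_roots_def)

lemma tendsto_edge_wave: "(edge_wave N \<longlongrightarrow> 0) at_top"
proof -
  have "((\<lambda>x. poly (pcompose (hermite N) [:0, sqrt 2:]) x * exp (- x\<^sup>2)) \<longlongrightarrow> 0) at_top"
    by (rule tendsto_poly_gaussian)
  moreover have "filterlim (\<lambda>t. (edge_c N + edge_s N * t) / sqrt 2) at_top at_top"
    using edge_s_pos[of N] by real_asymp
  ultimately have "((\<lambda>t. poly (pcompose (hermite N) [:0, sqrt 2:]) ((edge_c N + edge_s N * t) / sqrt 2)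
      * exp (- ((edge_c N + edge_s N * t) / sqrt 2)\<^sup>2)) \<longlongrightarrow> 0) at_top"
    by (rule filterlim_compose)
  then show ?thesis by (simp add: edge_wave_def[abs_def] poly_pcompose power_divide)
qed

lemma perturbed_airy_edge_wave:
  "perturbed_airy (edge_s N ^ 4) (\<lambda>t. edge_wave N t * k) (\<lambda>t. edge_wave' N t * k)"
  unfolding perturbed_airy_def
  using DERIV_cmult_right[OF DERIV_edge_wave] DERIV_cmult_right[OF DERIV_edge_wave']
    tendsto_mult_left_zero[OF tendsto_edge_wave] by (simp add: mult_ac)

text \<open>A zero there would persist to the right by monotonicity of the square, giving the
  polynomial infinitely many roots.\<close>

lemma no_hermite_root_beyond_turning_point:
  assumes "t \<ge> 0" shows "edge_wave N t \<noteq> 0"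
proof
  assume zero: "edge_wave N t = 0"
  have "edge_wave N u = 0" if "u \<ge> t" for u
    using perturbed_airy_zero_persists[OF _ perturbed_airy_edge_wave[of N 1], of t u] zero that assms by simp
  then have "(\<lambda>u. edge_c N + edge_s N * u) ` {t..} \<subseteq> hermite_roots N"
    by (auto simp: edge_wave_zero_iff)
  then have "finite ((\<lambda>u. edge_c N + edge_s N * u) ` {t..})" using finite_hermite_roots finite_subset by blast
  moreover have "inj_on (\<lambda>u. edge_c N + edge_s N * u) {t..}"
    using edge_s_pos[of N] by (auto intro!: inj_onI)
  ultimately have "finite {t..}" using finite_image_iff by blast
  then show False using infinite_Ici[of t] by simp
qed

lemma edge_s_tendsto_0: "(\<lambda>N. edge_s N ^ 4) \<longlonglongrightarrow> 0"
  unfolding edge_s_def edge_c_def by real_asymp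

text \<open>Divided by its value at 0, the rescaled wave is close to A together with its derivative
  on [p, 0], so zero counts there agree; to the right of 0 neither function has zeros.\<close>

lemma eventually_card_hermite_roots_above:
  assumes p: "p < 0" "airyA p \<noteq> 0"
  shows "\<forall>\<^sub>F N in sequentially.
    card {x \<in> hermite_roots N. edge_c N + edge_s N * p < x} = card {x \<in> airyZ. p < x}"
proof -
  have set_eq: "{t \<in> {p..0}. airyA t = 0} = {x \<in> airyZ. p < x}"
    using p airyZ_neg by (force simp: airyZ_def less_le)
  have cont: "continuous_on UNIV airyA'" by (rule continuous_on_airy_sol)
  have fin: "finite {t \<in> {p..0}. airyA t = 0}" unfolding set_eq by (rule finite_airyZ_above)
  have end0: "airyA 0 \<noteq> 0" by simp
  obtain e where e: "e > 0" and count: "\<And>g g'. \<forall>t. (g has_real_derivative g' t) (at t) \<Longrightarrow>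
     \<forall>t\<in>{p..0}. \<bar>g t - airyA t\<bar> < e \<and> \<bar>g' t - airyA' t\<bar> < e \<Longrightarrow>
     card {t \<in> {p..0}. g t = 0} = card {t \<in> {p..0}. airyA t = 0}"
    using zero_count_stable[OF DERIV_airy_sol cont fin airyA_simple_zero p(2) end0] by blast
  \<comment> \<open>The second bound prevents the threshold p itself from being a zero of the wave,
    so that roots at or above it and roots strictly above it are the same.\<close>
  define e' where "e' = min e \<bar>airyA p\<bar>"
  have "e' > 0" using e p by (simp add: e'_def)
  obtain \<epsilon>0 where \<epsilon>0: "\<epsilon>0 > 0" and close: "\<And>\<epsilon> y y'. 0 \<le> \<epsilon> \<Longrightarrow> \<epsilon> \<le> \<epsilon>0 \<Longrightarrow> perturbed_airy \<epsilon> y y' \<Longrightarrow> y 0 = 1 \<Longrightarrow>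
     \<forall>t\<in>{p..0}. \<bar>y t - airyA t\<bar> < e' \<and> \<bar>y' t - airyA' t\<bar> < e'"
    using perturbed_airy_uniform[of "- p" e'] \<open>e' > 0\<close> p by auto
  have "\<forall>\<^sub>F N in sequentially. edge_s N ^ 4 < \<epsilon>0"
    using order_tendstoD(2)[OF edge_s_tendsto_0 \<epsilon>0] .
  then show ?thesis
  proof eventually_elim
    case (elim N)
    define k where "k = 1 / edge_wave N 0"
    have k: "k \<noteq> 0" using no_hermite_root_beyond_turning_point[of 0 N] by (simp add: k_def)
    let ?g = "\<lambda>t. edge_wave N t * k" and ?g' = "\<lambda>t. edge_wave' N t * k"
    have near: "\<forall>t\<in>{p..0}. \<bar>?g t - airyA t\<bar> < e' \<and> \<bar>?g' t - airyA' t\<bar> < e'"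
      using close[OF _ _ perturbed_airy_edge_wave, of N k] elim k by (simp add: k_def)
    have "card {t \<in> {p..0}. ?g t = 0} = card {t \<in> {p..0}. airyA t = 0}"
      by (rule count) (use near DERIV_cmult_right[OF DERIV_edge_wave] in \<open>auto simp: e'_def\<close>)
    moreover have "?g p \<noteq> 0"
    proof
      assume "?g p = 0"
      then have "\<bar>0 - airyA p\<bar> < e'" using near p by (metis atLeastAtMost_iff less_imp_le order_refl)
      then show False by (simp add: e'_def)
    qed
    have "p < t \<and> t \<le> 0" if "edge_wave N t = 0" "p \<le> t" for t
      using that k \<open>?g p \<noteq> 0\<close> no_hermite_root_beyond_turning_point[of t N] by (cases "t = p"; cases "0 \<le> t") auto
    then have "{t \<in> {p..0}. ?g t = 0} = {t. p < t \<and> edge_wave N t = 0}"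
      using k by auto
    moreover have "{x \<in> hermite_roots N. edge_c N + edge_s N * p < x}
       = (\<lambda>t. edge_c N + edge_s N * t) ` {t. p < t \<and> edge_wave N t = 0}"
    proof (intro equalityI subsetI)
      fix x assume x: "x \<in> {x \<in> hermite_roots N. edge_c N + edge_s N * p < x}"
      define t where "t = (x - edge_c N) / edge_s N"
      have "x = edge_c N + edge_s N * t" using edge_s_pos[of N] by (simp add: t_def)
      then show "x \<in> (\<lambda>t. edge_c N + edge_s N * t) ` {t. p < t \<and> edge_wave N t = 0}"
        using x edge_s_pos[of N] by (auto simp: edge_wave_zero_iff)
    qed (use edge_s_pos[of N] in \<open>auto simp: edge_wave_zero_iff\<close>)
    moreover have "inj_on (\<lambda>t. edge_c N + edge_s N * t) {t. p < t \<and> edge_wave N t = 0}"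
      using edge_s_pos[of N] by (auto intro!: inj_onI)
    ultimately show ?case unfolding set_eq by (simp add: card_image)
  qed
qed

lemma airyZ_isolated:
  assumes "a \<in> airyZ" "\<delta> > 0"
  shows "\<exists>d>0. d \<le> \<delta> \<and> d < - a \<and> (\<forall>x\<in>airyZ. x \<noteq> a \<longrightarrow> d < \<bar>x - a\<bar>)"
proof -
  define F where "F = {x \<in> airyZ. a - 1 < x} - {a}"
  have F: "finite F" using finite_airyZ_above by (simp add: F_def)
  have "\<forall>\<^sub>F d in at_right 0. \<forall>x\<in>F. d < \<bar>x - a\<bar>"
  proof (intro eventually_ball_finite F ballI)
    fix x assume "x \<in> F"
    then show "\<forall>\<^sub>F d in at_right 0. d < \<bar>x - a\<bar>"
      by (intro order_tendstoD[OF tendsto_ident_at]) (auto simp: F_def)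
  qed
  moreover have "\<forall>\<^sub>F d in at_right (0 :: real). d < min \<delta> (min (- a) 1)"
    using assms airyZ_neg[OF assms(1)] by (intro order_tendstoD[OF tendsto_ident_at]) auto
  moreover have "\<forall>\<^sub>F d in at_right (0 :: real). d > 0" by (rule eventually_at_right_less)
  ultimately have "\<forall>\<^sub>F d in at_right 0. (\<forall>x\<in>F. d < \<bar>x - a\<bar>) \<and> d < min \<delta> (min (- a) 1) \<and> d > 0"
    by eventually_elim auto
  then obtain d where d: "\<forall>x\<in>F. d < \<bar>x - a\<bar>" "d < min \<delta> (min (- a) 1)" "d > 0"
    using eventually_happens'[OF trivial_limit_at_right_real] by blast
  have "d < \<bar>x - a\<bar>" if "x \<in> airyZ" "x \<noteq> a" for x
    using d that by (cases "a - 1 < x") (auto simp: F_def)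
  then show ?thesis using d by (intro exI[of _ d]) auto
qed

text \<open>For small d there are r - 1 Airy zeros above a + d and r above a - d. The same counts
  hold for the Hermite zeros when N is large, which traps the r-th largest one between the two
  thresholds.\<close>

theorem hermite_zero_edge_limit:
  assumes r: "r \<ge> 1"
  shows "(\<lambda>N. (hermite_zero (N - r + 1) N - edge_c N) / edge_s N) \<longlonglongrightarrow> airy_zero r"
proof (rule tendstoI)
  fix \<delta> :: real assume "\<delta> > 0"
  define a where "a = airy_zero r"
  have a: "a \<in> airyZ" "card {x \<in> airyZ. a < x} = r - 1" using airy_zero_props[OF r] by (auto simp: a_def)
  obtain d where d: "d > 0" "d \<le> \<delta> / 2" "d < - a" "\<And>x. x \<in> airyZ \<Longrightarrow> x \<noteq> a \<Longrightarrow> d < \<bar>x - a\<bar>"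
    using airyZ_isolated[OF a(1), of "\<delta> / 2"] \<open>\<delta> > 0\<close> by auto
  have nz: "a + d \<notin> airyZ" "a - d \<notin> airyZ" using d(4)[of "a + d"] d(4)[of "a - d"] d(1) by auto
  have "{x \<in> airyZ. a + d < x} = {x \<in> airyZ. a < x}" using d by force
  then have c1: "card {x \<in> airyZ. a + d < x} = r - 1" using a by simp
  have "{x \<in> airyZ. a - d < x} = insert a {x \<in> airyZ. a < x}" using d a by force
  then have c2: "card {x \<in> airyZ. a - d < x} = r" using a r finite_airyZ_above by simp
  have "\<forall>\<^sub>F N in sequentially. card {x \<in> hermite_roots N. edge_c N + edge_s N * (a + d) < x} = r - 1"
    using eventually_card_hermite_roots_above[of "a + d"] nz d c1 by (simp add: airyZ_def)
  moreover have "\<forall>\<^sub>F N in sequentially. card {x \<in> hermite_roots N. edge_c N + edge_s N * (a - d) < x} = r"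
    using eventually_card_hermite_roots_above[of "a - d"] nz d c2 airyZ_neg[OF a(1)] by (simp add: airyZ_def)
  moreover have "\<forall>\<^sub>F N in sequentially. r \<le> N" by (rule eventually_ge_at_top)
  ultimately show "\<forall>\<^sub>F N in sequentially. dist ((hermite_zero (N - r + 1) N - edge_c N) / edge_s N) (airy_zero r) < \<delta>"
  proof eventually_elim
    case (elim N)
    define z where "z = hermite_zero (N - r + 1) N"
    have z: "z \<in> hermite_roots N" using elim r by (auto simp: z_def intro!: hermite_zero_in_roots)
    have above: "card {x \<in> hermite_roots N. z < x} = r - 1"
      using card_roots_above_hermite_zero[OF r elim(3)] by (simp add: z_def)
    have fin: "finite {x \<in> hermite_roots N. P x}" for P by simp
    have "z \<le> edge_c N + edge_s N * (a + d)"
    proof (rule ccontr)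
      assume "\<not> ?thesis"
      then have "insert z {x \<in> hermite_roots N. z < x} \<subseteq> {x \<in> hermite_roots N. edge_c N + edge_s N * (a + d) < x}"
        using z by auto
      from card_mono[OF fin this] show False using above elim(1) r by simp
    qed
    moreover have "edge_c N + edge_s N * (a - d) < z"
    proof (rule ccontr)
      assume "\<not> ?thesis"
      then have "{x \<in> hermite_roots N. edge_c N + edge_s N * (a - d) < x} \<subseteq> {x \<in> hermite_roots N. z < x}"
        by auto
      from card_mono[OF fin this] show False using above elim(2) r by simp
    qed
    ultimately have "\<bar>(z - edge_c N) / edge_s N - a\<bar> \<le> d"
      using edge_s_pos[of N] by (simp add: field_simps abs_le_iff)
    then show ?case using d \<open>\<delta> > 0\<close> by (simp add: z_def a_def dist_real_def)
  qed
qed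

subsection \<open>A difference scheme for the Airy equation\<close>

lemma taylor_first_order:
  fixes f f' f'' :: "real \<Rightarrow> real"
  assumes d: "\<And>t. (f has_real_derivative f' t) (at t)" "\<And>t. (f' has_real_derivative f'' t) (at t)"
    and M: "\<And>t. x \<le> t \<Longrightarrow> t \<le> x + h \<Longrightarrow> \<bar>f'' t\<bar> \<le> M" and h: "h > 0"
  shows "\<bar>f (x + h) - f x - h * f' x\<bar> \<le> h\<^sup>2 * M"
proof -
  obtain \<xi> where \<xi>: "x < \<xi>" "\<xi> < x + h" "f (x + h) - f x = h * f' \<xi>"
    using MVT2[of x "x + h" f f'] d h by auto
  obtain \<zeta> where \<zeta>: "x < \<zeta>" "\<zeta> < \<xi>" "f' \<xi> - f' x = (\<xi> - x) * f'' \<zeta>"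
    using MVT2[of x \<xi> f' f''] d \<xi> by auto
  have "\<bar>f (x + h) - f x - h * f' x\<bar> = h * ((\<xi> - x) * \<bar>f'' \<zeta>\<bar>)"
    using \<xi> \<zeta> h by (simp add: abs_mult flip: right_diff_distrib)
  also have "\<dots> \<le> h * (h * M)"
    using \<xi> \<zeta> h M[of \<zeta>] by (intro mult_left_mono mult_mono) auto
  finally show ?thesis by (simp add: power2_eq_square mult.assoc)
qed

text \<open>Symplectic Euler scheme for \<open>u'' = (x + a) u\<close> with perturbed coefficients.\<close>
lemma euler_scheme_error:
  fixes u u' :: "real \<Rightarrow> real" and P G \<gamma> \<mu> :: "nat \<Rightarrow> real"
  assumes u: "\<And>t. (u has_real_derivative u' t) (at t)" "\<And>t. (u' has_real_derivative (t + a) * u t) (at t)"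
    "u 0 = 0" "u' 0 = 1"
    and M: "\<And>t. 0 \<le> t \<Longrightarrow> t \<le> Y \<Longrightarrow> \<bar>u t\<bar> \<le> M \<and> \<bar>u' t\<bar> \<le> M \<and> \<bar>(t + a) * u t\<bar> \<le> M \<and> \<bar>u t + (t + a) * u' t\<bar> \<le> M"
    and h: "0 < h" "h \<le> \<eta>" "\<eta> \<le> 1" and L: "L = \<bar>a\<bar> + Y + 1"
    and P0: "P 0 = 0" and G0: "G 0 = 1"
    and P: "\<And>k. real (Suc k) * h \<le> Y \<Longrightarrow> P (Suc k) = P k + h * \<gamma> k * G k"
    and G: "\<And>k. real (Suc k) * h \<le> Y \<Longrightarrow> G (Suc k) = G k + h * \<mu> k * P (Suc k)"
    and \<gamma>: "\<And>k. real (Suc k) * h \<le> Y \<Longrightarrow> \<bar>\<gamma> k - 1\<bar> \<le> \<eta>"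
    and \<mu>: "\<And>k. real (Suc k) * h \<le> Y \<Longrightarrow> \<bar>\<mu> k - (real k * h + a)\<bar> \<le> \<eta>"
    and kY: "real k * h \<le> Y"
  shows "\<bar>P k - u (real k * h)\<bar> + \<bar>G k - u' (real k * h)\<bar>
    \<le> real k * h * \<eta> * (M * (4 + 3 * L)) * exp ((2 + 2 * L) * (real k * h))"
  using kY
proof (induction k)
  case 0
  then show ?case by (simp add: P0 G0 u)
next
  case (Suc k)
  define x where "x = real k * h"
  have xh: "real (Suc k) * h = x + h" by (simp add: x_def algebra_simps)
  have x: "0 \<le> x" "x + h \<le> Y" "x \<le> Y" using h Suc.prems xh by (auto simp: x_def)
  have L1: "L \<ge> 1" using x by (simp add: L)
  have \<eta>0: "\<eta> > 0" using h by simp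
  define p d where "p = \<bar>P k - u x\<bar>" and "d = \<bar>G k - u' x\<bar>"
  have pd: "p \<ge> 0" "d \<ge> 0" by (auto simp: p_def d_def)
  have M0: "M \<ge> 0" using M[of x] x by force
  note Mx = M[OF x(1) x(3)]
  have h2: "h\<^sup>2 * M \<le> h * \<eta> * M" using h M0 by (simp add: power2_eq_square mult_left_mono mult_right_mono)
  have T1: "\<bar>u (x + h) - u x - h * u' x\<bar> \<le> h\<^sup>2 * M"
    using M x h by (intro taylor_first_order[OF u(1,2)]) auto
  have du'': "((\<lambda>t. (t + a) * u t) has_real_derivative u t + (t + a) * u' t) (at t)" for t
    by (rule derivative_eq_intros u refl)+ simp
  have T2: "\<bar>u' (x + h) - u' x - h * ((x + a) * u x)\<bar> \<le> h\<^sup>2 * M"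
    using M x h by (intro taylor_first_order[OF u(2) du'']) auto
  have step_u: "\<bar>u (x + h) - u x\<bar> \<le> h * M"
  proof -
    obtain \<xi> where "x < \<xi>" "\<xi> < x + h" "u (x + h) - u x = h * u' \<xi>"
      using MVT2[of x "x + h" u u'] u(1) h by auto
    then show ?thesis using M[of \<xi>] x h by (simp add: abs_mult)
  qed
  have \<gamma>k: "\<bar>\<gamma> k - 1\<bar> \<le> \<eta>" and \<mu>k: "\<bar>\<mu> k - (x + a)\<bar> \<le> \<eta>" using \<gamma> \<mu> Suc.prems by (auto simp: x_def)
  have \<mu>L: "\<bar>\<mu> k\<bar> \<le> L" using \<mu>k x h by (simp add: L)
  have "P (Suc k) - u (x + h) = (P k - u x) + h * ((\<gamma> k - 1) * G k) + h * (G k - u' x) - (u (x + h) - u x - h * u' x)"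
    using P[OF Suc.prems] by (simp add: algebra_simps)
  then have q1: "\<bar>P (Suc k) - u (x + h)\<bar> \<le> p + \<bar>h * ((\<gamma> k - 1) * G k)\<bar> + \<bar>h * (G k - u' x)\<bar> + h\<^sup>2 * M"
    using T1 unfolding p_def by linarith
  have q2: "\<bar>h * ((\<gamma> k - 1) * G k)\<bar> \<le> h * (\<eta> * (M + d))"
  proof -
    have "\<bar>G k\<bar> \<le> M + d" using Mx unfolding d_def by linarith
    then show ?thesis unfolding abs_mult using \<gamma>k h by (intro mult_mono) auto
  qed
  have q3: "\<bar>h * (G k - u' x)\<bar> = h * d" using h by (simp add: d_def abs_mult)
  have q4: "p + h * (\<eta> * (M + d)) + h * d + h\<^sup>2 * M \<le> p + 2 * h * d + 2 * h * \<eta> * M"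
  proof -
    have "h * (\<eta> * d) \<le> h * (1 * d)" using h pd by (intro mult_left_mono mult_right_mono) auto
    then show ?thesis using h2 by (simp add: algebra_simps)
  qed
  have p': "\<bar>P (Suc k) - u (x + h)\<bar> \<le> p + 2 * h * d + 2 * h * \<eta> * M"
    using q1 q2 q3 q4 by linarith
  \<comment> \<open>A cruder version without the factors h: it enters the update of G only after
    multiplication by another h.\<close>
  have p'': "\<bar>P (Suc k) - u (x + h)\<bar> \<le> p + 2 * d + 2 * \<eta> * M"
  proof -
    have "h * d \<le> 1 * d" "h * (\<eta> * M) \<le> 1 * (\<eta> * M)"
      using h pd M0 by (intro mult_right_mono; simp)+
    then show ?thesis using p' by (simp add: algebra_simps)
  qed
  have "\<mu> k * P (Suc k) - (x + a) * u x
     = \<mu> k * (P (Suc k) - u (x + h)) + \<mu> k * (u (x + h) - u x) + (\<mu> k - (x + a)) * u x"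
    by (simp add: algebra_simps)
  also have "\<bar>\<dots>\<bar> \<le> L * (p + 2 * d + 2 * \<eta> * M) + L * (\<eta> * M) + \<eta> * M"
  proof -
    have "\<bar>\<mu> k * (P (Suc k) - u (x + h))\<bar> \<le> L * (p + 2 * d + 2 * \<eta> * M)"
      unfolding abs_mult using \<mu>L p'' L1 by (intro mult_mono) auto
    moreover have "\<bar>\<mu> k * (u (x + h) - u x)\<bar> \<le> L * (\<eta> * M)"
      unfolding abs_mult using \<mu>L step_u L1 h M0 order_trans[OF step_u mult_right_mono[OF h(2) M0]]
      by (intro mult_mono) auto
    moreover have "\<bar>(\<mu> k - (x + a)) * u x\<bar> \<le> \<eta> * M"
      unfolding abs_mult using \<mu>k Mx \<eta>0 by (intro mult_mono) auto
    ultimately show ?thesis by linarith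
  qed
  finally have force: "\<bar>\<mu> k * P (Suc k) - (x + a) * u x\<bar> \<le> L * (p + 2 * d + 2 * \<eta> * M) + L * (\<eta> * M) + \<eta> * M" .
  have "G (Suc k) - u' (x + h) = (G k - u' x) + h * (\<mu> k * P (Suc k) - (x + a) * u x)
      - (u' (x + h) - u' x - h * ((x + a) * u x))"
    using G[OF Suc.prems] by (simp add: algebra_simps)
  then have "\<bar>G (Suc k) - u' (x + h)\<bar> \<le> d + \<bar>h * (\<mu> k * P (Suc k) - (x + a) * u x)\<bar> + h * \<eta> * M"
    using T2 h2 unfolding d_def by linarith
  also have "\<bar>h * (\<mu> k * P (Suc k) - (x + a) * u x)\<bar> \<le> h * (L * (p + 2 * d + 2 * \<eta> * M) + L * (\<eta> * M) + \<eta> * M)"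
    unfolding abs_mult using force h by (intro mult_mono) auto
  finally have d': "\<bar>G (Suc k) - u' (x + h)\<bar> \<le> d + h * (L * (p + 2 * d + 2 * \<eta> * M) + L * (\<eta> * M) + \<eta> * M) + h * \<eta> * M"
    by simp
  define C1 C2 where "C1 = 2 + 2 * L" and "C2 = M * (4 + 3 * L)"
  have C: "C1 \<ge> 0" "C2 \<ge> 0" using L1 M0 by (auto simp: C1_def C2_def)
  have IH: "p + d \<le> x * \<eta> * C2 * exp (C1 * x)"
    using Suc.IH x by (simp add: p_def d_def x_def C1_def C2_def)
  have "\<bar>P (Suc k) - u (x + h)\<bar> + \<bar>G (Suc k) - u' (x + h)\<bar> \<le> (p + d) + h * (C1 * (p + d)) + h * \<eta> * C2"
  proof -
    have "0 \<le> h * p * (2 + L)" using h pd L1 by simp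
    then show ?thesis using p' d' unfolding C1_def C2_def by (simp add: algebra_simps)
  qed
  also have "\<dots> = (1 + C1 * h) * (p + d) + h * \<eta> * C2" by (simp add: algebra_simps)
  \<comment> \<open>Discrete Gronwall: 1 + C1 h <= exp (C1 h) lets the accumulated exponential
    absorb one more step.\<close>
  also have "\<dots> \<le> exp (C1 * h) * (x * \<eta> * C2 * exp (C1 * x)) + h * \<eta> * C2 * exp (C1 * (x + h))"
  proof (rule add_mono)
    show "(1 + C1 * h) * (p + d) \<le> exp (C1 * h) * (x * \<eta> * C2 * exp (C1 * x))"
      using IH pd h C by (intro mult_mono) (auto simp: exp_ge_add_one_self)
    have "h * \<eta> * C2 * 1 \<le> h * \<eta> * C2 * exp (C1 * (x + h))"
      using h C \<eta>0 x by (intro mult_left_mono) auto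
    then show "h * \<eta> * C2 \<le> h * \<eta> * C2 * exp (C1 * (x + h))" by simp
  qed
  also have "\<dots> = (x + h) * \<eta> * C2 * exp (C1 * (x + h))"
    by (simp add: algebra_simps exp_add)
  finally show ?case unfolding xh C1_def C2_def .
qed

subsection \<open>Convergence of the edge profile\<close>

definition edge_u :: "nat \<Rightarrow> real \<Rightarrow> real" where
  "edge_u r x = airyA (x + airy_zero r) / airyA' (airy_zero r)"

definition edge_u' :: "nat \<Rightarrow> real \<Rightarrow> real" where
  "edge_u' r x = airyA' (x + airy_zero r) / airyA' (airy_zero r)"

lemma edge_limit_eq: "edge_limit r = edge_u r"
  unfolding edge_limit_def edge_u_def deriv_airy using airy_value0_pos by (intro ext) (simp add: airy_eq)

context
  fixes r :: nat
  assumes r: "r \<ge> 1"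
begin

lemma airyA'_zero_nonzero: "airyA' (airy_zero r) \<noteq> 0"
  using airy_zero_props(1)[OF r] airyA_simple_zero by (simp add: airyZ_def)

lemma DERIV_edge_u: "(edge_u r has_real_derivative edge_u' r x) (at x)"
  "(edge_u' r has_real_derivative (x + airy_zero r) * edge_u r x) (at x)"
proof -
  have "((\<lambda>x. airyA (x + airy_zero r)) has_real_derivative airyA' (x + airy_zero r)) (at x)"
    "((\<lambda>x. airyA' (x + airy_zero r)) has_real_derivative (x + airy_zero r) * airyA (x + airy_zero r)) (at x)"
    using DERIV_shift[of airyA "airyA' (x + airy_zero r)" x "airy_zero r"] DERIV_shift[of airyA' "(x + airy_zero r) * airyA (x + airy_zero r)" x "airy_zero r"]
      DERIV_airy_sol DERIV_airy_sol' by blast+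
  from DERIV_cdivide[OF this(1), of "airyA' (airy_zero r)"] DERIV_cdivide[OF this(2), of "airyA' (airy_zero r)"]
  show "(edge_u r has_real_derivative edge_u' r x) (at x)"
    "(edge_u' r has_real_derivative (x + airy_zero r) * edge_u r x) (at x)"
    by (simp_all add: edge_u_def[abs_def] edge_u'_def[abs_def])
qed

lemma edge_u_0: "edge_u r 0 = 0" "edge_u' r 0 = 1"
  using airy_zero_props(1)[OF r] airyA'_zero_nonzero by (simp_all add: edge_u_def edge_u'_def airyZ_def)

lemma continuous_on_edge_u [continuous_intros]: "continuous_on S (edge_u r)" "continuous_on S (edge_u' r)"
  using DERIV_edge_u by (meson DERIV_isCont continuous_at_imp_continuous_on)+

lemma edge_u_bound: "\<exists>M\<ge>1. \<forall>t. 0 \<le> t \<longrightarrow> t \<le> Y \<longrightarrow>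
   \<bar>edge_u r t\<bar> \<le> M \<and> \<bar>edge_u' r t\<bar> \<le> M \<and> \<bar>(t + airy_zero r) * edge_u r t\<bar> \<le> M \<and> \<bar>edge_u r t + (t + airy_zero r) * edge_u' r t\<bar> \<le> M"
proof -
  have bdd: "\<exists>M. \<forall>t\<in>{0..Y}. \<bar>f t\<bar> \<le> M" if cont: "continuous_on {0..Y} f" for f :: "real \<Rightarrow> real"
  proof -
    obtain M where "\<forall>x\<in>f ` {0..Y}. norm x \<le> M"
      using compact_imp_bounded[OF compact_continuous_image[OF cont compact_Icc]] unfolding bounded_iff by blast
    then show ?thesis by auto
  qed
  obtain M1 where 1: "\<forall>t\<in>{0..Y}. \<bar>edge_u r t\<bar> \<le> M1" using bdd continuous_on_edge_u by blast
  obtain M2 where 2: "\<forall>t\<in>{0..Y}. \<bar>edge_u' r t\<bar> \<le> M2" using bdd continuous_on_edge_u by blast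
  obtain M3 where 3: "\<forall>t\<in>{0..Y}. \<bar>(t + airy_zero r) * edge_u r t\<bar> \<le> M3"
  proof -
    have "continuous_on {0..Y} (\<lambda>t. (t + airy_zero r) * edge_u r t)" by (intro continuous_intros)
    from bdd[OF this] show ?thesis using that by blast
  qed
  obtain M4 where 4: "\<forall>t\<in>{0..Y}. \<bar>edge_u r t + (t + airy_zero r) * edge_u' r t\<bar> \<le> M4"
  proof -
    have "continuous_on {0..Y} (\<lambda>t. edge_u r t + (t + airy_zero r) * edge_u' r t)" by (intro continuous_intros)
    from bdd[OF this] show ?thesis using that by blast
  qed
  show ?thesis
    by (rule exI[of _ "max 1 (max (max M1 M2) (max M3 M4))"]) (use 1 2 3 4 in \<open>simp add: le_max_iff_disj\<close>)
qed

section \<open>The rescaled recurrence as a difference scheme\<close>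

definition edge_z :: "nat \<Rightarrow> real" where "edge_z N = hermite_zero (N - r + 1) N"
definition edge_h :: "nat \<Rightarrow> real" where "edge_h N = real N powr - (1 / 3)"

text \<open>The index is shifted by one: position k carries Q_(k-1), so that the convention Q_(-1) =
  0 becomes the boundary value u 0 = 0.\<close>

definition edge_P :: "nat \<Rightarrow> nat \<Rightarrow> real" where
  "edge_P N k = (case k of 0 \<Rightarrow> 0 | Suc j \<Rightarrow> real N powr (1 / 6) * dual_vec N (edge_z N) j)"

text \<open>Dividing a difference quotient by this factor multiplies it by sqrt ((N - k) / N), the
  relative size of the recurrence coefficient. \<open>edge_G\<close> is thereby the flux of a
  recurrence in divergence form.\<close>

definition edge_\<gamma> :: "nat \<Rightarrow> nat \<Rightarrow> real" where
  "edge_\<gamma> N k = sqrt (real N) / sqrt (real (N - k))"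

definition edge_G :: "nat \<Rightarrow> nat \<Rightarrow> real" where
  "edge_G N k = (edge_P N (Suc k) - edge_P N k) / (edge_h N * edge_\<gamma> N k)"

definition edge_\<mu> :: "nat \<Rightarrow> nat \<Rightarrow> real" where
  "edge_\<mu> N k = real N powr (1 / 6) * (sqrt 2 * edge_z N - sqrt (real (N - k)) - sqrt (real (N - Suc k)))"

lemma edge_z_root: "r \<le> N \<Longrightarrow> edge_z N \<in> hermite_roots N"
  unfolding edge_z_def using r by (intro hermite_zero_in_roots) auto

lemma edge_h_pos: "N > 0 \<Longrightarrow> edge_h N > 0" by (simp add: edge_h_def)

lemma edge_h_scaling:
  assumes "N > 0"
  shows "edge_h N * sqrt (real N) = real N powr (1 / 6)" "edge_h N * real N powr (1 / 3) = 1"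
    "edge_h N * real N powr (1 / 6) * real N powr (1 / 6) = 1"
  unfolding edge_h_def using assms by (simp_all add: powr_half_sqrt[symmetric] flip: powr_add)

lemma edge_\<gamma>_pos: "k < N \<Longrightarrow> edge_\<gamma> N k > 0" by (simp add: edge_\<gamma>_def)

lemma edge_P_Suc: "k < N \<Longrightarrow> edge_P N (Suc k) = edge_P N k + edge_h N * edge_\<gamma> N k * edge_G N k"
  using edge_h_pos[of N] edge_\<gamma>_pos[of k N] by (simp add: edge_G_def)

text \<open>The normalisation Q_0 = N^(-1/2) times N^(1/6) is one step width h = N^(-1/3). This is
  the initial slope u' 0 = 1 and explains the division by Ai'(a_r) in the limit.\<close>

lemma edge_G_0: assumes "r \<le> N" shows "edge_G N 0 = 1"
proof -
  have N: "N > 0" using assms r by simp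
  have "real N powr (1 / 6) * (1 / sqrt (real N)) = edge_h N"
    using N by (simp flip: edge_h_scaling(1))
  then show ?thesis
    using dual_vec_0[OF edge_z_root[OF assms]] N edge_h_pos[of N]
    by (simp add: edge_G_def edge_P_def edge_\<gamma>_def)
qed

text \<open>With B k = sqrt (N - k), subtracting (B k + B (k + 1)) q k from the recurrence turns it
  into a difference of the fluxes B (k + 1) (q (k + 1) - q k) and B k (q k - q (k - 1)). What
  remains is sqrt 2 z - B k - B (k + 1), the discrete potential \<open>edge_\<mu>\<close> up to
  scale.\<close>

lemma edge_G_Suc:
  assumes N: "r \<le> N" and k: "Suc k < N"
  shows "edge_G N (Suc k) = edge_G N k + edge_h N * edge_\<mu> N k * edge_P N (Suc k)"
proof -
  define q where "q j = dual_vec N (edge_z N) j" for j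
  define \<rho> where "\<rho> = real N powr (1 / 6)"
  have N0: "N > 0" using k by simp
  have \<rho>: "\<rho> > 0" using N0 by (simp add: \<rho>_def)
  have hs: "edge_h N * sqrt (real N) = \<rho>" and h\<rho>: "edge_h N * \<rho> * \<rho> = 1"
    using edge_h_scaling[OF N0] by (simp_all add: \<rho>_def)
  define B where "B j = sqrt (real (N - j))" for j
  have G: "edge_G N j = (edge_P N (Suc j) - edge_P N j) * B j / \<rho>" for j
    unfolding edge_G_def edge_\<gamma>_def B_def using hs by (simp add: mult.commute field_simps flip: hs)
  have rec: "sqrt 2 * edge_z N * q k = B (Suc k) * q (Suc k) + B k * (if k = 0 then 0 else q (k - 1))"
  proof (cases k)
    case 0
    then show ?thesis
      using dual_vec_rec_0[OF edge_z_root[OF N]] k by (simp add: q_def B_def real_sqrt_divide field_simps)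
  next
    case (Suc j)
    then have "edge_z N * q k = B (Suc k) / sqrt 2 * q (Suc k) + B k / sqrt 2 * q j"
      using dual_vec_rec[of j N "edge_z N"] k by (simp add: q_def B_def real_sqrt_divide)
    then have "sqrt 2 * (edge_z N * q k) = sqrt 2 * (B (Suc k) / sqrt 2 * q (Suc k) + B k / sqrt 2 * q j)"
      by simp
    also have "\<dots> = B (Suc k) * q (Suc k) + B k * q j" by (simp add: field_simps)
    finally show ?thesis using Suc by (simp add: mult.assoc)
  qed
  have Pk: "edge_P N k = \<rho> * (if k = 0 then 0 else q (k - 1))"
    by (cases k) (simp_all add: edge_P_def q_def \<rho>_def)
  have PS: "edge_P N (Suc k) = \<rho> * q k" "edge_P N (Suc (Suc k)) = \<rho> * q (Suc k)"
    by (simp_all add: edge_P_def q_def \<rho>_def)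
  have "edge_G N (Suc k) - edge_G N k = (q (Suc k) - q k) * B (Suc k) - (q k - (if k = 0 then 0 else q (k - 1))) * B k"
    unfolding G PS Pk using \<rho> by (simp add: field_simps)
  also have "\<dots> = (sqrt 2 * edge_z N - B k - B (Suc k)) * q k"
    using rec by (simp add: algebra_simps)
  also have "\<dots> = edge_h N * edge_\<mu> N k * edge_P N (Suc k)"
  proof -
    have "edge_h N * edge_\<mu> N k * edge_P N (Suc k) = (edge_h N * \<rho> * \<rho>) * ((sqrt 2 * edge_z N - B k - B (Suc k)) * q k)"
      unfolding edge_\<mu>_def PS B_def \<rho>_def by (simp add: mult_ac)
    then show ?thesis using h\<rho> by simp
  qed
  finally show ?thesis by simp
qed

text \<open>A change of centre and of scale: sqrt 2 * \<open>edge_c\<close> differs from 2 sqrt N by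
  o(N^(-1/6)), and sqrt 2 * \<open>edge_s\<close> * N^(1/6) tends to 1. The latter is computed
  through its cube, which is an explicit quotient of square roots.\<close>

lemma edge_z_scaled_limit: "(\<lambda>N. real N powr (1 / 6) * (sqrt 2 * edge_z N - 2 * sqrt (real N))) \<longlonglongrightarrow> airy_zero r"
proof -
  have l1: "(\<lambda>N. real N powr (1 / 6) * (sqrt 2 * edge_c N - 2 * sqrt (real N))) \<longlonglongrightarrow> 0"
  proof -
    have "sqrt 2 * edge_c N = sqrt (4 * real N + 2)" for N
      by (simp add: edge_c_def flip: real_sqrt_mult)
    then show ?thesis by simp real_asymp
  qed
  have l2: "(\<lambda>N. real N powr (1 / 6) * (sqrt 2 * edge_s N)) \<longlonglongrightarrow> 1"
  proof -
    have scale: "real N powr (1 / 6) * (sqrt 2 * edge_s N) = (sqrt (2 * real N) / sqrt (2 * real N + 1)) powr (1 / 3)"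
      if "N > 0" for N
    proof -
      define y where "y = real N powr (1 / 6) * (sqrt 2 * edge_s N)"
      have y: "y > 0" using that edge_s_pos[of N] by (simp add: y_def)
      have N3: "(real N powr (1 / 6)) ^ 3 = sqrt (real N)"
        using that by (simp add: powr_half_sqrt[symmetric] powr_powr flip: powr_numeral)
      have "y ^ 3 = (real N powr (1 / 6)) ^ 3 * (sqrt 2 ^ 3 * edge_s N ^ 3)"
        by (simp add: y_def power_mult_distrib)
      also have "\<dots> = sqrt (real N) * (2 * sqrt 2 * edge_s N ^ 3)"
        by (simp only: N3) (simp add: power3_eq_cube)
      also have "edge_s N ^ 3 = 1 / (2 * edge_c N)"
        using edge_s_cube[of N] edge_c_pos[of N] by (simp add: field_simps)
      finally have "y ^ 3 = sqrt (2 * real N) / sqrt (2 * real N + 1)"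
        by (simp add: edge_c_def real_sqrt_mult)
      moreover have "(y ^ 3) powr (1 / 3) = y" using y by (simp add: powr_powr flip: powr_numeral)
      ultimately show ?thesis by (simp add: y_def)
    qed
    then have "\<forall>\<^sub>F N in sequentially. (sqrt (2 * real N) / sqrt (2 * real N + 1)) powr (1 / 3) = real N powr (1 / 6) * (sqrt 2 * edge_s N)"
      by (intro eventually_mono[OF eventually_gt_at_top[of 0]]) (simp only: scale)
    moreover have "(\<lambda>N. (sqrt (2 * real N) / sqrt (2 * real N + 1)) powr (1 / 3)) \<longlonglongrightarrow> 1"
      by real_asymp
    ultimately show ?thesis by (rule Lim_transform_eventually[rotated])
  qed
  have "(\<lambda>N. real N powr (1 / 6) * (sqrt 2 * edge_c N - 2 * sqrt (real N))
      + real N powr (1 / 6) * (sqrt 2 * edge_s N) * ((edge_z N - edge_c N) / edge_s N)) \<longlonglongrightarrow> 0 + 1 * airy_zero r"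
    using hermite_zero_edge_limit[OF r] unfolding edge_z_def by (intro tendsto_intros l1 l2)
  moreover have "real N powr (1 / 6) * (sqrt 2 * edge_c N - 2 * sqrt (real N))
      + real N powr (1 / 6) * (sqrt 2 * edge_s N) * ((edge_z N - edge_c N) / edge_s N)
      = real N powr (1 / 6) * (sqrt 2 * edge_z N - 2 * sqrt (real N))" for N
    using edge_s_pos[of N] by (simp add: field_simps)
  ultimately show ?thesis by simp
qed

lemma sqrt_diff_bounds:
  assumes "0 \<le> x" "x < n"
  shows "x / (2 * sqrt n) \<le> sqrt n - sqrt (n - x)" "sqrt n - sqrt (n - x) \<le> x / (2 * sqrt (n - x))"
proof -
  have pos: "sqrt n > 0" "sqrt (n - x) > 0" "sqrt (n - x) \<le> sqrt n" using assms by auto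
  have "(sqrt n - sqrt (n - x)) * (sqrt n + sqrt (n - x)) = x"
    using assms by (simp add: algebra_simps)
  then have eq: "sqrt n - sqrt (n - x) = x / (sqrt n + sqrt (n - x))" using pos by (subst eq_divide_eq) auto
  show "x / (2 * sqrt n) \<le> sqrt n - sqrt (n - x)" "sqrt n - sqrt (n - x) \<le> x / (2 * sqrt (n - x))"
    unfolding eq using pos assms by (intro divide_left_mono; simp add: mult_pos_pos add_pos_pos)+
qed

lemma eventually_scheme_coeffs:
  assumes "\<eta> > 0" "Y > 0"
  shows "\<forall>\<^sub>F N in sequentially. r \<le> N \<and> edge_h N \<le> \<eta> \<and> (\<forall>k. real (Suc k) * edge_h N \<le> Y \<longrightarrow>
     Suc k < N \<and> \<bar>edge_\<gamma> N k - 1\<bar> \<le> \<eta> \<and> \<bar>edge_\<mu> N k - (real k * edge_h N + airy_zero r)\<bar> \<le> \<eta>)"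
proof -
  \<comment> \<open>The window k h <= Y means k <= Y N^(1/3), so this single number bounds all the
    coefficient ratios that occur, including the one at index k + 1.\<close>
  define \<Gamma> where "\<Gamma> N = sqrt (real N) / sqrt (real N - Y * real N powr (1 / 3))" for N
  have g: "\<Gamma> \<longlonglongrightarrow> 1" unfolding \<Gamma>_def by real_asymp
  have l1: "(\<lambda>N. Y * (\<Gamma> N - 1) + \<Gamma> N * (edge_h N / 2)) \<longlonglongrightarrow> Y * (1 - 1) + 1 * (0 / 2)"
  proof -
    have "edge_h \<longlonglongrightarrow> 0" unfolding edge_h_def by real_asymp
    then show ?thesis by (intro tendsto_intros g) auto
  qed
  have "\<forall>\<^sub>F N in sequentially. \<Gamma> N < 1 + \<eta>" using order_tendstoD(2)[OF g] assms by simp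
  moreover have "\<forall>\<^sub>F N in sequentially. Y * (\<Gamma> N - 1) + \<Gamma> N * (edge_h N / 2) < \<eta> / 2"
    using order_tendstoD(2)[OF l1, of "\<eta> / 2"] assms by simp
  moreover have "\<forall>\<^sub>F N in sequentially. dist (real N powr (1 / 6) * (sqrt 2 * edge_z N - 2 * sqrt (real N))) (airy_zero r) < \<eta> / 2"
    using tendstoD[OF edge_z_scaled_limit, of "\<eta> / 2"] assms by simp
  moreover have "\<forall>\<^sub>F N in sequentially. r \<le> N" by (rule eventually_ge_at_top)
  moreover have "\<forall>\<^sub>F N in sequentially. edge_h N < \<eta>"
  proof -
    have "edge_h \<longlonglongrightarrow> 0" unfolding edge_h_def by real_asymp
    then show ?thesis using order_tendstoD(2) assms by blast
  qed
  moreover have "\<forall>\<^sub>F N in sequentially. real N - Y * real N powr (1 / 3) > 1" by real_asymp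
  ultimately show ?thesis
  proof eventually_elim
    case (elim N)
    have N: "N > 0" using elim r by simp
    define h where "h = edge_h N"
    have h: "h > 0" using edge_h_pos[OF N] by (simp add: h_def)
    have hN: "h * real N powr (1 / 3) = 1" using edge_h_scaling[OF N] by (simp add: h_def)
    define \<rho> where "\<rho> = real N powr (1 / 6)"
    have \<rho>: "\<rho> = h * sqrt (real N)" using edge_h_scaling[OF N] by (simp add: \<rho>_def h_def)
    have \<rho>0: "\<rho> > 0" using N by (simp add: \<rho>_def)
    have main: "Suc k < N \<and> \<bar>edge_\<gamma> N k - 1\<bar> \<le> \<eta> \<and> \<bar>edge_\<mu> N k - (real k * h + airy_zero r)\<bar> \<le> \<eta>"
      if k: "real (Suc k) * h \<le> Y" for k
    proof -
      have kY: "real (Suc k) \<le> Y * real N powr (1 / 3)"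
      proof -
        have "real (Suc k) = (real (Suc k) * h) * real N powr (1 / 3)" using hN by (simp add: mult.assoc)
        also have "\<dots> \<le> Y * real N powr (1 / 3)" using k by (intro mult_right_mono) auto
        finally show ?thesis .
      qed
      have kN: "Suc k < N" using kY elim by linarith
      have pos: "real N - Y * real N powr (1 / 3) > 0" using elim by simp
      have root: "sqrt (real N - Y * real N powr (1 / 3)) \<le> sqrt (real N - real j)" if "j \<le> Suc k" for j
        using that kY by simp
      have \<Gamma>j: "sqrt (real N) / sqrt (real N - real j) \<le> \<Gamma> N" if "j \<le> Suc k" for j
        unfolding \<Gamma>_def using root[OF that] pos kN that by (intro divide_left_mono mult_pos_pos) auto
      have conv: "real (N - k) = real N - real k" "real (N - Suc k) = real N - real (Suc k)" using kN by auto
      have "edge_\<gamma> N k \<le> \<Gamma> N" unfolding edge_\<gamma>_def conv using \<Gamma>j[of k] by simp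
      moreover have "1 \<le> edge_\<gamma> N k" unfolding edge_\<gamma>_def conv using kN by simp
      ultimately have g: "\<bar>edge_\<gamma> N k - 1\<bar> \<le> \<eta>" using elim by simp
      \<comment> \<open>The part of \<mu> that varies with k: to first order the two square roots
        contribute k h / 2 and (k + 1) h / 2. The rest of \<mu> converges to a_r.\<close>
      define S where "S = \<rho> * ((sqrt (real N) - sqrt (real N - real k)) + (sqrt (real N) - sqrt (real N - real (Suc k))))"
      have lower: "real j * h / 2 \<le> \<rho> * (sqrt (real N) - sqrt (real N - real j))" if "j \<le> Suc k" for j
      proof -
        have "\<rho> * (real j / (2 * sqrt (real N))) \<le> \<rho> * (sqrt (real N) - sqrt (real N - real j))"
          using sqrt_diff_bounds(1)[of "real j" "real N"] that kN \<rho>0 by (intro mult_left_mono) auto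
        also have "\<rho> * (real j / (2 * sqrt (real N))) = real j * h / 2" using N by (simp add: \<rho>)
        finally show ?thesis .
      qed
      have upper: "\<rho> * (sqrt (real N) - sqrt (real N - real j)) \<le> real j * h / 2 * \<Gamma> N" if "j \<le> Suc k" for j
      proof -
        have "\<rho> * (sqrt (real N) - sqrt (real N - real j)) \<le> \<rho> * (real j / (2 * sqrt (real N - real j)))"
          using sqrt_diff_bounds(2)[of "real j" "real N"] that kN \<rho>0 by (intro mult_left_mono) auto
        also have "\<dots> = real j * h / 2 * (sqrt (real N) / sqrt (real N - real j))"
          by (simp add: \<rho>)
        also have "\<dots> \<le> real j * h / 2 * \<Gamma> N" using \<Gamma>j[OF that] h by (intro mult_left_mono) auto
        finally show ?thesis .
      qed
      have Suc_h: "real (Suc k) * h / 2 = real k * h / 2 + h / 2" by (simp add: field_simps)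
      have "S \<ge> real k * h"
        unfolding S_def distrib_left using lower[of k] lower[of "Suc k"] h Suc_h by linarith
      moreover have "S - real k * h \<le> Y * (\<Gamma> N - 1) + \<Gamma> N * (h / 2)"
      proof -
        have "S \<le> real k * h / 2 * \<Gamma> N + real (Suc k) * h / 2 * \<Gamma> N"
          unfolding S_def distrib_left using upper[of k] upper[of "Suc k"] by simp
        also have "\<dots> = real k * h * \<Gamma> N + \<Gamma> N * (h / 2)" by (simp add: field_simps)
        finally have "S - real k * h \<le> (real k * h) * (\<Gamma> N - 1) + \<Gamma> N * (h / 2)" by (simp add: algebra_simps)
        moreover have "\<Gamma> N \<ge> 1" using \<open>edge_\<gamma> N k \<le> \<Gamma> N\<close> \<open>1 \<le> edge_\<gamma> N k\<close> by simp
        moreover have "real k * h \<le> Y" using k h by (simp add: algebra_simps)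
        ultimately show ?thesis using mult_right_mono[of "real k * h" Y "\<Gamma> N - 1"] by linarith
      qed
      ultimately have S: "\<bar>S - real k * h\<bar> \<le> \<eta> / 2" using elim by (simp add: h_def)
      have "edge_\<mu> N k = \<rho> * (sqrt 2 * edge_z N - 2 * sqrt (real N)) + S"
        unfolding edge_\<mu>_def S_def \<rho>_def conv by (simp add: algebra_simps)
      moreover have "\<bar>\<rho> * (sqrt 2 * edge_z N - 2 * sqrt (real N)) - airy_zero r\<bar> < \<eta> / 2"
        using elim by (simp add: dist_real_def \<rho>_def)
      ultimately have "\<bar>edge_\<mu> N k - (real k * h + airy_zero r)\<bar> \<le> \<eta>" using S by linarith
      with kN g show ?thesis by simp
    qed
    then show ?case using elim by (simp add: h_def)
  qed
qed

text \<open>Besides closeness to u, a bound linear in k h is kept: G stays bounded, so every step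
  adds only O(h). The variance needs it because its weight 1 / k is singular at the left
  end.\<close>

lemma eventually_edge_P_close:
  assumes Y: "Y > 0"
  shows "\<exists>C>0. \<forall>\<eta>>0. \<eta> \<le> 1 \<longrightarrow> (\<forall>\<^sub>F N in sequentially. edge_h N \<le> \<eta> \<and> r \<le> N \<and>
     (\<forall>k. real k * edge_h N \<le> Y \<longrightarrow> k < N \<and>
       \<bar>edge_P N k - edge_u r (real k * edge_h N)\<bar> \<le> C * \<eta> \<and> \<bar>edge_P N k\<bar> \<le> C * (real k * edge_h N)))"
proof -
  obtain M where M: "M \<ge> 1" "\<And>t. 0 \<le> t \<Longrightarrow> t \<le> Y \<Longrightarrow>
   \<bar>edge_u r t\<bar> \<le> M \<and> \<bar>edge_u' r t\<bar> \<le> M \<and> \<bar>(t + airy_zero r) * edge_u r t\<bar> \<le> M \<and> \<bar>edge_u r t + (t + airy_zero r) * edge_u' r t\<bar> \<le> M"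
    using edge_u_bound by blast
  define L where "L = \<bar>airy_zero r\<bar> + Y + 1"
  define C0 where "C0 = Y * (M * (4 + 3 * L)) * exp ((2 + 2 * L) * Y)"
  have L: "L \<ge> 1" using Y by (simp add: L_def)
  have C0: "C0 \<ge> 0" using Y M L by (simp add: C0_def)
  define C where "C = C0 + 2 * (M + C0) + 1"
  have C: "C > 0" "C0 \<le> C" "2 * (M + C0) \<le> C" using C0 M by (auto simp: C_def)
  show ?thesis
  proof (intro exI[of _ C] conjI allI impI C)
    fix \<eta> :: real assume \<eta>: "\<eta> > 0" "\<eta> \<le> 1"
    show "\<forall>\<^sub>F N in sequentially. edge_h N \<le> \<eta> \<and> r \<le> N \<and> (\<forall>k. real k * edge_h N \<le> Y \<longrightarrow> k < N \<and>
       \<bar>edge_P N k - edge_u r (real k * edge_h N)\<bar> \<le> C * \<eta> \<and> \<bar>edge_P N k\<bar> \<le> C * (real k * edge_h N))"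
      using eventually_scheme_coeffs[OF \<eta>(1) Y]
    proof eventually_elim
      case (elim N)
      define h where "h = edge_h N"
      have N: "N > 0" using elim r by simp
      have h: "h > 0" "h \<le> \<eta>" using edge_h_pos[OF N] elim by (auto simp: h_def)
      have coeff: "Suc k < N" "\<bar>edge_\<gamma> N k - 1\<bar> \<le> \<eta>" "\<bar>edge_\<mu> N k - (real k * h + airy_zero r)\<bar> \<le> \<eta>"
        if "real (Suc k) * h \<le> Y" for k
        using elim that by (auto simp: h_def)
      have kN: "k < N" if "real k * h \<le> Y" for k
        using coeff(1)[of "k - 1"] that N by (cases k) auto
      have err: "\<bar>edge_P N k - edge_u r (real k * h)\<bar> + \<bar>edge_G N k - edge_u' r (real k * h)\<bar> \<le> C0 * \<eta>"
        if kY: "real k * h \<le> Y" for k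
      proof -
        have "\<bar>edge_P N k - edge_u r (real k * h)\<bar> + \<bar>edge_G N k - edge_u' r (real k * h)\<bar>
          \<le> real k * h * \<eta> * (M * (4 + 3 * L)) * exp ((2 + 2 * L) * (real k * h))"
        proof (rule euler_scheme_error[OF DERIV_edge_u edge_u_0 M(2) h(1) h(2) \<eta>(2) L_def])
          show "edge_P N 0 = 0" by (simp add: edge_P_def)
          show "edge_G N 0 = 1" using edge_G_0 elim by simp
          show "edge_P N (Suc k) = edge_P N k + h * edge_\<gamma> N k * edge_G N k" if "real (Suc k) * h \<le> Y" for k
            using edge_P_Suc[of k N] coeff(1)[OF that] by (simp add: h_def)
          show "edge_G N (Suc k) = edge_G N k + h * edge_\<mu> N k * edge_P N (Suc k)" if "real (Suc k) * h \<le> Y" for k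
            using edge_G_Suc[of N k] coeff(1)[OF that] elim by (simp add: h_def)
        qed (use coeff kY in auto)
        also have "\<dots> \<le> Y * \<eta> * (M * (4 + 3 * L)) * exp ((2 + 2 * L) * Y)"
          using kY h \<eta> M L Y by (intro mult_mono) (auto intro!: mult_nonneg_nonneg mult_left_mono)
        finally show ?thesis by (simp add: C0_def mult_ac)
      qed
      have Gb: "\<bar>edge_G N k\<bar> \<le> M + C0" if kY: "real k * h \<le> Y" for k
      proof -
        have "C0 * \<eta> \<le> C0 * 1" using C0 \<eta> by (intro mult_left_mono) auto
        moreover have "\<bar>edge_u' r (real k * h)\<bar> \<le> M" using M(2)[of "real k * h"] kY h by simp
        ultimately show ?thesis using err[OF kY] by linarith
      qed
      have Pb: "\<bar>edge_P N k\<bar> \<le> 2 * (M + C0) * (real k * h)" if "real k * h \<le> Y" for k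
        using that
      proof (induction k)
        case 0
        then show ?case by (simp add: edge_P_def)
      next
        case (Suc k)
        have kY: "real k * h \<le> Y" using Suc.prems h by (simp add: algebra_simps)
        have "\<bar>edge_\<gamma> N k\<bar> \<le> 2" using coeff(2)[OF Suc.prems] \<eta> by linarith
        then have "\<bar>h * edge_\<gamma> N k * edge_G N k\<bar> \<le> h * 2 * (M + C0)"
          unfolding abs_mult using Gb[OF kY] h by (intro mult_mono) auto
        then show ?case
          using Suc.IH[OF kY] edge_P_Suc[of k N] kN[OF kY] by (simp add: h_def algebra_simps)
      qed
      show ?case
      proof (intro conjI allI impI)
        fix k assume kY: "real k * edge_h N \<le> Y"
        then have k: "real k * h \<le> Y" by (simp add: h_def)
        show "k < N" by (rule kN[OF k])
        show "\<bar>edge_P N k - edge_u r (real k * edge_h N)\<bar> \<le> C * \<eta>"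
          using err[OF k] mult_right_mono[OF C(2), of \<eta>] \<eta> unfolding h_def by linarith
        show "\<bar>edge_P N k\<bar> \<le> C * (real k * edge_h N)"
          using Pb[OF k] mult_right_mono[OF C(3), of "real k * h"] h unfolding h_def by simp
      qed (use elim in auto)
    qed
  qed
qed

end

subsection \<open>Convergence of the variance\<close>

lemma tendsto_airyA_weighted: "((\<lambda>x. x * (airyA x)\<^sup>2) \<longlongrightarrow> 0) at_top"
proof (rule Lim_null_comparison)
  show "\<forall>\<^sub>F x in at_top. norm (x * (airyA x)\<^sup>2) \<le> x * (3 / x ^ 3)\<^sup>2"
    using eventually_gt_at_top[of 0]
  proof eventually_elim
    case (elim x)
    then have "(airyA x)\<^sup>2 \<le> (3 / x ^ 3)\<^sup>2"
      using airyA_le(2)[of x] airyA_pos[of x] by (intro power_mono) auto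
    then show ?case using elim by (simp add: abs_mult)
  qed
  show "((\<lambda>x::real. x * (3 / x ^ 3)\<^sup>2) \<longlongrightarrow> 0) at_top" by real_asymp
qed

context
  fixes r :: nat
  assumes r: "r \<ge> 1"
begin

definition edge_density :: "real \<Rightarrow> real" where "edge_density x = (edge_u r x)\<^sup>2 / x"

text \<open>An explicit antiderivative of - u^2 that vanishes at infinity, so its value at b is the
  mass of u^2 beyond b.\<close>

definition edge_energy :: "real \<Rightarrow> real" where
  "edge_energy x = (edge_u' r x)\<^sup>2 - (x + airy_zero r) * (edge_u r x)\<^sup>2"

lemma DERIV_edge_energy: "(edge_energy has_real_derivative - ((edge_u r x)\<^sup>2)) (at x)"
  unfolding edge_energy_def[abs_def]
  by (rule derivative_eq_intros DERIV_edge_u[OF r] refl)+ (simp add: algebra_simps power2_eq_square)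

lemma edge_energy_0: "edge_energy 0 = 1"
  by (simp add: edge_energy_def edge_u_0[OF r])

lemma tendsto_edge_energy: "(edge_energy \<longlongrightarrow> 0) at_top"
proof -
  have sh: "filterlim (\<lambda>x. x + airy_zero r) at_top at_top"
    by (rule filterlim_tendsto_add_at_top[OF tendsto_const filterlim_ident, of "airy_zero r", simplified add.commute])
  have "((\<lambda>x. (airyA' (x + airy_zero r) / airyA' (airy_zero r))\<^sup>2 - (x + airy_zero r) * (airyA (x + airy_zero r))\<^sup>2 / (airyA' (airy_zero r))\<^sup>2) \<longlongrightarrow>
     (0 / airyA' (airy_zero r))\<^sup>2 - 0 / (airyA' (airy_zero r))\<^sup>2) at_top"
    using airyA'_zero_nonzero[OF r]
    by (intro tendsto_intros filterlim_compose[OF tendsto_airyA'(2) sh] filterlim_compose[OF tendsto_airyA_weighted sh]) auto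
  then show ?thesis
    by (simp add: edge_energy_def[abs_def] edge_u_def edge_u'_def power_divide)
qed

lemma edge_energy_antimono: "x \<le> y \<Longrightarrow> edge_energy y \<le> edge_energy x"
proof (rule DERIV_nonpos_imp_nonincreasing[of x y edge_energy])
  fix t show "\<exists>d. (edge_energy has_real_derivative d) (at t) \<and> d \<le> 0"
    using DERIV_edge_energy by (intro exI[of _ "- ((edge_u r t)\<^sup>2)"]) auto
qed

lemma edge_energy_nonneg: "edge_energy x \<ge> 0"
proof (rule tendsto_upperbound[OF tendsto_edge_energy])
  show "\<forall>\<^sub>F y in at_top. edge_energy y \<le> edge_energy x"
    using eventually_ge_at_top[of x] by eventually_elim (rule edge_energy_antimono)
qed simp

lemma borel_measurable_edge [measurable]: "edge_u r \<in> borel_measurable borel" "edge_density \<in> borel_measurable borel"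
proof -
  show "edge_u r \<in> borel_measurable borel"
    by (intro borel_measurable_continuous_onI continuous_on_edge_u[OF r])
  then show "edge_density \<in> borel_measurable borel"
    unfolding edge_density_def[abs_def] by measurable
qed

text \<open>With b = 0 the total mass is \<open>edge_energy 0\<close> = 1, the continuous
  counterpart of the normalisation of the dual vectors.\<close>

lemma edge_u_sq_tail:
  "set_integrable lborel {b..} (\<lambda>x. (edge_u r x)\<^sup>2)" "(LBINT x:{b..}. (edge_u r x)\<^sup>2) = edge_energy b"
proof -
  have "(\<integral>\<^sup>+x. ennreal ((edge_u r x)\<^sup>2) * indicator {b..} x \<partial>lborel) = ennreal (0 - (- edge_energy b))"
  proof (rule nn_integral_FTC_atLeast)
    show "((\<lambda>x. - edge_energy x) has_real_derivative (edge_u r x)\<^sup>2) (at x)" for x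
      using DERIV_minus[OF DERIV_edge_energy[of x]] by simp
    show "((\<lambda>x. - edge_energy x) \<longlongrightarrow> 0) at_top" using tendsto_minus[OF tendsto_edge_energy] by simp
  qed auto
  then have "(\<integral>\<^sup>+x. ennreal ((edge_u r x)\<^sup>2 * indicator {b..} x) \<partial>lborel) = ennreal (edge_energy b)"
    by (simp add: ennreal_mult ennreal_indicator)
  then have "has_bochner_integral lborel (\<lambda>x. (edge_u r x)\<^sup>2 * indicator {b..} x) (edge_energy b)"
    by (intro has_bochner_integral_nn_integral) (auto simp: edge_energy_nonneg)
  then have "has_bochner_integral lborel (\<lambda>x. indicator {b..} x *\<^sub>R (edge_u r x)\<^sup>2) (edge_energy b)"
    by (simp add: mult.commute)
  then show "set_integrable lborel {b..} (\<lambda>x. (edge_u r x)\<^sup>2)" "(LBINT x:{b..}. (edge_u r x)\<^sup>2) = edge_energy b"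
    by (auto simp: set_integrable_def set_lebesgue_integral_def has_bochner_integral_iff)
qed

lemma edge_u_le: assumes Y: "\<forall>t. 0 \<le> t \<longrightarrow> t \<le> Y \<longrightarrow> \<bar>edge_u' r t\<bar> \<le> M" and x: "0 \<le> x" "x \<le> Y"
  shows "\<bar>edge_u r x\<bar> \<le> M * x"
proof (cases "x = 0")
  case False
  then obtain \<xi> where "0 < \<xi>" "\<xi> < x" "edge_u r x - edge_u r 0 = (x - 0) * edge_u' r \<xi>"
    using MVT2[of 0 x "edge_u r" "edge_u' r"] DERIV_edge_u[OF r] x by auto
  then show ?thesis using Y x edge_u_0[OF r] by (simp add: abs_mult mult.commute mult_right_mono)
qed (simp add: edge_u_0[OF r])

text \<open>At 0 the quotient has the value 0 by convention, which agrees with its limit because |u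
  x| <= M x.\<close>

lemma continuous_on_edge_density: "continuous_on {0..Y} edge_density"
proof (cases "Y > 0")
  case True
  obtain M where M: "M \<ge> 1" "\<forall>t. 0 \<le> t \<longrightarrow> t \<le> Y \<longrightarrow> \<bar>edge_u' r t\<bar> \<le> M"
    using edge_u_bound[OF r, of Y] by meson
  show ?thesis
  proof (rule continuous_on_eq_continuous_within[THEN iffD2], rule ballI)
    fix x assume x: "x \<in> {0..Y}"
    show "continuous (at x within {0..Y}) edge_density"
    proof (cases "x = 0")
      case False
      have "isCont (edge_u r) x" using DERIV_isCont DERIV_edge_u[OF r] by blast
      then have "isCont edge_density x"
        unfolding edge_density_def[abs_def] using False by (intro continuous_intros) auto
      then show ?thesis by (rule continuous_at_imp_continuous_at_within)
    next
      case True
      have "(edge_density \<longlongrightarrow> 0) (at 0 within {0..Y})"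
      proof (rule Lim_null_comparison)
        show "\<forall>\<^sub>F x in at 0 within {0..Y}. norm (edge_density x) \<le> M\<^sup>2 * x"
          unfolding eventually_at_filter
        proof (rule always_eventually, intro allI impI)
          fix x assume "x \<noteq> 0" "x \<in> {0..Y}"
          then have x: "x > 0" "x \<le> Y" by auto
          have "(edge_u r x)\<^sup>2 \<le> (M * x)\<^sup>2"
            using edge_u_le[OF M(2), of x] x by (metis abs_ge_zero less_imp_le power2_abs power_mono)
          then have "(edge_u r x)\<^sup>2 / x \<le> (M * x)\<^sup>2 / x" using x by (intro divide_right_mono) auto
          then show "norm (edge_density x) \<le> M\<^sup>2 * x"
            using x by (simp add: edge_density_def power2_eq_square field_simps)
        qed
        show "((\<lambda>x. M\<^sup>2 * x) \<longlongrightarrow> 0) (at 0 within {0..Y})"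
          by (auto intro!: tendsto_eq_intros)
      qed
      then show ?thesis using True by (simp add: continuous_within edge_density_def)
    qed
  qed
next
  case False
  then have "{0..Y} \<subseteq> {0}" by auto
  then show ?thesis by (rule continuous_on_subset[rotated]) simp
qed

lemma edge_density_nonneg: "x \<ge> 0 \<Longrightarrow> edge_density x \<ge> 0"
  by (simp add: edge_density_def)

lemma edge_density_tail:
  assumes "b > 0"
  shows "set_integrable lborel {b..} edge_density" "(LBINT x:{b..}. edge_density x) \<le> edge_energy b / b"
proof -
  have le: "edge_density x \<le> (edge_u r x)\<^sup>2 / b" if "x \<in> {b..}" for x
    unfolding edge_density_def using that assms by (intro divide_left_mono) auto
  have int: "set_integrable lborel {b..} (\<lambda>x. (edge_u r x)\<^sup>2 / b)"
    using set_integral_divide_zero edge_u_sq_tail(1)[of b] by (intro set_integrable_divide) auto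
  show dens: "set_integrable lborel {b..} edge_density"
  proof (rule set_integrable_bound[OF int])
    show "set_borel_measurable lborel {b..} edge_density"
      unfolding set_borel_measurable_def by measurable
    show "AE x in lborel. x \<in> {b..} \<longrightarrow> norm (edge_density x) \<le> norm ((edge_u r x)\<^sup>2 / b)"
    proof (intro AE_I2 impI)
      fix x assume x: "x \<in> {b..}"
      then show "norm (edge_density x) \<le> norm ((edge_u r x)\<^sup>2 / b)"
        using le[OF x] edge_density_nonneg[of x] assms by simp
    qed
  qed
  have "(LBINT x:{b..}. edge_density x) \<le> (LBINT x:{b..}. (edge_u r x)\<^sup>2 / b)"
    by (rule set_integral_mono[OF dens int]) (rule le)
  then show "(LBINT x:{b..}. edge_density x) \<le> edge_energy b / b"
    by (simp add: edge_u_sq_tail(2))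
qed

lemma edge_density_total:
  "set_integrable lborel {0<..} edge_density" "edge_variance r = (LBINT x:{0<..}. edge_density x)"
proof -
  have "set_integrable lborel {0..1} edge_density"
    by (rule borel_integrable_atLeastAtMost') (rule continuous_on_edge_density)
  moreover have "set_integrable lborel {1..} edge_density" by (rule edge_density_tail) simp
  ultimately have "set_integrable lborel ({0..1} \<union> {1..}) edge_density"
    by (rule set_integrable_Un) auto
  then show "set_integrable lborel {0<..} edge_density"
    by (rule set_integrable_subset) auto
  have "(airy (x + airy_zero r))\<^sup>2 / ((deriv airy (airy_zero r))\<^sup>2 * x) = edge_density x" for x
    unfolding edge_density_def edge_limit_eq[symmetric] edge_limit_def by (simp add: power_divide)
  then show "edge_variance r = (LBINT x:{0<..}. edge_density x)"
    by (simp add: edge_variance_def)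
qed

lemma edge_variance_split:
  assumes "b > 0"
  shows "edge_variance r = integral {0..b} edge_density + (LBINT x:{b..}. edge_density x)"
proof -
  have int: "set_integrable lborel {0..b} edge_density"
    by (rule borel_integrable_atLeastAtMost') (rule continuous_on_edge_density)
  have "(LBINT x:{0..b}. edge_density x) = integral {0..b} edge_density"
    by (rule set_borel_integral_eq_integral(2)[OF int])
  moreover have "(LBINT x:{0<..}. edge_density x) = (LBINT x:{0..b} \<union> {b<..}. edge_density x)"
  proof -
    have "indicator {0<..} x *\<^sub>R edge_density x = indicator ({0..b} \<union> {b<..}) x *\<^sub>R edge_density x" for x
      using assms by (cases "x = 0") (auto simp: indicator_def edge_density_def)
    then show ?thesis
      unfolding set_lebesgue_integral_def by (intro Bochner_Integration.integral_cong refl)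
  qed
  moreover have "\<dots> = (LBINT x:{0..b}. edge_density x) + (LBINT x:{b<..}. edge_density x)"
    by (rule set_integral_Un[OF _ int set_integrable_subset[OF edge_density_tail(1)[OF assms]]]) auto
  moreover have "(LBINT x:{b<..}. edge_density x) = (LBINT x:{b..}. edge_density x)"
    unfolding set_lebesgue_integral_def
    by (rule integral_cong_AE) (use AE_lborel_singleton[of b] in \<open>auto elim!: eventually_mono simp: indicator_def\<close>)
  ultimately show ?thesis by (simp add: edge_density_total(2))
qed

lemma edge_variance_tail:
  assumes "b > 0"
  shows "0 \<le> edge_variance r - integral {0..b} edge_density"
    "edge_variance r - integral {0..b} edge_density \<le> edge_energy b / b"
    "edge_variance r - integral {0..b} edge_density \<le> 1 / b"
proof -
  have eq: "edge_variance r - integral {0..b} edge_density = (LBINT x:{b..}. edge_density x)"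
    using edge_variance_split[OF assms] by simp
  have "0 \<le> (LBINT x:{b..}. edge_density x)"
    unfolding set_lebesgue_integral_def
    using assms edge_density_nonneg by (intro integral_nonneg_AE AE_I2) (auto simp: indicator_def)
  then show "0 \<le> edge_variance r - integral {0..b} edge_density" using eq by simp
  show 1: "edge_variance r - integral {0..b} edge_density \<le> edge_energy b / b"
    using edge_density_tail(2)[OF assms] eq by simp
  have "edge_energy b \<le> 1" using edge_energy_antimono[of 0 b] edge_energy_0 assms by simp
  then have "edge_energy b / b \<le> 1 / b" using assms by (intro divide_right_mono) auto
  then show "edge_variance r - integral {0..b} edge_density \<le> 1 / b" using 1 by simp
qed

section \<open>Passage to the limit in the profile and in the variance\<close>

lemma edge_profile_eq:
  assumes N: "r \<le> N" and k: "k = nat \<lfloor>real N powr (1 / 3) * y\<rfloor>" "k < N" and y: "0 \<le> y" "y < real N powr (2 / 3)"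
  shows "edge_profile r N y = edge_P r N (Suc k)"
  using poly_dual_hermite[OF k(2), of "N - r + 1"] assms r
  by (simp add: edge_profile_def edge_P_def edge_z_def[OF r])

lemma edge_profile_uniform:
  assumes Y: "Y > 0"
  shows "uniform_limit {0..Y} (\<lambda>N. edge_profile r N) (edge_limit r) sequentially"
  unfolding uniform_limit_iff
proof (intro allI impI)
  fix \<epsilon> :: real assume \<epsilon>: "\<epsilon> > 0"
  have Y1: "Y + 1 > 0" using Y by simp
  obtain C where C: "C > 0" and close: "\<And>\<eta>. \<eta> > 0 \<Longrightarrow> \<eta> \<le> 1 \<Longrightarrow> (\<forall>\<^sub>F N in sequentially. edge_h N \<le> \<eta> \<and> r \<le> N \<and>
     (\<forall>k. real k * edge_h N \<le> Y + 1 \<longrightarrow> k < N \<and>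
       \<bar>edge_P r N k - edge_u r (real k * edge_h N)\<bar> \<le> C * \<eta> \<and> \<bar>edge_P r N k\<bar> \<le> C * (real k * edge_h N)))"
    using eventually_edge_P_close[OF r Y1] by blast
  obtain M where M: "M \<ge> 1" "\<forall>t. 0 \<le> t \<longrightarrow> t \<le> Y + 1 \<longrightarrow> \<bar>edge_u' r t\<bar> \<le> M"
    using edge_u_bound[OF r, of "Y + 1"] by meson
  \<comment> \<open>The budget is shared by the error C \<eta> of the scheme and by M \<eta> for the
    distance between y and the grid point to its right at which P is sampled.\<close>
  define \<eta> where "\<eta> = min 1 (\<epsilon> / (2 * (C + M)))"
  have CM: "C + M > 0" using C M by simp
  have \<eta>: "\<eta> > 0" "\<eta> \<le> 1" "(C + M) * \<eta> < \<epsilon>"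
  proof -
    show "\<eta> > 0" "\<eta> \<le> 1" using \<epsilon> CM by (auto simp: \<eta>_def)
    have "(C + M) * \<eta> \<le> (C + M) * (\<epsilon> / (2 * (C + M)))" using CM by (intro mult_left_mono) (auto simp: \<eta>_def)
    also have "\<dots> = \<epsilon> / 2"
    proof -
      have "D * (\<epsilon> / (2 * D)) = \<epsilon> / 2" if "D > 0" for D using that by simp
      then show ?thesis using CM .
    qed
    finally show "(C + M) * \<eta> < \<epsilon>" using \<epsilon> by simp
  qed
  have "\<forall>\<^sub>F N in sequentially. Y < real N powr (2 / 3)" by real_asymp
  with close[OF \<eta>(1,2)] show "\<forall>\<^sub>F N in sequentially. \<forall>y\<in>{0..Y}. dist (edge_profile r N y) (edge_limit r y) < \<epsilon>"
  proof eventually_elim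
    case (elim N)
    have N: "N > 0" using elim r by simp
    define h where "h = edge_h N"
    have h: "h > 0" "h \<le> \<eta>" "h * real N powr (1 / 3) = 1"
      using elim edge_h_pos[OF r N] edge_h_scaling[OF r N] by (auto simp: h_def)
    show ?case
    proof
      fix y assume y: "y \<in> {0..Y}"
      define k where "k = nat \<lfloor>real N powr (1 / 3) * y\<rfloor>"
      have k: "real k \<le> real N powr (1 / 3) * y" "real N powr (1 / 3) * y < real k + 1"
        using y by (auto simp: k_def of_nat_floor)
      have yk: "(real N powr (1 / 3) * y) * h = y"
        using arg_cong[OF h(3), of "\<lambda>x. x * y"] by (simp add: mult_ac)
      have kh: "real k * h \<le> y"
        using mult_right_mono[OF k(1) less_imp_le[OF h(1)]] unfolding yk .
      have Skh: "y < real (Suc k) * h"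
        using mult_strict_right_mono[OF k(2) h(1)] unfolding yk by (simp add: add.commute)
      have SkY: "real (Suc k) * h \<le> Y + 1" using kh h \<eta> y by (simp add: algebra_simps)
      have kN: "Suc k < N" and P: "\<bar>edge_P r N (Suc k) - edge_u r (real (Suc k) * h)\<bar> \<le> C * \<eta>"
        using elim SkY unfolding h_def by blast+
      have "edge_profile r N y = edge_P r N (Suc k)"
        using elim kN y by (intro edge_profile_eq) (auto simp: k_def)
      moreover have "\<bar>edge_u r (real (Suc k) * h) - edge_u r y\<bar> \<le> M * \<eta>"
      proof -
        obtain \<xi> where \<xi>: "y < \<xi>" "\<xi> < real (Suc k) * h" "edge_u r (real (Suc k) * h) - edge_u r y = (real (Suc k) * h - y) * edge_u' r \<xi>"
          using MVT2[OF Skh, of "edge_u r" "edge_u' r"] DERIV_edge_u[OF r] by blast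
        have "real (Suc k) * h - y \<le> \<eta>" using kh h by (simp add: algebra_simps)
        then have "\<bar>(real (Suc k) * h - y) * edge_u' r \<xi>\<bar> \<le> \<eta> * M"
          unfolding abs_mult using M(2) \<xi> Skh SkY y by (intro mult_mono) auto
        then show ?thesis using \<xi> by (simp add: mult.commute)
      qed
      ultimately have "\<bar>edge_profile r N y - edge_u r y\<bar> \<le> (C + M) * \<eta>"
        using P by (simp add: algebra_simps)
      then show "dist (edge_profile r N y) (edge_limit r y) < \<epsilon>"
        using \<eta>(3) by (simp add: dist_real_def edge_limit_eq)
    qed
  qed
qed

text \<open>The second identity is exact and non-asymptotic: the vector over k has norm 1 and is
  scaled by N^(1/6). It is what controls the sum far from the edge.\<close>

lemma scaled_cov_entry_eq:
  assumes N: "r \<le> N"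
  shows "real N powr (1 / 3) * cov_entry N (N - r + 1) (N - r + 1) = (\<Sum>k<N. (edge_P r N (Suc k))\<^sup>2 / real (Suc k))"
    "(\<Sum>k<N. (edge_P r N (Suc k))\<^sup>2) = real N powr (1 / 3)"
proof -
  have sq: "(edge_P r N (Suc k))\<^sup>2 = real N powr (1 / 3) * (dual_vec N (hermite_zero (N - r + 1) N) k)\<^sup>2" for k
  proof -
    have "real N powr (1 / 6) * real N powr (1 / 6) = real N powr (1 / 3)" by (simp flip: powr_add)
    moreover have "(x * q)\<^sup>2 = (x * x) * q\<^sup>2" for x q :: real by (simp add: power2_eq_square)
    moreover have "edge_P r N (Suc k) = real N powr (1 / 6) * dual_vec N (hermite_zero (N - r + 1) N) k"
      by (simp add: edge_P_def[OF r] edge_z_def[OF r])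
    ultimately show ?thesis by presburger
  qed
  have i: "N - r + 1 \<in> {1..N}" using N r by auto
  show "real N powr (1 / 3) * cov_entry N (N - r + 1) (N - r + 1) = (\<Sum>k<N. (edge_P r N (Suc k))\<^sup>2 / real (Suc k))"
    unfolding cov_entry_eq[OF i] sum_distrib_left sq by simp
  show "(\<Sum>k<N. (edge_P r N (Suc k))\<^sup>2) = real N powr (1 / 3)"
    unfolding sq sum_distrib_left[symmetric]
    using sum_dual_vec[OF hermite_zero_in_roots[OF i] hermite_zero_in_roots[OF i]] by (simp add: power2_eq_square)
qed

lemma edge_density_cells: "integral {0..real K * h} edge_density = (\<Sum>k<K. integral {real k * h..real (Suc k) * h} edge_density)"
  if "h > 0"
proof (induction K)
  case (Suc K)
  have le: "0 \<le> real K * h" "real K * h \<le> real (Suc K) * h" using that by (auto simp: algebra_simps)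
  have "edge_density integrable_on {0..real (Suc K) * h}"
    by (rule integrable_continuous_interval) (rule continuous_on_edge_density)
  from Henstock_Kurzweil_Integration.integral_combine[OF le this] show ?case using Suc by simp
qed simp

text \<open>Written as h * P^2 / ((k + 1) h), the summands form a right-endpoint Riemann sum of
  \<open>edge_density\<close>. Uniform continuity handles the cells up to Y, and the norms of the
  discrete and the continuous profile handle the rest.\<close>

theorem variance_limit:
  "(\<lambda>N. real N powr (1 / 3) * cov_entry N (N - r + 1) (N - r + 1)) \<longlonglongrightarrow> edge_variance r"
proof (rule tendstoI)
  fix \<epsilon> :: real assume \<epsilon>: "\<epsilon> > 0"
  \<comment> \<open>The tail of the sum costs 1/Y and that of the integral 2/Y. Y > 2 ensures K h >=
    Y/2, since Y lies less than one cell of width h <= 1 beyond K h.\<close>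
  define Y where "Y = 8 / \<epsilon> + 2"
  have Y: "Y > 2" "4 / Y < \<epsilon> / 2" using \<epsilon> by (auto simp: Y_def field_simps add_pos_pos)
  obtain C where C: "C > 0" and close: "\<And>\<eta>. \<eta> > 0 \<Longrightarrow> \<eta> \<le> 1 \<Longrightarrow> (\<forall>\<^sub>F N in sequentially. edge_h N \<le> \<eta> \<and> r \<le> N \<and>
     (\<forall>k. real k * edge_h N \<le> Y \<longrightarrow> k < N \<and>
       \<bar>edge_P r N k - edge_u r (real k * edge_h N)\<bar> \<le> C * \<eta> \<and> \<bar>edge_P r N k\<bar> \<le> C * (real k * edge_h N)))"
    using eventually_edge_P_close[OF r, of Y] Y by auto
  obtain M where M: "M \<ge> 1" "\<forall>t. 0 \<le> t \<longrightarrow> t \<le> Y \<longrightarrow> \<bar>edge_u' r t\<bar> \<le> M"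
    using edge_u_bound[OF r, of Y] by meson
  define \<epsilon>1 where "\<epsilon>1 = \<epsilon> / (8 * Y)"
  have \<epsilon>1: "\<epsilon>1 > 0" using \<epsilon> Y by (simp add: \<epsilon>1_def)
  have "uniformly_continuous_on {0..Y} edge_density"
    by (rule compact_uniformly_continuous[OF continuous_on_edge_density]) simp
  then obtain \<delta> where \<delta>: "\<delta> > 0" "\<And>x y. x \<in> {0..Y} \<Longrightarrow> y \<in> {0..Y} \<Longrightarrow> \<bar>y - x\<bar> < \<delta> \<Longrightarrow> \<bar>edge_density y - edge_density x\<bar> < \<epsilon>1"
    unfolding uniformly_continuous_on_def dist_real_def using \<epsilon>1 by meson
  have CC: "C * (C + M) > 0" using C M by simp
  define \<eta> where "\<eta> = min (min 1 (\<delta> / 2)) (\<epsilon>1 / (C * (C + M)))"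
  have \<eta>: "\<eta> > 0" "\<eta> \<le> 1" "\<eta> < \<delta>" using \<delta> \<epsilon>1 CC by (auto simp: \<eta>_def)
  have \<eta>2: "C * (C + M) * \<eta> \<le> \<epsilon>1"
  proof -
    have "C * (C + M) * \<eta> \<le> C * (C + M) * (\<epsilon>1 / (C * (C + M)))" using CC by (intro mult_left_mono) (auto simp: \<eta>_def)
    also have "\<dots> = \<epsilon>1"
    proof -
      have "D * (\<epsilon>1 / D) = \<epsilon>1" if "D > 0" for D using that by simp
      then show ?thesis using CC .
    qed
    finally show ?thesis .
  qed
  show "\<forall>\<^sub>F N in sequentially. dist (real N powr (1 / 3) * cov_entry N (N - r + 1) (N - r + 1)) (edge_variance r) < \<epsilon>"
    using close[OF \<eta>(1,2)]
  proof eventually_elim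
    case (elim N)
    have N: "N > 0" "r \<le> N" using elim r by auto
    define h where "h = edge_h N"
    have h: "h > 0" "h \<le> \<eta>" "h * real N powr (1 / 3) = 1"
      using elim edge_h_pos[OF r N(1)] edge_h_scaling[OF r N(1)] by (auto simp: h_def)
    define P where "P = edge_P r N"
    have P: "k < N" "\<bar>P k - edge_u r (real k * h)\<bar> \<le> C * \<eta>" "\<bar>P k\<bar> \<le> C * (real k * h)" if "real k * h \<le> Y" for k
      using elim that by (auto simp: h_def P_def)
    define K where "K = nat \<lfloor>Y / h\<rfloor>"
    have K: "real K * h \<le> Y" "Y < real (Suc K) * h"
    proof -
      have "real K \<le> Y / h" "Y / h < real K + 1" using Y h by (auto simp: K_def of_nat_floor)
      then show "real K * h \<le> Y" "Y < real (Suc K) * h" using h by (simp_all add: field_simps)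
    qed
    have KN: "K < N" using P(1)[OF K(1)] .
    have cell: "\<bar>(P (Suc k))\<^sup>2 / real (Suc k) - integral {real k * h..real (Suc k) * h} edge_density\<bar> \<le> 2 * \<epsilon>1 * h"
      if k: "k < K" for k
    proof -
      define b where "b = real (Suc k) * h"
      have "b \<le> real K * h" unfolding b_def using k h by (intro mult_right_mono) auto
      then have b: "b \<le> Y" "b > 0" using K(1) h by (linarith, simp add: b_def)
      have kb: "real k * h = b - h" by (simp add: b_def algebra_simps)
      have bh: "0 \<le> b - h" using h by (simp flip: kb)
      have Pb: "\<bar>P (Suc k) - edge_u r b\<bar> \<le> C * \<eta>" "\<bar>P (Suc k)\<bar> \<le> C * b" using P[of "Suc k"] b by (auto simp: b_def)
      have ub: "\<bar>edge_u r b\<bar> \<le> M * b" using edge_u_le[OF M(2)] b by simp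
      have "(P (Suc k))\<^sup>2 - (edge_u r b)\<^sup>2 = (P (Suc k) - edge_u r b) * (P (Suc k) + edge_u r b)" by (simp add: algebra_simps power2_eq_square)
      then have "\<bar>(P (Suc k))\<^sup>2 - (edge_u r b)\<^sup>2\<bar> = \<bar>P (Suc k) - edge_u r b\<bar> * \<bar>P (Suc k) + edge_u r b\<bar>" by (simp add: abs_mult)
      \<comment> \<open>The linear bounds contribute a factor b = (k + 1) h, which cancels the
        division by k + 1 and leaves an error proportional to the cell width.\<close>
      also have "\<dots> \<le> (C * \<eta>) * (C * b + M * b)"
        using Pb ub C \<eta> abs_triangle_ineq[of "P (Suc k)" "edge_u r b"] by (intro mult_mono) (auto intro: order_trans)
      also have "\<dots> = (C * (C + M) * \<eta>) * b" by (simp add: algebra_simps)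
      also have "\<dots> \<le> \<epsilon>1 * b" using \<eta>2 b by (intro mult_right_mono) auto
      finally have "\<bar>(P (Suc k))\<^sup>2 - (edge_u r b)\<^sup>2\<bar> / real (Suc k) \<le> \<epsilon>1 * b / real (Suc k)"
        by (intro divide_right_mono) auto
      also have "\<epsilon>1 * b / real (Suc k) = \<epsilon>1 * h" by (simp add: b_def)
      finally have e1: "\<bar>(P (Suc k))\<^sup>2 / real (Suc k) - h * edge_density b\<bar> \<le> \<epsilon>1 * h"
      proof -
        have "h * edge_density b = (edge_u r b)\<^sup>2 / real (Suc k)" using h by (simp add: edge_density_def b_def)
        then show "\<bar>(P (Suc k))\<^sup>2 - (edge_u r b)\<^sup>2\<bar> / real (Suc k) \<le> \<epsilon>1 * h \<Longrightarrow> ?thesis"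
          by (simp add: diff_divide_distrib[symmetric])
      qed
      have int: "edge_density integrable_on {b - h..b}"
        by (rule integrable_continuous_interval, rule continuous_on_subset[OF continuous_on_edge_density[of Y]]) (use bh b in auto)
      have "\<bar>integral {b - h..b} (\<lambda>x. edge_density x - edge_density b)\<bar> \<le> \<epsilon>1 * (b - (b - h))"
      proof -
        have "norm (integral {b - h..b} (\<lambda>x. edge_density x - edge_density b)) \<le> \<epsilon>1 * measure lborel {b - h..b}"
        proof (rule has_integral_bound_real)
          show "((\<lambda>x. edge_density x - edge_density b) has_integral integral {b - h..b} (\<lambda>x. edge_density x - edge_density b)) {b - h..b}"
            by (intro integrable_integral integrable_diff int integrable_const_ivl)
          show "norm (edge_density x - edge_density b) \<le> \<epsilon>1" if "x \<in> {b - h..b} - {}" for x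
          proof -
            have "x \<in> {0..Y}" "b \<in> {0..Y}" "\<bar>x - b\<bar> < \<delta>" using that bh b h \<eta> by auto
            then show ?thesis using \<delta>(2)[of b x] by simp
          qed
        qed (use \<epsilon>1 in simp_all)
        then show ?thesis using h by simp
      qed
      moreover have "integral {b - h..b} (\<lambda>x. edge_density x - edge_density b) = integral {b - h..b} edge_density - h * edge_density b"
        using int h by (subst integral_diff) auto
      ultimately have "\<bar>integral {b - h..b} edge_density - h * edge_density b\<bar> \<le> \<epsilon>1 * h" by simp
      then show ?thesis using e1 unfolding kb b_def[symmetric] by linarith
    qed
    have "\<bar>(\<Sum>k<K. (P (Suc k))\<^sup>2 / real (Suc k)) - integral {0..real K * h} edge_density\<bar>
      \<le> (\<Sum>k<K. 2 * \<epsilon>1 * h)"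
      unfolding edge_density_cells[OF h(1)] sum_subtractf[symmetric]
      by (rule order_trans[OF sum_abs sum_mono]) (use cell in auto)
    also have "\<dots> = 2 * \<epsilon>1 * (real K * h)" by simp
    also have "\<dots> \<le> 2 * \<epsilon>1 * Y" using K \<epsilon>1 by (intro mult_left_mono) auto
    also have "\<dots> = \<epsilon> / 4" using Y by (simp add: \<epsilon>1_def)
    finally have head: "\<bar>(\<Sum>k<K. (P (Suc k))\<^sup>2 / real (Suc k)) - integral {0..real K * h} edge_density\<bar> \<le> \<epsilon> / 4" .
    have tail: "0 \<le> (\<Sum>k\<in>{K..<N}. (P (Suc k))\<^sup>2 / real (Suc k))"
      "(\<Sum>k\<in>{K..<N}. (P (Suc k))\<^sup>2 / real (Suc k)) \<le> 1 / Y"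
    proof -
      show "0 \<le> (\<Sum>k\<in>{K..<N}. (P (Suc k))\<^sup>2 / real (Suc k))" by (intro sum_nonneg) auto
      \<comment> \<open>Beyond K the weight is at most 1 / (K + 1), and the squares add up to at
        most N^(1/3) = 1 / h.\<close>
      have "(\<Sum>k\<in>{K..<N}. (P (Suc k))\<^sup>2 / real (Suc k)) \<le> (\<Sum>k\<in>{K..<N}. (P (Suc k))\<^sup>2 / real (Suc K))"
        by (intro sum_mono divide_left_mono) auto
      also have "\<dots> = (\<Sum>k\<in>{K..<N}. (P (Suc k))\<^sup>2) / real (Suc K)" by (simp add: sum_divide_distrib)
      also have "\<dots> \<le> (\<Sum>k<N. (P (Suc k))\<^sup>2) / real (Suc K)"
        by (intro divide_right_mono sum_mono2) auto
      also have "\<dots> = 1 / (real (Suc K) * h)"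
      proof -
        have "real N powr (1 / 3) = 1 / h" using h by (simp add: field_simps)
        then show ?thesis using scaled_cov_entry_eq(2)[OF N(2)] by (simp add: P_def)
      qed
      also have "\<dots> \<le> 1 / Y" using K(2) Y by (intro divide_left_mono) auto
      finally show "(\<Sum>k\<in>{K..<N}. (P (Suc k))\<^sup>2 / real (Suc k)) \<le> 1 / Y" .
    qed
    have Kh: "real K * h \<ge> Y / 2" using K(2) h \<eta> Y by (simp add: algebra_simps)
    have "1 / (real K * h) \<le> 1 / (Y / 2)" using Kh Y by (intro divide_left_mono) auto
    then have "1 / (real K * h) \<le> 2 / Y" by simp
    then have rest: "0 \<le> edge_variance r - integral {0..real K * h} edge_density"
      "edge_variance r - integral {0..real K * h} edge_density \<le> 2 / Y"
      using edge_variance_tail[of "real K * h"] Kh Y by auto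
    have "(\<Sum>k<N. (P (Suc k))\<^sup>2 / real (Suc k)) = (\<Sum>k<K. (P (Suc k))\<^sup>2 / real (Suc k)) + (\<Sum>k\<in>{K..<N}. (P (Suc k))\<^sup>2 / real (Suc k))"
      using sum.atLeastLessThan_concat[of 0 K N "\<lambda>k. (P (Suc k))\<^sup>2 / real (Suc k)"] KN by (simp add: atLeast0LessThan)
    then have "\<bar>(\<Sum>k<N. (P (Suc k))\<^sup>2 / real (Suc k)) - edge_variance r\<bar> \<le> \<epsilon> / 4 + 4 / Y"
    proof -
      have "2 / Y = 2 * (1 / Y)" "4 / Y = 4 * (1 / Y)" by simp_all
      moreover have "1 / Y > 0" using Y by simp
      ultimately show "(\<Sum>k<N. (P (Suc k))\<^sup>2 / real (Suc k)) = (\<Sum>k<K. (P (Suc k))\<^sup>2 / real (Suc k)) + (\<Sum>k\<in>{K..<N}. (P (Suc k))\<^sup>2 / real (Suc k)) \<Longrightarrow> ?thesis"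
        using head tail rest by linarith
    qed
    then show ?case
      using Y \<epsilon> scaled_cov_entry_eq(1)[OF N(2)] by (simp add: dist_real_def P_def)
  qed
qed

end

subsection \<open>Closed forms for integrals of the squared Airy function\<close>

definition airy_sq_coeff :: "nat \<Rightarrow> real" where
  "airy_sq_coeff n = (\<Sum>i\<le>n. airy_coeff 1 (- airy_m) i * airy_coeff 1 (- airy_m) (n - i))"

lemma airy_sq_coeff_0: "airy_sq_coeff 0 = 1" "airy_sq_coeff 1 = - 2 * airy_m" "airy_sq_coeff 2 = airy_m\<^sup>2"
  by (simp_all add: airy_sq_coeff_def eval_nat_numeral)

text \<open>The square of a solution of \<open>y'' = t y\<close> solves \<open>w''' = 4 t w' + 2 w\<close>.\<close>
lemma airy_sq_coeff_rec:
  "airy_sq_coeff (n + 3) = airy_sq_coeff n * real (4 * n + 2) / (real (n + 1) * real (n + 2) * real (n + 3))"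
proof -
  define U where "U = Abs_fps (airy_coeff 1 (- airy_m))"
  have ode: "fps_deriv (fps_deriv U) = fps_X * U"
  proof (rule fps_ext)
    fix n show "fps_nth (fps_deriv (fps_deriv U)) n = fps_nth (fps_X * U) n"
      by (cases n) (simp_all add: U_def divide_simps)
  qed
  have sq: "fps_nth (U * U) n = airy_sq_coeff n" for n
    by (simp add: U_def fps_mult_nth airy_sq_coeff_def atMost_atLeast0)
  have "fps_deriv (fps_deriv (fps_deriv (U * U)))
      = 3 * (fps_deriv (fps_deriv U)) * fps_deriv U * 2 + 2 * U * fps_deriv (fps_deriv (fps_deriv U))"
    by (simp add: algebra_simps)
  also have "\<dots> = 4 * fps_X * fps_deriv (U * U) + 2 * (U * U)"
    unfolding ode by (simp add: algebra_simps)
  finally have W: "fps_deriv (fps_deriv (fps_deriv (U * U))) = fps_X * (4 * fps_deriv (U * U)) + 2 * (U * U)"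
    by (simp add: mult_ac)
  define W where "W = U * U"
  have "fps_nth (fps_deriv (fps_deriv (fps_deriv W))) n = fps_nth (fps_X * (4 * fps_deriv W) + 2 * W) n"
    unfolding W_def W ..
  then have "real (n + 1) * (real (n + 2) * (real (n + 3) * airy_sq_coeff (n + 3))) = (4 * real n + 2) * airy_sq_coeff n"
    unfolding sq[symmetric] W_def[symmetric]
    by (cases n) (simp_all add: numeral_fps_const eval_nat_numeral algebra_simps)
  moreover have "real (n + 1) * real (n + 2) * real (n + 3) \<noteq> 0" by simp
  ultimately show ?thesis by (subst nonzero_eq_divide_eq) (auto simp: algebra_simps)
qed

lemma airy_sq_sums: "(\<lambda>n. airy_sq_coeff n * x ^ n) sums (airyA x)\<^sup>2"
proof -
  let ?f = "\<lambda>n. airy_coeff 1 (- airy_m) n * x ^ n"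
  have "summable (\<lambda>n. norm (?f n))" using abs_summable_airy_coeff by simp
  from Cauchy_product_sums[OF this this]
  have "(\<lambda>k. \<Sum>i\<le>k. ?f i * ?f (k - i)) sums (airyA x * airyA x)" by (simp add: airy_sol_def)
  moreover have "(\<Sum>i\<le>k. ?f i * ?f (k - i)) = airy_sq_coeff k * x ^ k" for k
    unfolding airy_sq_coeff_def sum_distrib_right
    by (intro sum.cong refl) (simp add: mult_ac flip: power_add)
  ultimately show ?thesis by (simp add: power2_eq_square)
qed

lemma abs_summable_airy_sq: "summable (\<lambda>n. \<bar>airy_sq_coeff n * x ^ n\<bar>)"
proof (rule summable_step3[where K = 4])
  fix n
  have "\<bar>airy_sq_coeff (n + 3)\<bar> = \<bar>airy_sq_coeff n\<bar> * (real (4 * n + 2) / (real (n + 1) * real (n + 2) * real (n + 3)))"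
    unfolding airy_sq_coeff_rec by (simp add: abs_mult)
  also have "\<dots> \<le> \<bar>airy_sq_coeff n\<bar> * (4 / real (n + 1))"
  proof (intro mult_left_mono)
    have "real (4 * n + 2) * 1 \<le> (4 * real (n + 2)) * real (n + 3)" by (intro mult_mono) auto
    then have "real (4 * n + 2) / (real (n + 1) * real (n + 2) * real (n + 3))
        \<le> (4 * real (n + 2) * real (n + 3)) / (real (n + 1) * real (n + 2) * real (n + 3))"
      by (intro divide_right_mono) auto
    also have "\<dots> = 4 / real (n + 1)"
    proof -
      have "(4 * q * r) / (p * q * r) = 4 / p" if "q \<noteq> 0" "r \<noteq> 0" for p q r :: real using that by simp
      then show ?thesis by this auto
    qed
    finally show "real (4 * n + 2) / (real (n + 1) * real (n + 2) * real (n + 3)) \<le> 4 / real (n + 1)" .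
  qed auto
  finally show "\<bar>airy_sq_coeff (n + 3)\<bar> \<le> \<bar>airy_sq_coeff n\<bar> * 4 / real (n + 1)" by simp
qed simp

lemma summable_airy_sq: "summable (\<lambda>n. airy_sq_coeff n * x ^ n)"
  by (rule summable_rabs_cancel[OF abs_summable_airy_sq])

lemma DERIV_power_series_antideriv:
  fixes v :: "nat \<Rightarrow> real"
  assumes sm: "\<And>x. summable (\<lambda>n. v n * x ^ n)"
  shows "((\<lambda>x. \<Sum>n. v n / real (Suc n) * x ^ Suc n) has_real_derivative (\<Sum>n. v n * x ^ n)) (at x)"
    "summable (\<lambda>n. v n / real (Suc n) * x ^ Suc n)"
proof -
  define w where "w n = (case n of 0 \<Rightarrow> 0 | Suc k \<Rightarrow> v k / real (Suc k))" for n
  have abs: "summable (\<lambda>n. \<bar>v n * x ^ n\<bar>)" for x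
    using powser_insidea[OF sm[of "\<bar>x\<bar> + 1"], of x] by simp
  have smS: "summable (\<lambda>n. v n / real (Suc n) * x ^ Suc n)" for x
  proof (rule summable_comparison_test')
    show "summable (\<lambda>n. \<bar>x\<bar> * \<bar>v n * x ^ n\<bar>)" by (rule summable_mult[OF abs])
    fix n :: nat
    have "\<bar>v n * x ^ Suc n\<bar> / real (Suc n) \<le> \<bar>v n * x ^ Suc n\<bar> / 1" by (intro divide_left_mono) auto
    then show "norm (v n / real (Suc n) * x ^ Suc n) \<le> \<bar>x\<bar> * \<bar>v n * x ^ n\<bar>"
      by (simp add: abs_mult mult_ac)
  qed
  have wS: "(\<lambda>n. w (Suc n) * x ^ Suc n) = (\<lambda>n. v n / real (Suc n) * x ^ Suc n)" for x by (simp add: w_def)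
  have smw: "summable (\<lambda>n. w n * x ^ n)" for x
    using smS[of x] unfolding wS[symmetric] by (rule summable_Suc_iff[THEN iffD1])
  have "((\<lambda>x. \<Sum>n. w n * x ^ n) has_real_derivative (\<Sum>n. diffs w n * x ^ n)) (at x)"
    by (rule termdiffs_strong_converges_everywhere) (rule smw)
  moreover have "diffs w = v" by (rule ext) (simp add: diffs_def w_def)
  moreover have "(\<Sum>n. w n * x ^ n) = (\<Sum>n. v n / real (Suc n) * x ^ Suc n)" for x
    using suminf_split_head[OF smw[of x]] by (simp add: w_def)
  ultimately show "((\<lambda>x. \<Sum>n. v n / real (Suc n) * x ^ Suc n) has_real_derivative (\<Sum>n. v n * x ^ n)) (at x)" by simp
  show "summable (\<lambda>n. v n / real (Suc n) * x ^ Suc n)" by (rule smS)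
qed

text \<open>The function A'^2 - x A^2 plus an antiderivative of A^2 is constant; comparing its
  values at z and 0 gives a power series for A'(z)^2, the denominator of the variance.\<close>

lemma airyA'_sq_at_zero:
  assumes "airyA z = 0"
  shows "(airyA' z)\<^sup>2 = airy_m\<^sup>2 - z * (\<Sum>n. airy_sq_coeff n * z ^ n / real (Suc n))"
    "summable (\<lambda>n. airy_sq_coeff n * z ^ n / real (Suc n))"
proof -
  define Q where "Q x = (\<Sum>n. airy_sq_coeff n / real (Suc n) * x ^ Suc n)" for x
  have dQ: "(Q has_real_derivative (airyA x)\<^sup>2) (at x)" for x
    unfolding Q_def[abs_def] using DERIV_power_series_antideriv(1)[OF summable_airy_sq, of x] airy_sq_sums[of x]
    by (simp add: sums_iff)
  have "((\<lambda>x. (airyA' x)\<^sup>2 - x * (airyA x)\<^sup>2 + Q x) has_real_derivative 0) (at x)" for x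
    by (rule derivative_eq_intros dQ DERIV_airy_sol DERIV_airy_sol' refl)+ (simp add: algebra_simps power2_eq_square)
  from DERIV_const_ratio_const[OF _ this] DERIV_isconst_all[OF allI[OF this], of z 0]
  have "(airyA' z)\<^sup>2 + Q z = airy_m\<^sup>2 + Q 0" using assms by simp
  moreover have "Q 0 = 0" by (simp add: Q_def)
  moreover have Qz: "(\<lambda>n. airy_sq_coeff n / real (Suc n) * z ^ Suc n) = (\<lambda>n. z * (airy_sq_coeff n * z ^ n / real (Suc n)))"
    by (rule ext) simp
  moreover show sm: "summable (\<lambda>n. airy_sq_coeff n * z ^ n / real (Suc n))"
  proof (rule summable_comparison_test'[OF abs_summable_airy_sq[of z]])
    fix n
    show "norm (airy_sq_coeff n * z ^ n / real (Suc n)) \<le> \<bar>airy_sq_coeff n * z ^ n\<bar>"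
      using divide_left_mono[of 1 "real (Suc n)" "\<bar>airy_sq_coeff n * z ^ n\<bar>"] by (simp add: abs_mult)
  qed
  moreover have "Q z = z * (\<Sum>n. airy_sq_coeff n * z ^ n / real (Suc n))"
    unfolding Q_def Qz by (rule suminf_mult[OF sm])
  ultimately show "(airyA' z)\<^sup>2 = airy_m\<^sup>2 - z * (\<Sum>n. airy_sq_coeff n * z ^ n / real (Suc n))"
    by linarith
qed

text \<open>\<open>W = A\<^sup>2\<close> vanishes at \<open>z\<close>, and the partial sums \<open>s\<^sub>n\<close> of its Taylor series at \<open>z\<close> are, up to powers of \<open>z\<close>,
  the Taylor coefficients of \<open>W(t) / (t - z)\<close>.\<close>
lemma airy_sq_quotient:
  assumes z: "airyA z = 0" "z \<noteq> 0"
  defines "s \<equiv> \<lambda>n. \<Sum>k\<le>n. airy_sq_coeff k * z ^ k"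
  shows "\<exists>V S. (\<forall>t. (S has_real_derivative V t) (at t)) \<and> (\<forall>t. (t - z) * V t = (airyA t)\<^sup>2) \<and>
     S 0 - S z = (\<Sum>n. s n / real (Suc n)) \<and> summable (\<lambda>n. s n / real (Suc n))"
proof -
  define v where "v n = - s n / z ^ Suc n" for n
  have total: "(\<lambda>n. airy_sq_coeff n * z ^ n) sums 0" using airy_sq_sums[of z] z by simp
  \<comment> \<open>As the full series is 0, s n is minus its remainder and decays faster than any
    geometric sequence. This is where A(z) = 0 removes the pole of the quotient and makes it
    entire.\<close>
  have bound: "\<bar>s n\<bar> * \<rho> ^ n \<le> (\<Sum>k. \<bar>airy_sq_coeff k * (z * \<rho>) ^ k\<bar>)" if \<rho>: "\<rho> \<ge> 1" for \<rho> n
  proof -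
    let ?B = "\<lambda>k. airy_sq_coeff k * z ^ k"
    have sm: "summable ?B" by (rule summable_airy_sq)
    have sma: "summable (\<lambda>k. \<bar>airy_sq_coeff (k + Suc n) * (z * \<rho>) ^ (k + Suc n)\<bar>)"
      using abs_summable_airy_sq[of "z * \<rho>"] by (rule summable_ignore_initial_segment)
    have smB: "summable (\<lambda>k. \<bar>?B (k + Suc n)\<bar>)"
      using abs_summable_airy_sq[of z] by (rule summable_ignore_initial_segment)
    have scaled: "\<bar>airy_sq_coeff j * (z * \<rho>) ^ j\<bar> = \<bar>?B j\<bar> * \<rho> ^ j" for j
      using \<rho> by (simp add: power_mult_distrib abs_mult)
    have "s n = - (\<Sum>k. ?B (k + Suc n))"
      using suminf_split_initial_segment[OF sm, of "Suc n"] total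
      by (simp add: s_def sums_iff lessThan_Suc_atMost)
    then have "\<bar>s n\<bar> \<le> (\<Sum>k. \<bar>?B (k + Suc n)\<bar>)" using summable_rabs[OF smB] by simp
    then have "\<bar>s n\<bar> * \<rho> ^ n \<le> (\<Sum>k. \<bar>?B (k + Suc n)\<bar>) * \<rho> ^ n" using \<rho> by (intro mult_right_mono) auto
    also have "\<dots> = (\<Sum>k. \<bar>?B (k + Suc n)\<bar> * \<rho> ^ n)" by (rule suminf_mult2[OF smB])
    also have "\<dots> \<le> (\<Sum>k. \<bar>airy_sq_coeff (k + Suc n) * (z * \<rho>) ^ (k + Suc n)\<bar>)"
    proof (rule suminf_le[OF _ summable_mult2[OF smB] sma])
      fix k
      have "\<rho> ^ n \<le> \<rho> ^ (k + Suc n)" using \<rho> by (intro power_increasing) auto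
      then have "\<bar>?B (k + Suc n)\<bar> * \<rho> ^ n \<le> \<bar>?B (k + Suc n)\<bar> * \<rho> ^ (k + Suc n)" by (intro mult_left_mono) auto
      then show "\<bar>?B (k + Suc n)\<bar> * \<rho> ^ n \<le> \<bar>airy_sq_coeff (k + Suc n) * (z * \<rho>) ^ (k + Suc n)\<bar>"
        unfolding scaled .
    qed
    also have "\<dots> \<le> (\<Sum>k. \<bar>airy_sq_coeff k * (z * \<rho>) ^ k\<bar>)"
      using suminf_split_initial_segment[OF abs_summable_airy_sq[of "z * \<rho>"], of "Suc n"]
        sum_nonneg[of "{..<Suc n}" "\<lambda>k. \<bar>airy_sq_coeff k * (z * \<rho>) ^ k\<bar>"] by simp
    finally show ?thesis .
  qed
  have smv: "summable (\<lambda>n. v n * x ^ n)" for x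
  proof -
    \<comment> \<open>Large enough for the comparison with a geometric series of ratio 1/2 at the
      given x.\<close>
    define \<rho> where "\<rho> = max 1 (2 * \<bar>x\<bar> / \<bar>z\<bar>)"
    have \<rho>: "\<rho> \<ge> 1" "\<bar>x\<bar> / (\<bar>z\<bar> * \<rho>) \<le> 1 / 2"
    proof -
      show "\<rho> \<ge> 1" by (simp add: \<rho>_def)
      have "2 * \<bar>x\<bar> / \<bar>z\<bar> \<le> \<rho>" by (simp add: \<rho>_def)
      then show "\<bar>x\<bar> / (\<bar>z\<bar> * \<rho>) \<le> 1 / 2" using z \<open>\<rho> \<ge> 1\<close> by (simp add: field_simps)
    qed
    define T where "T = (\<Sum>k. \<bar>airy_sq_coeff k * (z * \<rho>) ^ k\<bar>)"
    show ?thesis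
    proof (rule summable_comparison_test')
      show "summable (\<lambda>n. T / \<bar>z\<bar> * (1 / 2) ^ n)" by (intro summable_mult summable_geometric) simp
      fix n
      have T: "T \<ge> 0" unfolding T_def by (intro suminf_nonneg abs_summable_airy_sq) auto
      have \<rho>n: "\<rho> > 0" using \<rho> by simp
      have "norm (v n * x ^ n) = (\<bar>s n\<bar> * \<rho> ^ n) / \<bar>z\<bar> * (\<bar>x\<bar> / (\<bar>z\<bar> * \<rho>)) ^ n"
        using \<rho>n z by (simp add: v_def abs_mult power_abs power_divide power_mult_distrib)
      also have "\<dots> \<le> T / \<bar>z\<bar> * (1 / 2) ^ n"
        using bound[OF \<rho>(1), of n] \<rho> T unfolding T_def by (intro mult_mono divide_right_mono power_mono) auto
      finally show "norm (v n * x ^ n) \<le> T / \<bar>z\<bar> * (1 / 2) ^ n" .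
    qed
  qed
  define V where "V t = (\<Sum>n. v n * t ^ n)" for t
  define S where "S t = (\<Sum>n. v n / real (Suc n) * t ^ Suc n)" for t
  have dS: "(S has_real_derivative V t) (at t)" for t
    unfolding S_def[abs_def] V_def by (rule DERIV_power_series_antideriv(1)[OF smv])
  have quot: "(t - z) * V t = (airyA t)\<^sup>2" for t
  proof -
    have V: "(\<lambda>n. v n * t ^ n) sums V t" unfolding V_def by (rule summable_sums[OF smv])
    have "(\<lambda>n. v n * t ^ n * t - z * (v (Suc n) * t ^ Suc n)) sums (V t * t - z * (V t - v 0 * t ^ 0))"
      by (intro sums_diff sums_mult2 sums_mult V) (use sums_Suc_iff[of "\<lambda>n. v n * t ^ n" "V t - v 0"] V in simp)
    moreover have "v n * t ^ n * t - z * (v (Suc n) * t ^ Suc n) = airy_sq_coeff (Suc n) * t ^ Suc n" for n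
    proof -
      have "v n - z * v (Suc n) = airy_sq_coeff (Suc n)"
        using z by (simp add: v_def s_def field_simps)
      then have "(v n - z * v (Suc n)) * t ^ Suc n = airy_sq_coeff (Suc n) * t ^ Suc n" by simp
      then show ?thesis by (simp add: algebra_simps)
    qed
    ultimately have "(\<lambda>n. airy_sq_coeff (Suc n) * t ^ Suc n) sums (V t * t - z * (V t - v 0))" by simp
    moreover have "(\<lambda>n. airy_sq_coeff (Suc n) * t ^ Suc n) sums ((airyA t)\<^sup>2 - airy_sq_coeff 0 * t ^ 0)"
      using sums_split_initial_segment[OF airy_sq_sums[of t], of 1] by simp
    ultimately have "V t * t - z * (V t - v 0) = (airyA t)\<^sup>2 - airy_sq_coeff 0"
      using sums_unique2 by fastforce
    moreover have "z * v 0 = - airy_sq_coeff 0" using z by (simp add: v_def s_def)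
    ultimately show ?thesis by (simp add: algebra_simps)
  qed
  have vterm: "v n / real (Suc n) * z ^ Suc n = - (s n / real (Suc n))" for n
    using z by (simp add: v_def)
  have "summable (\<lambda>n. - (s n / real (Suc n)))"
    using DERIV_power_series_antideriv(2)[OF smv, of z] unfolding vterm .
  then have sms: "summable (\<lambda>n. s n / real (Suc n))" by (simp only: summable_minus_iff)
  have "S 0 = 0" by (simp add: S_def)
  moreover have "S z = - (\<Sum>n. s n / real (Suc n))"
    unfolding S_def vterm by (rule suminf_minus[OF sms])
  ultimately show ?thesis using dS quot sms by (intro exI[of _ V] exI[of _ S]) simp
qed

section \<open>Moments of the squared Airy function\<close>

text \<open>The expression t^(j+1) A^2 - t^j A'^2 + j t^(j-1) A A' has derivative (2 j + 1) t^j A^2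
  + j (j - 1) t^(j-2) A A'. For j = 2 and j = 3 the last term is removed by subtracting A^2 and 3
  A'^2; the divisors 1, 3, 5, 7 are 2 j + 1.\<close>

definition airy_moment_antideriv :: "real \<Rightarrow> real \<Rightarrow> real \<Rightarrow> real \<Rightarrow> real \<Rightarrow> real" where
  "airy_moment_antideriv p0 p1 p2 p3 t = (let A = airyA t; A' = airyA' t in
     p0 * (t * A\<^sup>2 - A'\<^sup>2)
   + p1 / 3 * (t\<^sup>2 * A\<^sup>2 - t * A'\<^sup>2 + A * A')
   + p2 / 5 * (t ^ 3 * A\<^sup>2 - t\<^sup>2 * A'\<^sup>2 + 2 * t * (A * A') - A\<^sup>2)
   + p3 / 7 * (t ^ 4 * A\<^sup>2 - t ^ 3 * A'\<^sup>2 + 3 * t\<^sup>2 * (A * A') - 3 * A'\<^sup>2))"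

lemma DERIV_airy_moment_antideriv:
  "(airy_moment_antideriv p0 p1 p2 p3 has_real_derivative (p0 + p1 * t + p2 * t\<^sup>2 + p3 * t ^ 3) * (airyA t)\<^sup>2) (at t)"
  unfolding airy_moment_antideriv_def[abs_def] Let_def
  by (rule DERIV_airy_sol DERIV_airy_sol' derivative_eq_intros refl)+
     (simp add: algebra_simps power2_eq_square power3_eq_cube power4_eq_xxxx)

lemma airy_moment_antideriv_0:
  "airy_moment_antideriv p0 p1 p2 p3 0 = - (p0 * airy_m\<^sup>2 + p1 * airy_m / 3 + p2 / 5 + p3 * 3 * airy_m\<^sup>2 / 7)"
  by (simp add: airy_moment_antideriv_def)

lemma tendsto_airy_products:
  assumes "k \<le> 4"
  shows "((\<lambda>t. t ^ k * (airyA t)\<^sup>2) \<longlongrightarrow> 0) at_top" "((\<lambda>t. t ^ k * (airyA' t)\<^sup>2) \<longlongrightarrow> 0) at_top"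
    "((\<lambda>t. t ^ k * (airyA t * airyA' t)) \<longlongrightarrow> 0) at_top"
proof -
  have pw: "t ^ k \<le> t ^ 4" if "t \<ge> 1" for t :: real using that assms by (intro power_increasing)
  have bounds: "t ^ k * (\<bar>x\<bar> * \<bar>y\<bar>) \<le> t ^ 4 * (48 / t ^ 3 * (48 / t ^ 3))"
    if "t \<ge> 1" "\<bar>x\<bar> \<le> 48 / t ^ 3" "\<bar>y\<bar> \<le> 48 / t ^ 3" for t x y :: real
    using that pw[of t] by (intro mult_mono) auto
  have A: "\<bar>airyA t\<bar> \<le> 48 / t ^ 3" "\<bar>airyA' t\<bar> \<le> 48 / t ^ 3" if "t \<ge> 1" for t
  proof -
    have "airyA t \<le> 3 / t ^ 3" "airyA t > 0" using airyA_le(2)[of t] airyA_pos[of t] that by auto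
    moreover have "3 / t ^ 3 \<le> 48 / t ^ 3" using that by (intro divide_right_mono) auto
    ultimately show "\<bar>airyA t\<bar> \<le> 48 / t ^ 3" by linarith
    have "48 / t ^ 4 \<le> 48 / t ^ 3" using that by (intro divide_left_mono power_increasing) auto
    then show "\<bar>airyA' t\<bar> \<le> 48 / t ^ 3" using airyA'_abs_le[of t] that by linarith
  qed
  have lim: "((\<lambda>t :: real. t ^ 4 * (48 / t ^ 3 * (48 / t ^ 3))) \<longlongrightarrow> 0) at_top" by real_asymp
  have main: "((\<lambda>t. t ^ k * (f t * g t)) \<longlongrightarrow> 0) at_top"
    if fg: "\<And>t. t \<ge> 1 \<Longrightarrow> \<bar>f t\<bar> \<le> 48 / t ^ 3" "\<And>t. t \<ge> 1 \<Longrightarrow> \<bar>g t\<bar> \<le> 48 / t ^ 3" for f g :: "real \<Rightarrow> real"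
  proof (rule Lim_null_comparison[OF _ lim])
    show "\<forall>\<^sub>F t in at_top. norm (t ^ k * (f t * g t)) \<le> t ^ 4 * (48 / t ^ 3 * (48 / t ^ 3))"
      using eventually_ge_at_top[of 1]
    proof eventually_elim
      case (elim t)
      then have "norm (t ^ k * (f t * g t)) = t ^ k * (\<bar>f t\<bar> * \<bar>g t\<bar>)" by (simp add: abs_mult)
      then show ?case using bounds[OF elim fg[OF elim]] by simp
    qed
  qed
  show "((\<lambda>t. t ^ k * (airyA t)\<^sup>2) \<longlongrightarrow> 0) at_top" "((\<lambda>t. t ^ k * (airyA' t)\<^sup>2) \<longlongrightarrow> 0) at_top"
    "((\<lambda>t. t ^ k * (airyA t * airyA' t)) \<longlongrightarrow> 0) at_top"
    unfolding power2_eq_square using A by (intro main; simp)+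
qed

lemma tendsto_airy_moment_antideriv: "(airy_moment_antideriv p0 p1 p2 p3 \<longlongrightarrow> 0) at_top"
proof -
  note t = tendsto_airy_products
  have "((\<lambda>t. p0 * (t ^ 1 * (airyA t)\<^sup>2 - t ^ 0 * (airyA' t)\<^sup>2)
   + p1 / 3 * (t ^ 2 * (airyA t)\<^sup>2 - t ^ 1 * (airyA' t)\<^sup>2 + t ^ 0 * (airyA t * airyA' t))
   + p2 / 5 * (t ^ 3 * (airyA t)\<^sup>2 - t ^ 2 * (airyA' t)\<^sup>2 + 2 * (t ^ 1 * (airyA t * airyA' t)) - t ^ 0 * (airyA t)\<^sup>2)
   + p3 / 7 * (t ^ 4 * (airyA t)\<^sup>2 - t ^ 3 * (airyA' t)\<^sup>2 + 3 * (t ^ 2 * (airyA t * airyA' t)) - 3 * (t ^ 0 * (airyA' t)\<^sup>2)))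
   \<longlongrightarrow> p0 * (0 - 0) + p1 / 3 * (0 - 0 + 0) + p2 / 5 * (0 - 0 + 2 * 0 - 0) + p3 / 7 * (0 - 0 + 3 * 0 - 3 * 0)) at_top"
    by (intro tendsto_intros t) simp_all
  then show ?thesis by (simp add: airy_moment_antideriv_def[abs_def] Let_def mult.assoc)
qed

text \<open>At a zero z < 0 of A this equals the integral of A(t)^2 / (t - z) over [z, 0], hence
  A'(z)^2 times the part of the variance below x = - z.\<close>

definition airy_head_integral :: "real \<Rightarrow> real" where
  "airy_head_integral z = (\<Sum>n. (\<Sum>k\<le>n. airy_sq_coeff k * z ^ k) / real (Suc n))"

context
  fixes r :: nat and \<alpha> D :: real
  assumes r: "r \<ge> 1" and \<alpha>: "airy_zero r = - \<alpha>" and D: "D = (airyA' (- \<alpha>))\<^sup>2"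
begin

lemma \<alpha>_props: "\<alpha> > 0" "airyA (- \<alpha>) = 0" "D > 0"
  using airy_zero_props(1)[OF r] airyZ_neg[of "- \<alpha>"] airyA_simple_zero[of "- \<alpha>"] by (auto simp: \<alpha> airyZ_def D)

lemma edge_density_airyA: "edge_density r x = (airyA (x - \<alpha>))\<^sup>2 / (D * x)"
  using edge_density_def[OF r, of x] by (simp add: edge_u_def \<alpha> D power_divide)

lemma edge_density_head: "integral {0..\<alpha>} (edge_density r) = airy_head_integral (- \<alpha>) / D"
proof -
  obtain V S where VS: "\<And>t. (S has_real_derivative V t) (at t)" "\<And>t. (t - (- \<alpha>)) * V t = (airyA t)\<^sup>2"
     "S 0 - S (- \<alpha>) = airy_head_integral (- \<alpha>)"
    using airy_sq_quotient[OF \<alpha>_props(2)] \<alpha>_props(1) unfolding airy_head_integral_def by auto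
  have dS: "((\<lambda>x. S (x - \<alpha>) / D) has_real_derivative V (x - \<alpha>) / D) (at x)" for x
    using DERIV_cdivide[OF DERIV_shift[THEN iffD1, of S "V (x - \<alpha>)" x "- \<alpha>"]] VS(1)[of "x - \<alpha>"] by simp
  have "(edge_density r has_integral (S (\<alpha> - \<alpha>) / D - S (0 - \<alpha>) / D)) {0..\<alpha>}"
  proof (rule fundamental_theorem_of_calculus_interior)
    show "0 \<le> \<alpha>" using \<alpha>_props by simp
    show "continuous_on {0..\<alpha>} (\<lambda>x. S (x - \<alpha>) / D)"
      using dS by (meson DERIV_isCont continuous_at_imp_continuous_on)
    fix x assume "x \<in> {0<..<\<alpha>}"
    then have x: "x > 0" by simp
    have "x * V (x - \<alpha>) = (airyA (x - \<alpha>))\<^sup>2" using VS(2)[of "x - \<alpha>"] by simp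
    then have "edge_density r x = x * V (x - \<alpha>) / (D * x)" by (simp only: edge_density_airyA)
    also have "\<dots> = V (x - \<alpha>) / D" using x by simp
    finally show "((\<lambda>x. S (x - \<alpha>) / D) has_vector_derivative edge_density r x) (at x)"
      using dS[of x] by (simp add: has_real_derivative_iff_has_vector_derivative)
  qed
  then have "integral {0..\<alpha>} (edge_density r) = S (\<alpha> - \<alpha>) / D - S (0 - \<alpha>) / D" by (rule integral_unique)
  then show ?thesis using VS(3) by (simp add: diff_divide_distrib[symmetric])
qed

lemma edge_density_combine:
  assumes "X > \<alpha>"
  shows "integral {0..X} (edge_density r) = airy_head_integral (- \<alpha>) / D + integral {\<alpha>..X} (edge_density r)"
    "edge_density r integrable_on {\<alpha>..X}"
proof -
  have int: "edge_density r integrable_on {0..X}"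
    by (rule integrable_continuous_interval[OF continuous_on_edge_density[OF r]])
  show "integral {0..X} (edge_density r) = airy_head_integral (- \<alpha>) / D + integral {\<alpha>..X} (edge_density r)"
    using Henstock_Kurzweil_Integration.integral_combine[OF _ _ int, of \<alpha>] assms \<alpha>_props(1) edge_density_head by simp
  show "edge_density r integrable_on {\<alpha>..X}"
    by (rule integrable_subinterval_real[OF int]) (use assms \<alpha>_props in auto)
qed

lemma has_integral_poly_airy_sq:
  fixes p0 p1 p2 p3 :: real
  assumes "X > \<alpha>"
  defines "P \<equiv> airy_moment_antideriv p0 p1 p2 p3"
  shows "((\<lambda>x. (p0 + p1 * (x - \<alpha>) + p2 * (x - \<alpha>)\<^sup>2 + p3 * (x - \<alpha>) ^ 3) * (airyA (x - \<alpha>))\<^sup>2 / D)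
      has_integral ((P (X - \<alpha>) - P 0) / D)) {\<alpha>..X}"
proof -
  have d: "((\<lambda>x. P (x - \<alpha>) / D) has_real_derivative
     (p0 + p1 * (x - \<alpha>) + p2 * (x - \<alpha>)\<^sup>2 + p3 * (x - \<alpha>) ^ 3) * (airyA (x - \<alpha>))\<^sup>2 / D) (at x)" for x
    unfolding P_def
    using DERIV_cdivide[OF DERIV_shift[THEN iffD1, of "airy_moment_antideriv p0 p1 p2 p3" _ x "- \<alpha>"]]
      DERIV_airy_moment_antideriv[of p0 p1 p2 p3 "x - \<alpha>"] by simp
  have "((\<lambda>x. (p0 + p1 * (x - \<alpha>) + p2 * (x - \<alpha>)\<^sup>2 + p3 * (x - \<alpha>) ^ 3) * (airyA (x - \<alpha>))\<^sup>2 / D)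
      has_integral (P (X - \<alpha>) / D - P (\<alpha> - \<alpha>) / D)) {\<alpha>..X}"
    using assms d by (intro fundamental_theorem_of_calculus)
      (auto simp: has_real_derivative_iff_has_vector_derivative[symmetric] intro: has_field_derivative_at_within)
  then show ?thesis by (simp add: diff_divide_distrib)
qed

lemma tendsto_airy_moment_antideriv_shifted:
  "((\<lambda>X. airy_moment_antideriv p0 p1 p2 p3 (X - \<alpha>)) \<longlongrightarrow> 0) at_top"
  by (rule filterlim_compose[OF tendsto_airy_moment_antideriv]) real_asymp

text \<open>The antiderivative of the minorant times A^2 vanishes at infinity, so beyond \<alpha>
  only minus its value at 0 remains; the mass of the density beyond X is dropped before X tends to
  infinity.\<close>

lemma edge_variance_lower:
  assumes P: "\<And>x. x \<ge> \<alpha> \<Longrightarrow> p0 + p1 * (x - \<alpha>) + p2 * (x - \<alpha>)\<^sup>2 + p3 * (x - \<alpha>) ^ 3 \<le> 1 / x"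
  shows "(airy_head_integral (- \<alpha>) + (p0 * airy_m\<^sup>2 + p1 * airy_m / 3 + p2 / 5 + p3 * 3 * airy_m\<^sup>2 / 7)) / D \<le> edge_variance r"
proof -
  let ?P = "airy_moment_antideriv p0 p1 p2 p3"
  let ?J = "airy_head_integral (- \<alpha>)"
  have "\<forall>\<^sub>F X in at_top. ?J / D + (?P (X - \<alpha>) - ?P 0) / D \<le> edge_variance r"
    using eventually_gt_at_top[of \<alpha>]
  proof eventually_elim
    case (elim X)
    have "(?P (X - \<alpha>) - ?P 0) / D \<le> integral {\<alpha>..X} (edge_density r)"
    proof (rule has_integral_le[OF has_integral_poly_airy_sq[OF elim] integrable_integral[OF edge_density_combine(2)[OF elim]]])
      fix x assume "x \<in> {\<alpha>..X}"
      then have "(p0 + p1 * (x - \<alpha>) + p2 * (x - \<alpha>)\<^sup>2 + p3 * (x - \<alpha>) ^ 3) * ((airyA (x - \<alpha>))\<^sup>2 / D) \<le> 1 / x * ((airyA (x - \<alpha>))\<^sup>2 / D)"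
        using \<alpha>_props by (intro mult_right_mono P) auto
      then show "(p0 + p1 * (x - \<alpha>) + p2 * (x - \<alpha>)\<^sup>2 + p3 * (x - \<alpha>) ^ 3) * (airyA (x - \<alpha>))\<^sup>2 / D \<le> edge_density r x"
        by (simp add: edge_density_airyA mult.commute)
    qed
    then show ?case
      using edge_density_combine(1)[OF elim] edge_variance_tail(1)[OF r, of X] elim \<alpha>_props by simp
  qed
  moreover have "((\<lambda>X. ?J / D + (?P (X - \<alpha>) - ?P 0) / D) \<longlongrightarrow> ?J / D + (0 - ?P 0) / D) at_top"
    using \<alpha>_props by (intro tendsto_intros tendsto_airy_moment_antideriv_shifted) auto
  ultimately have "?J / D + (0 - ?P 0) / D \<le> edge_variance r"
    using tendsto_upperbound trivial_limit_at_top_linorder by blast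
  then show ?thesis
    by (simp only: airy_moment_antideriv_0 diff_minus_eq_add add_0_left add_0_right add_divide_distrib[symmetric])
qed

text \<open>As for the lower bound, except that the mass beyond X must be kept; it is at most 1 / X
  and disappears in the limit.\<close>

lemma edge_variance_upper:
  assumes P: "\<And>x. x \<ge> \<alpha> \<Longrightarrow> 1 / x \<le> p0 + p1 * (x - \<alpha>) + p2 * (x - \<alpha>)\<^sup>2 + p3 * (x - \<alpha>) ^ 3"
  shows "edge_variance r \<le> (airy_head_integral (- \<alpha>) + (p0 * airy_m\<^sup>2 + p1 * airy_m / 3 + p2 / 5 + p3 * 3 * airy_m\<^sup>2 / 7)) / D"
proof -
  let ?P = "airy_moment_antideriv p0 p1 p2 p3"
  let ?J = "airy_head_integral (- \<alpha>)"
  have "\<forall>\<^sub>F X in at_top. edge_variance r \<le> ?J / D + (?P (X - \<alpha>) - ?P 0) / D + 1 / X"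
    using eventually_gt_at_top[of \<alpha>]
  proof eventually_elim
    case (elim X)
    have "integral {\<alpha>..X} (edge_density r) \<le> (?P (X - \<alpha>) - ?P 0) / D"
    proof (rule has_integral_le[OF integrable_integral[OF edge_density_combine(2)[OF elim]] has_integral_poly_airy_sq[OF elim]])
      fix x assume "x \<in> {\<alpha>..X}"
      then have "1 / x * ((airyA (x - \<alpha>))\<^sup>2 / D) \<le> (p0 + p1 * (x - \<alpha>) + p2 * (x - \<alpha>)\<^sup>2 + p3 * (x - \<alpha>) ^ 3) * ((airyA (x - \<alpha>))\<^sup>2 / D)"
        using \<alpha>_props by (intro mult_right_mono P) auto
      then show "edge_density r x \<le> (p0 + p1 * (x - \<alpha>) + p2 * (x - \<alpha>)\<^sup>2 + p3 * (x - \<alpha>) ^ 3) * (airyA (x - \<alpha>))\<^sup>2 / D"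
        by (simp add: edge_density_airyA mult.commute)
    qed
    then show ?case
      using edge_density_combine(1)[OF elim] edge_variance_tail(3)[OF r, of X] elim \<alpha>_props by simp
  qed
  moreover have "((\<lambda>X. ?J / D + (?P (X - \<alpha>) - ?P 0) / D + 1 / X) \<longlongrightarrow> ?J / D + (0 - ?P 0) / D + 0) at_top"
  proof -
    have "((\<lambda>X :: real. 1 / X) \<longlongrightarrow> 0) at_top" by real_asymp
    then show ?thesis using \<alpha>_props by (intro tendsto_intros tendsto_airy_moment_antideriv_shifted) auto
  qed
  ultimately have "edge_variance r \<le> ?J / D + (0 - ?P 0) / D + 0"
    using tendsto_lowerbound trivial_limit_at_top_linorder by blast
  then show ?thesis
    by (simp only: airy_moment_antideriv_0 diff_minus_eq_add add_0_left add_0_right add_divide_distrib[symmetric])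
qed

end

subsection \<open>Fixed-point summation of power series\<close>

definition fp_approx :: "int \<Rightarrow> real \<Rightarrow> int \<Rightarrow> int \<Rightarrow> bool" where
  "fp_approx S x v e \<longleftrightarrow> \<bar>of_int S * x - of_int v\<bar> \<le> of_int e"

definition fp_val :: "nat \<Rightarrow> int \<Rightarrow> int \<Rightarrow> int \<Rightarrow> int \<Rightarrow> int" where
  "fp_val K p g q v = drop_bit K (v * (p * g)) div q"

text \<open>The product error splits as (S c - v) X + v (X - p), where |X| <= |p| + d. The final 4
  pays for the two roundings in \<open>fp_val\<close> and for the two in this bound itself, each at
  most one unit.\<close>

definition fp_err :: "nat \<Rightarrow> int \<Rightarrow> int \<Rightarrow> int \<Rightarrow> int \<Rightarrow> int \<Rightarrow> int \<Rightarrow> int" where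
  "fp_err K p d g q v e = drop_bit K ((e * (\<bar>p\<bar> + d) + \<bar>v\<bar> * d) * g) div q + 4"

lemma floor_div_bounds:
  fixes x :: int
  assumes "q > 0"
  shows "real_of_int x / (2 ^ K * of_int q) - 2 \<le> of_int (drop_bit K x div q)"
    "of_int (drop_bit K x div q) \<le> real_of_int x / (2 ^ K * of_int q)"
proof -
  have q: "real_of_int q \<ge> 1" using assms by simp
  have 1: "real_of_int x / 2 ^ K - 1 \<le> of_int (drop_bit K x)" "of_int (drop_bit K x) \<le> real_of_int x / 2 ^ K"
    using floor_divide_of_int_eq[of x "2 ^ K", where 'a = real, symmetric]
    by (simp_all add: drop_bit_eq_div)
  have 2: "real_of_int y / of_int q - 1 \<le> of_int (y div q)" "of_int (y div q) \<le> real_of_int y / of_int q" for y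
    using floor_divide_of_int_eq[of y q, where 'a = real, symmetric] by simp_all
  have "of_int (drop_bit K x) / of_int q \<le> (real_of_int x / 2 ^ K) / of_int q"
    using 1 q by (intro divide_right_mono) auto
  then show "of_int (drop_bit K x div q) \<le> real_of_int x / (2 ^ K * of_int q)"
    using 2(2)[of "drop_bit K x"] by simp
  have "(real_of_int x / 2 ^ K - 1) / of_int q \<le> of_int (drop_bit K x) / of_int q"
    using 1 q by (intro divide_right_mono) auto
  moreover have "(real_of_int x / 2 ^ K - 1) / of_int q = real_of_int x / (2 ^ K * of_int q) - 1 / of_int q"
    by (simp add: diff_divide_distrib)
  moreover have "1 / real_of_int q \<le> 1" using q by simp
  ultimately show "real_of_int x / (2 ^ K * of_int q) - 2 \<le> of_int (drop_bit K x div q)"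
    using 2(1)[of "drop_bit K x"] by linarith
qed

lemma fp_approx_step:
  assumes ap: "fp_approx S c v e" and x: "\<bar>2 ^ K * x - of_int p\<bar> \<le> of_int d" and g: "g \<ge> 0" and q: "q > 0"
  shows "fp_approx S (c * x * of_int g / of_int q) (fp_val K p g q v) (fp_err K p d g q v e)"
proof -
  define Z where "Z = 2 ^ K * real_of_int q"
  have Z: "Z > 0" using q by (simp add: Z_def)
  have d0: "real_of_int d \<ge> 0" "real_of_int e \<ge> 0" using x ap unfolding fp_approx_def by linarith+
  define X where "X = 2 ^ K * x"
  have X: "\<bar>X - of_int p\<bar> \<le> of_int d" using x by (simp add: X_def)
  define E where "E = of_int e * (\<bar>of_int p\<bar> + of_int d) + \<bar>of_int v\<bar> * (of_int d :: real)"
  define G where "G = real_of_int g"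
  have G: "G \<ge> 0" using g by (simp add: G_def)
  have "of_int S * c * X - of_int v * of_int p
     = (of_int S * c - of_int v) * X + of_int v * (X - of_int p)" by (simp add: algebra_simps)
  also have "\<bar>\<dots>\<bar> \<le> E"
    unfolding E_def
  proof (rule order_trans[OF abs_triangle_ineq add_mono])
    show "\<bar>(of_int S * c - of_int v) * X\<bar> \<le> of_int e * (\<bar>of_int p\<bar> + of_int d)"
      unfolding abs_mult using ap X d0 unfolding fp_approx_def by (intro mult_mono) auto
    show "\<bar>of_int v * (X - of_int p)\<bar> \<le> \<bar>of_int v\<bar> * of_int d"
      unfolding abs_mult using X by (intro mult_left_mono) auto
  qed
  finally have "\<bar>of_int S * c * X - of_int v * of_int p\<bar> * (G / Z) \<le> E * (G / Z)"
    using G Z by (intro mult_right_mono) auto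
  moreover have "\<bar>of_int S * c * X - of_int v * of_int p\<bar> * (G / Z) = \<bar>(of_int S * c * X - of_int v * of_int p) * (G / Z)\<bar>"
    using G Z by (simp only: abs_mult abs_of_nonneg divide_nonneg_pos)
  ultimately have le: "\<bar>(of_int S * c * X - of_int v * of_int p) * (G / Z)\<bar> \<le> E * (G / Z)" by (simp only:)
  have "of_int S * c * X * (G / Z) = of_int S * (c * x * G / of_int q)" by (simp add: X_def Z_def)
  then have eq: "(of_int S * c * X - of_int v * of_int p) * (G / Z) = of_int S * (c * x * G / of_int q) - of_int v * (of_int p * G) / Z"
    by (simp only: left_diff_distrib) (simp add: mult.assoc)
  have main: "\<bar>of_int S * (c * x * G / of_int q) - of_int v * (of_int p * G) / Z\<bar> \<le> E * G / Z"
    using le unfolding eq by simp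
  have "\<bar>of_int (fp_val K p g q v) - of_int v * (of_int p * G) / Z\<bar> \<le> 2"
    using floor_div_bounds[OF q, where x = "v * (p * g)" and K = K] by (simp add: fp_val_def Z_def G_def abs_le_iff)
  moreover have "E * G / Z \<le> of_int (fp_err K p d g q v e) - 2"
    using floor_div_bounds(1)[OF q, where x = "(e * (\<bar>p\<bar> + d) + \<bar>v\<bar> * d) * g" and K = K]
    by (simp add: fp_err_def Z_def G_def E_def)
  moreover have "\<bar>a - b'\<bar> \<le> f" if "\<bar>a - b\<bar> \<le> e" "\<bar>b' - b\<bar> \<le> 2" "e \<le> f - 2" for a b b' e f :: real
    using that by linarith
  ultimately show ?thesis unfolding fp_approx_def G_def[symmetric] using main by blast
qed

lemma fp_approx_add: "fp_approx S x v e \<Longrightarrow> fp_approx S y w f \<Longrightarrow> fp_approx S (x + y) (v + w) (e + f)"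
  unfolding fp_approx_def by (simp add: algebra_simps)

text \<open>One unit covers the rounding of the value, a second one the rounding of the error
  bound.\<close>

lemma fp_approx_div:
  assumes "fp_approx S x v e" "k > 0"
  shows "fp_approx S (x / of_int k) (v div k) (e div k + 2)"
proof -
  have k: "real_of_int k > 0" using assms by simp
  have "\<bar>(of_int S * x - of_int v) / of_int k\<bar> \<le> of_int e / of_int k"
    using assms k unfolding fp_approx_def by (simp add: divide_right_mono)
  then have "\<bar>of_int S * (x / of_int k) - of_int v / of_int k\<bar> \<le> of_int e / of_int k"
    by (simp add: diff_divide_distrib)
  moreover have "real_of_int v / of_int k - 1 \<le> of_int (v div k)" "real_of_int e / of_int k - 1 \<le> of_int (e div k)"
    "of_int (v div k) \<le> real_of_int v / of_int k"
    using floor_divide_of_int_eq[of v k, where 'a = real, symmetric] floor_divide_of_int_eq[of e k, where 'a = real, symmetric]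
    by simp_all
  ultimately show ?thesis unfolding fp_approx_def by simp
qed

text \<open>Sequences whose terms satisfy a three-step recurrence; \<open>g\<^sub>1 = g\<^sub>0 = 1\<close> is the series of an Airy solution,
  \<open>g\<^sub>1 = 4\<close>, \<open>g\<^sub>0 = 2\<close> that of its square.\<close>
definition step3_series :: "(nat \<Rightarrow> real) \<Rightarrow> real \<Rightarrow> int \<Rightarrow> int \<Rightarrow> bool" where
  "step3_series c x g1 g0 \<longleftrightarrow> 0 \<le> g1 \<and> g1 \<le> 4 \<and> 0 \<le> g0 \<and> g0 \<le> 2 \<and>
     (\<forall>n. c (n + 3) = c n * x * of_int (g1 * int n + g0) / of_int ((int n + 1) * ((int n + 2) * (int n + 3))))"

lemma step3_series_fp_approx:
  assumes "step3_series c x g1 g0" "\<bar>2 ^ K * x - of_int p\<bar> \<le> of_int d" "fp_approx S (c n) v e"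
  shows "fp_approx S (c (n + 3)) (fp_val K p (g1 * int n + g0) ((int n + 1) * ((int n + 2) * (int n + 3))) v)
    (fp_err K p d (g1 * int n + g0) ((int n + 1) * ((int n + 2) * (int n + 3))) v e)"
  using fp_approx_step[OF assms(3,2), of "g1 * int n + g0" "(int n + 1) * ((int n + 2) * (int n + 3))"] assms(1)
  unfolding step3_series_def by auto

text \<open>Since the numerator is at most 4 (n + 1), one application of the recurrence multiplies
  by at most 4 |x| / N^2 <= 1/8 in absolute value, that is 1/2 per index. The factor 4 makes room
  for the three initial terms, the last of which is compared with (1/2)^2.\<close>

lemma step3_series_tail:
  assumes c: "step3_series c x g1 g0" and N: "32 * \<bar>x\<bar> \<le> real N ^ 2" "N > 0"
    and b: "\<bar>c N\<bar> \<le> b" "\<bar>c (N + 1)\<bar> \<le> b" "\<bar>c (N + 2)\<bar> \<le> b"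
  shows "\<bar>c (N + j)\<bar> \<le> 4 * b * (1 / 2) ^ j"
proof (induction j rule: less_induct)
  case (less j)
  have b0: "b \<ge> 0" using b by linarith
  show ?case
  proof (cases "j < 3")
    case True
    then have "j = 0 \<or> j = 1 \<or> j = 2" by auto
    then show ?thesis using b b0 by (auto simp: power2_eq_square)
  next
    case False
    then obtain i where i: "j = i + 3" using that[of "j - 3"] by simp
    define n where "n = N + i"
    have n: "c (n + 3) = c n * x * of_int (g1 * int n + g0) / of_int ((int n + 1) * ((int n + 2) * (int n + 3)))"
      and g: "0 \<le> g1" "g1 \<le> 4" "0 \<le> g0" "g0 \<le> 2"
      using c unfolding step3_series_def by auto
    have "g1 * int n \<le> 4 * int n" using g by (intro mult_right_mono) auto
    then have "g1 * int n + g0 \<le> 4 * int n + 2" using g by (intro add_mono)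
    then have "g1 * int n + g0 \<le> 4 * (int n + 1)" by simp
    then have "real_of_int (g1 * int n + g0) \<le> of_int (4 * (int n + 1))" by (simp only: of_int_le_iff)
    then have gn: "real_of_int (g1 * int n + g0) \<le> 4 * (real n + 1)" by simp
    have gn0: "0 \<le> real_of_int (g1 * int n + g0)" using g by simp
    have q: "real_of_int ((int n + 1) * ((int n + 2) * (int n + 3))) = (real n + 1) * ((real n + 2) * (real n + 3))" by simp
    have "\<bar>c (n + 3)\<bar> = \<bar>c n\<bar> * (\<bar>x\<bar> * real_of_int (g1 * int n + g0) / ((real n + 1) * ((real n + 2) * (real n + 3))))"
      unfolding n q using gn0 by (simp add: abs_mult)
    also have "\<dots> \<le> \<bar>c n\<bar> * (1 / 8)"
    proof (rule mult_left_mono)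
      have "\<bar>x\<bar> * real_of_int (g1 * int n + g0) \<le> (real N ^ 2 / 32) * (4 * (real n + 1))"
        using N gn gn0 by (intro mult_mono) auto
      also have "\<dots> = (real n + 1) * real N ^ 2 / 8" by (simp add: field_simps)
      also have "\<dots> \<le> (real n + 1) * ((real n + 2) * (real n + 3)) / 8"
      proof -
        have "real N ^ 2 \<le> (real n + 2) * (real n + 3)"
          unfolding power2_eq_square by (intro mult_mono) (auto simp: n_def)
        then show ?thesis by (intro divide_right_mono mult_left_mono) auto
      qed
      finally show "\<bar>x\<bar> * real_of_int (g1 * int n + g0) / ((real n + 1) * ((real n + 2) * (real n + 3))) \<le> 1 / 8"
        by (subst pos_divide_le_eq) (auto intro!: mult_pos_pos add_nonneg_pos)
    qed auto
    also have "\<dots> \<le> (4 * b * (1 / 2) ^ i) * (1 / 8)"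
      using less[of i] i by (intro mult_right_mono) (auto simp: n_def)
    also have "\<dots> = 4 * b * (1 / 2) ^ j" by (simp add: i power_add power3_eq_cube)
    finally show ?thesis by (simp add: i n_def add.assoc)
  qed
qed

lemma suminf_split_bound:
  fixes f :: "nat \<Rightarrow> real"
  assumes sm: "summable f" and tail: "\<And>j. \<bar>f (N + j)\<bar> \<le> 4 * b * (1 / 2) ^ j"
  shows "\<bar>suminf f - sum f {..<N}\<bar> \<le> 8 * b"
proof -
  have geo: "summable (\<lambda>j. 4 * b * (1 / 2 :: real) ^ j)" by (intro summable_mult summable_geometric) simp
  have tail': "\<bar>f (j + N)\<bar> \<le> 4 * b * (1 / 2) ^ j" for j using tail[of j] by (simp add: add.commute)
  have sma: "summable (\<lambda>j. \<bar>f (j + N)\<bar>)"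
    by (rule summable_comparison_test'[OF geo]) (use tail' in simp)
  have "suminf f - sum f {..<N} = (\<Sum>j. f (j + N))"
    using suminf_split_initial_segment[OF sm, of N] by simp
  also have "\<bar>\<dots>\<bar> \<le> (\<Sum>j. \<bar>f (j + N)\<bar>)" by (rule summable_rabs[OF sma])
  also have "\<dots> \<le> (\<Sum>j. 4 * b * (1 / 2) ^ j)" by (rule suminf_le[OF tail' sma geo])
  also have "\<dots> = 8 * b" using suminf_mult[OF summable_geometric, of "1/2 :: real" "4 * b"] suminf_geometric[of "1 / 2 :: real"] by simp
  finally show ?thesis .
qed

text \<open>In units of \<open>1 / S\<close>, three consecutive terms \<open>x\<close>, \<open>y\<close>, \<open>z\<close> and the partial sums, each an integer followed by its error
  bound; \<open>p\<close> approximates \<open>2\<^sup>K\<close> times the argument of the recurrence up to \<open>d\<close>. The last step bounds the tail.\<close>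
primrec fp_sum :: "nat \<Rightarrow> nat \<Rightarrow> int \<Rightarrow> int \<Rightarrow> int \<Rightarrow> int \<Rightarrow> int \<Rightarrow>
    int \<Rightarrow> int \<Rightarrow> int \<Rightarrow> int \<Rightarrow> int \<Rightarrow> int \<Rightarrow> int \<Rightarrow> int \<Rightarrow> int \<times> int" where
  "fp_sum 0 K p d g1 g0 n xv xe yv ye zv ze sv se =
     (sv, se + 8 * (\<bar>xv\<bar> + xe + (\<bar>yv\<bar> + ye) + (\<bar>zv\<bar> + ze)))"
| "fp_sum (Suc f) K p d g1 g0 n xv xe yv ye zv ze sv se =
     fp_sum f K p d g1 g0 (n + 1) yv ye zv ze
       (fp_val K p (g1 * n + g0) ((n + 1) * ((n + 2) * (n + 3))) xv)
       (fp_err K p d (g1 * n + g0) ((n + 1) * ((n + 2) * (n + 3))) xv xe)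
       (sv + xv) (se + xe)"

text \<open>One pass accumulates two series: \<open>jv\<close> adds the running partial sums divided
  by n + 1, which gives \<open>airy_head_integral\<close>, and \<open>qv\<close> adds the terms
  divided by n + 1, which gives the series for A'(z)^2.\<close>

primrec fp_sums :: "nat \<Rightarrow> nat \<Rightarrow> int \<Rightarrow> int \<Rightarrow> int \<Rightarrow> int \<Rightarrow> int \<Rightarrow>
    int \<Rightarrow> int \<Rightarrow> int \<Rightarrow> int \<Rightarrow> int \<Rightarrow> int \<Rightarrow> int \<Rightarrow> int \<Rightarrow> int \<Rightarrow> int \<Rightarrow> int \<Rightarrow> int \<Rightarrow> (int \<times> int) \<times> (int \<times> int)" where
  "fp_sums 0 K p d g1 g0 n xv xe yv ye zv ze sv se jv je qv qe =
     ((jv, je + 8 * (\<bar>xv\<bar> + xe + (\<bar>yv\<bar> + ye) + (\<bar>zv\<bar> + ze))),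
      (qv, qe + 8 * (\<bar>xv\<bar> + xe + (\<bar>yv\<bar> + ye) + (\<bar>zv\<bar> + ze))))"
| "fp_sums (Suc f) K p d g1 g0 n xv xe yv ye zv ze sv se jv je qv qe =
     fp_sums f K p d g1 g0 (n + 1) yv ye zv ze
       (fp_val K p (g1 * n + g0) ((n + 1) * ((n + 2) * (n + 3))) xv)
       (fp_err K p d (g1 * n + g0) ((n + 1) * ((n + 2) * (n + 3))) xv xe)
       (sv + xv) (se + xe)
       (jv + (sv + xv) div (n + 1)) (je + ((se + xe) div (n + 1) + 2))
       (qv + xv div (n + 1)) (qe + (xe div (n + 1) + 2))"

lemma fp_approx_abs:
  assumes "fp_approx S x v e" "S > 0" shows "\<bar>x\<bar> \<le> of_int (\<bar>v\<bar> + e) / of_int S"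
proof -
  have "of_int S * \<bar>x\<bar> = \<bar>of_int S * x\<bar>" using assms(2) by (simp add: abs_mult)
  also have "\<dots> \<le> of_int (\<bar>v\<bar> + e)" using assms(1) unfolding fp_approx_def by simp
  finally show ?thesis using assms(2) by (simp add: pos_le_divide_eq mult.commute)
qed

lemma fp_approx_shift:
  assumes "fp_approx S x v e" "S > 0" "\<bar>y - x\<bar> \<le> 8 * (of_int B / of_int S)"
  shows "fp_approx S y v (e + 8 * B)"
proof -
  have "\<bar>of_int S * y - of_int S * x\<bar> = of_int S * \<bar>y - x\<bar>"
    using assms(2) by (simp add: abs_mult flip: right_diff_distrib)
  also have "\<dots> \<le> of_int S * (8 * (of_int B / of_int S))" using assms(2,3) by (intro mult_left_mono) auto
  also have "\<dots> = 8 * of_int B" using assms(2) by simp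
  finally show ?thesis using assms(1) unfolding fp_approx_def by simp
qed

lemma step3_series_tail_fp:
  assumes c: "step3_series c x g1 g0" and S: "S > 0" and N: "32 * \<bar>x\<bar> \<le> real N ^ 2" "N > 0"
    and ap: "fp_approx S (c N) xv xe" "fp_approx S (c (N + 1)) yv ye" "fp_approx S (c (N + 2)) zv ze"
  shows "\<bar>c (N + j)\<bar> \<le> 4 * (of_int (\<bar>xv\<bar> + xe + (\<bar>yv\<bar> + ye) + (\<bar>zv\<bar> + ze)) / of_int S) * (1 / 2) ^ j"
proof (rule step3_series_tail[OF c N])
  have pos: "of_int (\<bar>v\<bar> + e) / of_int S \<ge> (0 :: real)" if "fp_approx S y v e" for y v e
    using fp_approx_abs[OF that S] by linarith
  have split: "of_int (\<bar>xv\<bar> + xe + (\<bar>yv\<bar> + ye) + (\<bar>zv\<bar> + ze)) / of_int S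
     = (of_int (\<bar>xv\<bar> + xe) / of_int S + of_int (\<bar>yv\<bar> + ye) / of_int S + of_int (\<bar>zv\<bar> + ze) / of_int S :: real)"
    by (simp only: of_int_add add_divide_distrib)
  show "\<bar>c N\<bar> \<le> of_int (\<bar>xv\<bar> + xe + (\<bar>yv\<bar> + ye) + (\<bar>zv\<bar> + ze)) / of_int S"
    "\<bar>c (N + 1)\<bar> \<le> of_int (\<bar>xv\<bar> + xe + (\<bar>yv\<bar> + ye) + (\<bar>zv\<bar> + ze)) / of_int S"
    "\<bar>c (N + 2)\<bar> \<le> of_int (\<bar>xv\<bar> + xe + (\<bar>yv\<bar> + ye) + (\<bar>zv\<bar> + ze)) / of_int S"
    unfolding split
    using fp_approx_abs[OF ap(1) S] fp_approx_abs[OF ap(2) S] fp_approx_abs[OF ap(3) S] pos[OF ap(1)] pos[OF ap(2)] pos[OF ap(3)]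
    by linarith+
qed

lemma fp_sum_correct:
  assumes c: "step3_series c x g1 g0" and sm: "summable c" and S: "S > 0" and x: "\<bar>2 ^ K * x - of_int p\<bar> \<le> of_int d"
    and N: "32 * \<bar>x\<bar> \<le> real (n + f) ^ 2" "n + f > 0"
    and ap: "fp_approx S (c n) xv xe" "fp_approx S (c (n + 1)) yv ye" "fp_approx S (c (n + 2)) zv ze"
    and s: "fp_approx S (sum c {..<n}) sv se"
    and res: "fp_sum f K p d g1 g0 (int n) xv xe yv ye zv ze sv se = (v, e)"
  shows "fp_approx S (suminf c) v e"
  using N ap s res
proof (induction f arbitrary: n xv xe yv ye zv ze sv se)
  case 0
  define B where "B = \<bar>xv\<bar> + xe + (\<bar>yv\<bar> + ye) + (\<bar>zv\<bar> + ze)"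
  have "\<bar>suminf c - sum c {..<n}\<bar> \<le> 8 * (of_int B / of_int S)"
    unfolding B_def using 0 by (intro suminf_split_bound[OF sm] step3_series_tail_fp[OF c S]) auto
  from fp_approx_shift[OF 0(6) S this] show ?case using 0(7) by (simp add: B_def)
next
  case (Suc f)
  show ?case
  proof (rule Suc.IH[of "Suc n"])
    show "32 * \<bar>x\<bar> \<le> (real (Suc n + f))\<^sup>2" "0 < Suc n + f" using Suc.prems(1) by simp_all
    show "fp_approx S (c (Suc n)) yv ye" "fp_approx S (c (Suc n + 1)) zv ze" using Suc.prems(4,5) by simp_all
    show "fp_approx S (c (Suc n + 2)) (fp_val K p (g1 * int n + g0) ((int n + 1) * ((int n + 2) * (int n + 3))) xv)
       (fp_err K p d (g1 * int n + g0) ((int n + 1) * ((int n + 2) * (int n + 3))) xv xe)"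
      using step3_series_fp_approx[OF c x Suc.prems(3)] by (simp add: eval_nat_numeral)
    show "fp_approx S (sum c {..<Suc n}) (sv + xv) (se + xe)"
      using fp_approx_add[OF Suc.prems(6,3)] by simp
    show "fp_sum f K p d g1 g0 (int (Suc n)) yv ye zv ze
       (fp_val K p (g1 * int n + g0) ((int n + 1) * ((int n + 2) * (int n + 3))) xv)
       (fp_err K p d (g1 * int n + g0) ((int n + 1) * ((int n + 2) * (int n + 3))) xv xe)
       (sv + xv) (se + xe) = (v, e)"
      using Suc.prems(7) by (simp add: add.commute)
  qed
qed

text \<open>The series of partial sums can be truncated because the total is 0: each partial sum is
  minus a remainder and inherits the geometric decay of the terms, with the same final bound 8
  b.\<close>

lemma fp_sums_correct:
  fixes c :: "nat \<Rightarrow> real"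
  assumes c: "step3_series c x g1 g0" and sm: "summable (\<lambda>n. \<bar>c n\<bar>)" and zero: "suminf c = 0"
    and smj: "summable (\<lambda>k. (\<Sum>i\<le>k. c i) / real (Suc k))"
    and smq: "summable (\<lambda>k. c k / real (Suc k))" and S: "S > 0" and x: "\<bar>2 ^ K * x - of_int p\<bar> \<le> of_int d"
    and N: "32 * \<bar>x\<bar> \<le> real (n + f) ^ 2" "n + f > 0"
    and ap: "fp_approx S (c n) xv xe" "fp_approx S (c (n + 1)) yv ye" "fp_approx S (c (n + 2)) zv ze"
    and s: "fp_approx S (sum c {..<n}) sv se"
    and j: "fp_approx S (\<Sum>k<n. (\<Sum>i\<le>k. c i) / real (Suc k)) jv je"
    and q: "fp_approx S (\<Sum>k<n. c k / real (Suc k)) qv qe"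
    and res: "fp_sums f K p d g1 g0 (int n) xv xe yv ye zv ze sv se jv je qv qe = ((v, e), (w, h))"
  shows "fp_approx S (\<Sum>k. (\<Sum>i\<le>k. c i) / real (Suc k)) v e \<and> fp_approx S (\<Sum>k. c k / real (Suc k)) w h"
  using N ap s j q res
proof (induction f arbitrary: n xv xe yv ye zv ze sv se jv je qv qe)
  case 0
  define B where "B = \<bar>xv\<bar> + xe + (\<bar>yv\<bar> + ye) + (\<bar>zv\<bar> + ze)"
  define b where "b = real_of_int B / of_int S"
  have tail: "\<bar>c (n + j)\<bar> \<le> 4 * b * (1 / 2) ^ j" for j
    unfolding B_def b_def using 0 by (intro step3_series_tail_fp[OF c S]) auto
  have smc: "summable c" by (rule summable_rabs_cancel[OF sm])
  have "\<bar>(\<Sum>i\<le>n + j. c i) / real (Suc (n + j))\<bar> \<le> 4 * b * (1 / 2) ^ j" for j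
  proof -
    have "\<bar>suminf c - sum c {..<n + Suc j}\<bar> \<le> 8 * (b * (1 / 2) ^ Suc j)"
    proof (rule suminf_split_bound[OF smc])
      fix i show "\<bar>c (n + Suc j + i)\<bar> \<le> 4 * (b * (1 / 2) ^ Suc j) * (1 / 2) ^ i"
        using tail[of "Suc j + i"] by (simp add: power_add add.assoc mult_ac)
    qed
    then have "\<bar>\<Sum>i\<le>n + j. c i\<bar> \<le> 4 * b * (1 / 2) ^ j"
      using zero by (simp add: lessThan_Suc_atMost)
    moreover have "\<bar>(\<Sum>i\<le>n + j. c i) / real (Suc (n + j))\<bar> \<le> \<bar>\<Sum>i\<le>n + j. c i\<bar> / 1"
      unfolding abs_divide by (intro divide_left_mono) auto
    ultimately show ?thesis by simp
  qed
  from suminf_split_bound[OF smj this]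
  have J: "\<bar>(\<Sum>k. (\<Sum>i\<le>k. c i) / real (Suc k)) - (\<Sum>k<n. (\<Sum>i\<le>k. c i) / real (Suc k))\<bar> \<le> 8 * (of_int B / of_int S)"
    by (simp add: b_def)
  have "\<bar>c (n + j) / real (Suc (n + j))\<bar> \<le> 4 * b * (1 / 2) ^ j" for j
  proof -
    have "\<bar>c (n + j) / real (Suc (n + j))\<bar> \<le> \<bar>c (n + j)\<bar> / 1" unfolding abs_divide by (intro divide_left_mono) auto
    then show ?thesis using tail[of j] by simp
  qed
  from suminf_split_bound[OF smq this]
  have Q: "\<bar>(\<Sum>k. c k / real (Suc k)) - (\<Sum>k<n. c k / real (Suc k))\<bar> \<le> 8 * (of_int B / of_int S)"
    by (simp add: b_def)
  show ?case using fp_approx_shift[OF 0(7) S J] fp_approx_shift[OF 0(8) S Q] 0(9) by (auto simp: B_def)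
next
  case (Suc f)
  show ?case
  proof (rule Suc.IH[of "Suc n"])
    show "32 * \<bar>x\<bar> \<le> (real (Suc n + f))\<^sup>2" "0 < Suc n + f" using Suc.prems(1) by simp_all
    show "fp_approx S (c (Suc n)) yv ye" "fp_approx S (c (Suc n + 1)) zv ze" using Suc.prems(4,5) by simp_all
    show "fp_approx S (c (Suc n + 2)) (fp_val K p (g1 * int n + g0) ((int n + 1) * ((int n + 2) * (int n + 3))) xv)
       (fp_err K p d (g1 * int n + g0) ((int n + 1) * ((int n + 2) * (int n + 3))) xv xe)"
      using step3_series_fp_approx[OF c x Suc.prems(3)] by (simp add: eval_nat_numeral)
    have sn: "fp_approx S (\<Sum>i\<le>n. c i) (sv + xv) (se + xe)"
      using fp_approx_add[OF Suc.prems(6,3)] by (simp add: lessThan_Suc_atMost[symmetric])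
    then show "fp_approx S (sum c {..<Suc n}) (sv + xv) (se + xe)" by (simp add: lessThan_Suc_atMost)
    show "fp_approx S (\<Sum>k<Suc n. (\<Sum>i\<le>k. c i) / real (Suc k)) (jv + (sv + xv) div (int n + 1)) (je + ((se + xe) div (int n + 1) + 2))"
      using fp_approx_add[OF Suc.prems(7) fp_approx_div[OF sn, of "int n + 1"]] by (simp add: add.commute)
    show "fp_approx S (\<Sum>k<Suc n. c k / real (Suc k)) (qv + xv div (int n + 1)) (qe + (xe div (int n + 1) + 2))"
      using fp_approx_add[OF Suc.prems(8) fp_approx_div[OF Suc.prems(3), of "int n + 1"]] by (simp add: add.commute)
    show "fp_sums f K p d g1 g0 (int (Suc n)) yv ye zv ze
       (fp_val K p (g1 * int n + g0) ((int n + 1) * ((int n + 2) * (int n + 3))) xv)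
       (fp_err K p d (g1 * int n + g0) ((int n + 1) * ((int n + 2) * (int n + 3))) xv xe)
       (sv + xv) (se + xe) (jv + (sv + xv) div (int n + 1)) (je + ((se + xe) div (int n + 1) + 2))
       (qv + xv div (int n + 1)) (qe + (xe div (int n + 1) + 2)) = ((v, e), (w, h))"
      using Suc.prems(9) by (simp add: add.commute)
  qed
qed

lemma step3_series_airy:
  "step3_series (\<lambda>n. airy_coeff p q n * t ^ n) (t ^ 3) 1 1"
proof -
  have "airy_coeff p q (n + 3) * t ^ (n + 3)
     = airy_coeff p q n * t ^ n * t ^ 3 * (real n + 1) / ((real n + 1) * ((real n + 2) * (real n + 3)))" for n
  proof -
    have "x * y / (b * a) = x * y * c / (c * (a * b))" if "c \<noteq> 0" for x y a b c :: real using that by simp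
    then show ?thesis by (simp add: eval_nat_numeral power_add mult_ac add_ac)
  qed
  then show ?thesis unfolding step3_series_def by simp
qed

lemma step3_series_airy_sq:
  "step3_series (\<lambda>n. airy_sq_coeff n * t ^ n) (t ^ 3) 4 2"
  unfolding step3_series_def airy_sq_coeff_rec by (simp add: power_add mult_ac add_ac)

subsection \<open>Numerical values\<close>

text \<open>The derivative of t G' - G is t^2 G >= 0. This replaces the gap 1 / (G G') by t / G^2,
  so that only F and G have to be summed.\<close>

lemma airyG_le: assumes "t \<ge> 0" shows "airyG t \<le> t * airyG' t"
proof -
  have "0 * airyG' 0 - airyG 0 \<le> t * airyG' t - airyG t"
  proof (rule DERIV_nonneg_imp_nondecreasing[OF assms, of "\<lambda>t. t * airyG' t - airyG t"])
    fix x assume "0 \<le> x" "x \<le> t"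
    have "((\<lambda>t. t * airyG' t - airyG t) has_real_derivative x\<^sup>2 * airyG x) (at x)"
      by (rule DERIV_airy_sol DERIV_airy_sol' derivative_eq_intros refl)+ (simp add: power2_eq_square)
    moreover have "x\<^sup>2 * airyG x \<ge> 0" using airyG_ge[of x] \<open>0 \<le> x\<close> by simp
    ultimately show "\<exists>d. ((\<lambda>t. t * airyG' t - airyG t) has_real_derivative d) (at x) \<and> 0 \<le> d" by blast
  qed
  then show ?thesis by simp
qed

lemma airy_m_enclosure:
  assumes "t > 0" "F1 \<le> airyF t" "airyF t \<le> F2" "0 < G1" "G1 \<le> airyG t" "airyG t \<le> G2" "0 \<le> F1"
  shows "F1 / G2 - t / G1\<^sup>2 \<le> airy_m" "airy_m \<le> F2 / G1"
proof -
  have G: "airyG t > 0" "airyG' t > 0" using assms airyG'_ge(1)[of t] by linarith+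
  have "airyF t / airyG t \<le> F2 / G1" using assms by (intro frac_le) auto
  then show "airy_m \<le> F2 / G1" using airy_m_bounds(1)[OF assms(1)] by linarith
  have "F1 / G2 \<le> airyF t / airyG t" using assms G by (intro frac_le) auto
  moreover have "1 / (airyG t * airyG' t) \<le> t / G1\<^sup>2"
  proof -
    have "airyG t * airyG t \<le> airyG t * (t * airyG' t)" using airyG_le[of t] assms(1) G by (intro mult_left_mono) auto
    moreover have "G1\<^sup>2 \<le> airyG t * airyG t" unfolding power2_eq_square using assms by (intro mult_mono) auto
    ultimately have "G1\<^sup>2 \<le> t * (airyG t * airyG' t)" by (simp add: mult_ac)
    then show ?thesis using assms G by (simp add: field_simps)
  qed
  ultimately show "F1 / G2 - t / G1\<^sup>2 \<le> airy_m" using airy_m_bounds(2)[OF assms(1)] by linarith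
qed

lemma airy_sol_fp:
  assumes "fp_sum N K p d 1 1 0 S 0 v e 0 0 0 0 = (s, w)" "S > 0"
    and "\<bar>2 ^ K * t ^ 3 - of_int p\<bar> \<le> of_int d" "32 * \<bar>t ^ 3\<bar> \<le> real N ^ 2" "N > 0"
    and "fp_approx S (q * t) v e"
  shows "fp_approx S (airy_sol 1 q t) s w"
  unfolding airy_sol_def
  by (rule fp_sum_correct[OF step3_series_airy summable_airy_coeff assms(2,3), where n = 0 and f = N])
     (use assms in \<open>simp_all add: fp_approx_def eval_nat_numeral\<close>)

lemma airyG_fp:
  assumes "fp_sum N K p d 1 1 0 0 0 v e 0 0 0 0 = (s, w)" "S > 0"
    and "\<bar>2 ^ K * t ^ 3 - of_int p\<bar> \<le> of_int d" "32 * \<bar>t ^ 3\<bar> \<le> real N ^ 2" "N > 0"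
    and "fp_approx S t v e"
  shows "fp_approx S (airyG t) s w"
  unfolding airy_sol_def
  by (rule fp_sum_correct[OF step3_series_airy summable_airy_coeff assms(2,3), where n = 0 and f = N])
     (use assms in \<open>simp_all add: fp_approx_def eval_nat_numeral\<close>)

text \<open>At t = 12 the cube 1728 is an integer, so K = 0 and d = 0 and only the divisions round.
  236 is the least N with 32 * 1728 <= N^2. As G(12) is about 3.7 * 10^11, the gap 12 / G^2 is below
  10^(-22).\<close>

lemma airyF_12: "fp_sum 236 0 1728 0 1 1 0 1000000000000000000000000000 0 0 0 0 0 0 0
   = (268167949726681758034147578200566600385, 4884903649)"
  by code_simp

lemma airyG_12: "fp_sum 236 0 1728 0 1 1 0 0 0 12000000000000000000000000000 0 0 0 0 0
   = (367851652199794869402731481443898266105, 4884903649)"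
  by code_simp

lemma airy_m_bounds_num:
  "72901113294722698141854 / 10 ^ 23 \<le> airy_m" "airy_m \<le> 72901113294722698141864 / 10 ^ 23"
proof -
  have F: "fp_approx 1000000000000000000000000000 (airyF 12) 268167949726681758034147578200566600385 4884903649"
    by (rule airy_sol_fp[OF airyF_12]) (simp_all add: fp_approx_def)
  have G: "fp_approx 1000000000000000000000000000 (airyG 12) 367851652199794869402731481443898266105 4884903649"
    by (rule airyG_fp[OF airyG_12]) (simp_all add: fp_approx_def)
  have b: "268167949726681758034147578195681696736 / 10 ^ 27 \<le> airyF 12"
    "airyF 12 \<le> 268167949726681758034147578205451504034 / 10 ^ 27"
    "367851652199794869402731481439013362456 / 10 ^ 27 \<le> airyG 12"
    "airyG 12 \<le> 367851652199794869402731481448783169754 / 10 ^ 27"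
    using F G unfolding fp_approx_def abs_le_iff by simp_all
  note m = airy_m_enclosure[OF _ b(1,2) _ b(3,4)]
  have "72901113294722698141854 / 10 ^ 23
     \<le> (268167949726681758034147578195681696736 / 10 ^ 27) / (367851652199794869402731481448783169754 / 10 ^ 27)
       - 12 / (367851652199794869402731481439013362456 / 10 ^ 27 :: real)\<^sup>2"
    by (simp add: power_divide)
  also have "\<dots> \<le> airy_m" by (rule m) simp_all
  finally show "72901113294722698141854 / 10 ^ 23 \<le> airy_m" .
  have "airy_m \<le> (268167949726681758034147578205451504034 / 10 ^ 27) / (367851652199794869402731481439013362456 / 10 ^ 27)"
    by (rule m) simp_all
  also have "\<dots> \<le> 72901113294722698141864 / 10 ^ 23" by simp
  finally show "airy_m \<le> 72901113294722698141864 / 10 ^ 23" .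
qed

section \<open>Signs of the Airy function at rational points\<close>

lemma airyA_sign_fp:
  assumes "fp_sum N K p d 1 1 0 S 0 v e 0 0 0 0 = (s, w)" "S > 0"
    and "\<bar>2 ^ K * t ^ 3 - of_int p\<bar> \<le> of_int d" "32 * \<bar>t ^ 3\<bar> \<le> real N ^ 2" "N > 0"
    and "\<bar>of_int S * (- airy_m * t) - of_int v\<bar> \<le> of_int e"
  shows "w < s \<Longrightarrow> airyA t > 0" "w < - s \<Longrightarrow> airyA t < 0"
proof -
  have ap: "\<bar>of_int S * airyA t - of_int s\<bar> \<le> of_int w"
    using airy_sol_fp[OF assms(1-5), of "- airy_m"] assms(6) unfolding fp_approx_def by blast
  have S: "real_of_int S > 0" using assms(2) by simp
  show "airyA t > 0" if "w < s"
  proof -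
    have "real_of_int w < of_int s" using that by simp
    then have "of_int S * airyA t > 0" using ap by linarith
    then show ?thesis using S by (simp add: zero_less_mult_iff)
  qed
  show "airyA t < 0" if "w < - s"
  proof -
    have "real_of_int w < of_int (- s)" using that by (simp only: of_int_less_iff)
    then have "of_int S * airyA t < 0" using ap by simp
    then show ?thesis using S by (simp add: mult_less_0_iff)
  qed
qed

text \<open>The points -3/2, -3, -22/5 and -113/20 separate the first four zeros, which lie near
  -2.34, -4.09, -5.52 and -6.79.\<close>

lemma airyA_neg_3_2: "airyA (- (3 / 2)) > 0"
proof -
  have F: "fp_sum 14 40 (-3710851743744) 0 1 1 0 1000000000000 0 1093516699420 1 0 0 0 0 = (1307663154497, 12007077)"
    by code_simp
  show ?thesis
    by (rule airyA_sign_fp(1)[OF F]) (use airy_m_bounds_num in \<open>simp_all add: abs_le_iff power_divide\<close>)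
qed

lemma airyA_neg_3: "airyA (- 3) < 0"
proof -
  have F: "fp_sum 30 40 (-29686813949952) 0 1 1 0 1000000000000 0 2187033398841 1 0 0 0 0 = (-1066998214618, 137853)"
    by code_simp
  show ?thesis
    by (rule airyA_sign_fp(2)[OF F]) (use airy_m_bounds_num in \<open>simp_all add: abs_le_iff power_divide\<close>)
qed

lemma airyA_neg_22_5: "airyA (- (22 / 5)) > 0"
proof -
  have F: "fp_sum 53 40 (-93660798500471) 1 1 1 0 1000000000000 0 3207648984967 1 0 0 0 0 = (658267017236, 452)"
    by code_simp
  show ?thesis
    by (rule airyA_sign_fp(1)[OF F]) (use airy_m_bounds_num in \<open>simp_all add: abs_le_iff power_divide\<close>)
qed

lemma airyA_neg_113_20: "airyA (- (113 / 20)) < 0"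
proof -
  have F: "fp_sum 76 40 (-198310253647889) 1 1 1 0 1000000000000 0 4118912901151 1 0 0 0 0 = (-310549002034, 1684)"
    by code_simp
  show ?thesis
    by (rule airyA_sign_fp(2)[OF F]) (use airy_m_bounds_num in \<open>simp_all add: abs_le_iff power_divide\<close>)
qed

text \<open>The brackets are much narrower than three final digits suggest. The error bounds of the
  later summations grow with the absolute values of the terms, whereas the sums are small by
  cancellation; this loss increases with the size of the zero, and so does the precision for r = 3
  and r = 4.\<close>

lemma airyA_zero_2_right: "airyA (- (40879494441309 / 10 ^ 13)) < 0"
proof -
  have F: "fp_sum 60 60 (-78761918910045864683) 1 1 1 0 10000000000000000000 0 29801606556968541773 1 0 0 0 0 = (-1597443, 476)"
    by code_simp
  show ?thesis
    by (rule airyA_sign_fp(2)[OF F]) (use airy_m_bounds_num in \<open>simp_all add: abs_le_iff power_divide\<close>)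
qed

lemma airyA_zero_2_left: "airyA (- (40879494441310 / 10 ^ 13)) > 0"
proof -
  have F: "fp_sum 60 60 (-78761918910051644739) 1 1 1 0 10000000000000000000 0 29801606556969270784 1 0 0 0 0 = (664665, 476)"
    by code_simp
  show ?thesis
    by (rule airyA_sign_fp(1)[OF F]) (use airy_m_bounds_num in \<open>simp_all add: abs_le_iff power_divide\<close>)
qed

lemma airyA_zero_3_right: "airyA (- (5520559828095551 / 10 ^ 15)) > 0"
proof -
  have F: "fp_sum 80 72 (-794527713679120735862329) 1 1 1 0 10000000000000000000000 0 40245495747828862603811 6 0 0 0 0 = (1440983, 3733)"
    by code_simp
  show ?thesis
    by (rule airyA_sign_fp(1)[OF F]) (use airy_m_bounds_num in \<open>simp_all add: abs_le_iff power_divide\<close>)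
qed

lemma airyA_zero_3_left: "airyA (- (5520559828095552 / 10 ^ 15)) < 0"
proof -
  have F: "fp_sum 80 72 (-794527713679121167627080) 1 1 1 0 10000000000000000000000 0 40245495747828869893922 7 0 0 0 0 = (-22929037, 4162)"
    by code_simp
  show ?thesis
    by (rule airyA_sign_fp(2)[OF F]) (use airy_m_bounds_num in \<open>simp_all add: abs_le_iff power_divide\<close>)
qed

lemma airyA_zero_4_right: "airyA (- (678670809007175897 / 10 ^ 17)) < 0"
proof -
  have F: "fp_sum 104 80 (-377900235244823761669782780) 1 1 1 0 10000000000000000000000000 0 49475857537253239858783111 6788 0 0 0 0 = (-738378163, 51616065)"
    by code_simp
  show ?thesis
    by (rule airyA_sign_fp(2)[OF F]) (use airy_m_bounds_num in \<open>simp_all add: abs_le_iff power_divide\<close>)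
qed

lemma airyA_zero_4_left: "airyA (- (678670809007175902 / 10 ^ 17)) > 0"
proof -
  have F: "fp_sum 104 80 (-377900235244823770022143679) 1 1 1 0 10000000000000000000000000 0 49475857537253240223288678 6787 0 0 0 0 = (544408826, 51608459)"
    by code_simp
  show ?thesis
    by (rule airyA_sign_fp(1)[OF F]) (use airy_m_bounds_num in \<open>simp_all add: abs_le_iff power_divide\<close>)
qed

section \<open>Counting and enclosing the zeros\<close>

lemma pi_squared_ge_9: "9 \<le> pi\<^sup>2"
proof -
  have "3 \<le> pi" using sin_x_le_x[of "pi / 6"] sin_30 by simp
  then have "3\<^sup>2 \<le> pi\<^sup>2" by (intro power_mono) auto
  then show ?thesis by simp
qed

lemma airyA_IVT:
  assumes "p < q" "airyA p * airyA q < 0"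
  shows "\<exists>u\<in>airyZ. p < u \<and> u < q"
proof -
  have "\<exists>u. p \<le> u \<and> u \<le> q \<and> airyA u = 0"
  proof (cases "airyA p < 0")
    case True
    then have "airyA q > 0" using assms by (simp add: mult_less_0_iff)
    then show ?thesis using True assms(1) IVT[of airyA p 0 q] isCont_airyA(1) by auto
  next
    case False
    then have "airyA p > 0" "airyA q < 0" using assms by (auto simp: mult_less_0_iff)
    then show ?thesis using assms(1) IVT2[of airyA q 0 p] isCont_airyA(1) by auto
  qed
  then obtain u where u: "p \<le> u" "u \<le> q" "airyA u = 0" by blast
  moreover have "u \<noteq> p" "u \<noteq> q" using assms u by auto
  ultimately show ?thesis unfolding airyZ_def by (intro bexI[of _ u]) auto
qed

text \<open>Two zeros u < v in [p, q] would satisfy pi^2 <= (v - u)^2 (- p). With 9 in place of pi^2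
  the criterion is a rational inequality.\<close>

lemma airyA_zero_unique:
  assumes "(q - p)\<^sup>2 * (- p) < 9" "u \<in> airyZ" "v \<in> airyZ" "p \<le> u" "u \<le> q" "p \<le> v" "v \<le> q"
  shows "u = v"
proof -
  have *: False if "u \<in> airyZ" "v \<in> airyZ" "p \<le> u" "u < v" "v \<le> q" for u v
  proof -
    have "9 \<le> (v - u)\<^sup>2 * (- p)"
      using airyZ_spacing[OF that(1,2,4), of "- p"] that(3) pi_squared_ge_9 by simp
    also have "\<dots> \<le> (q - p)\<^sup>2 * (- p)"
      using that airyZ_neg[OF that(1)] by (intro mult_right_mono power_mono) auto
    finally show False using assms(1) by simp
  qed
  then show ?thesis using assms(2-) by (cases u v rule: linorder_cases) blast+
qed

text \<open>A zero between points of equal sign is simple, so the opposite sign is attained next to it and forces a second zero,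
  which the spacing of the zeros forbids.\<close>
lemma airyZ_above_same_sign:
  assumes "p < q" "(q - p)\<^sup>2 * (- p) < 9" "airyA p * airyA q > 0"
  shows "{x \<in> airyZ. p < x} = {x \<in> airyZ. q < x}"
proof -
  have "u \<notin> airyZ" if u: "p < u" "u < q" for u
  proof
    assume uz: "u \<in> airyZ"
    have "\<exists>d>0. \<forall>h>0. h < d \<longrightarrow> airyA (u - h) * airyA (u + h) < 0"
    proof (cases "airyA' u > 0")
      case True
      obtain d where "d > 0" "\<forall>h>0. h < d \<longrightarrow> airyA u < airyA (u + h)"
        using DERIV_pos_inc_right[OF DERIV_airy_sol True] by blast
      moreover obtain d' where "d' > 0" "\<forall>h>0. h < d' \<longrightarrow> airyA (u - h) < airyA u"
        using DERIV_pos_inc_left[OF DERIV_airy_sol True] by blast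
      ultimately show ?thesis using uz
        by (intro exI[of _ "min d d'"]) (auto simp: airyZ_def mult_neg_pos)
    next
      case False
      then have n: "airyA' u < 0" using airyA_simple_zero[of u] uz by (auto simp: airyZ_def)
      obtain d where "d > 0" "\<forall>h>0. h < d \<longrightarrow> airyA (u + h) < airyA u"
        using DERIV_neg_dec_right[OF DERIV_airy_sol n] by blast
      moreover obtain d' where "d' > 0" "\<forall>h>0. h < d' \<longrightarrow> airyA u < airyA (u - h)"
        using DERIV_neg_dec_left[OF DERIV_airy_sol n] by blast
      ultimately show ?thesis using uz
        by (intro exI[of _ "min d d'"]) (auto simp: airyZ_def mult_pos_neg)
    qed
    then obtain d where d: "d > 0" "\<And>h. 0 < h \<Longrightarrow> h < d \<Longrightarrow> airyA (u - h) * airyA (u + h) < 0" by blast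
    define m where "m = min d (min (u - p) (q - u))"
    define h where "h = m / 2"
    have "0 < m" "m \<le> d" "m \<le> u - p" "m \<le> q - u" unfolding m_def using d(1) u by auto
    then have h: "0 < h" "h < d" "p < u - h" "u + h < q" unfolding h_def by simp_all
    have s: "airyA (u - h) * airyA (u + h) < 0" using d h by blast
    have "airyA p * airyA (u - h) < 0 \<or> airyA (u + h) * airyA q < 0"
      using s assms(3) by (auto simp: mult_less_0_iff zero_less_mult_iff)
    then obtain v where "v \<in> airyZ" "p < v" "v < q" "v \<noteq> u"
      using airyA_IVT[of p "u - h"] airyA_IVT[of "u + h" q] h by fastforce
    then show False using airyA_zero_unique[OF assms(2) _ uz, of v] u by simp
  qed
  moreover have "q \<notin> airyZ" using assms(3) by (auto simp: airyZ_def)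
  ultimately show ?thesis using assms(1) by (auto simp: not_less) (metis less_le not_le)
qed

lemma airyZ_above_sign_change:
  assumes "p < q" "(q - p)\<^sup>2 * (- p) < 9" "airyA p * airyA q < 0"
  obtains u where "u \<in> airyZ" "p < u" "u < q" "{x \<in> airyZ. u < x} = {x \<in> airyZ. q < x}"
    "card {x \<in> airyZ. p < x} = Suc (card {x \<in> airyZ. q < x})"
proof -
  obtain u where u: "u \<in> airyZ" "p < u" "u < q" using airyA_IVT[OF assms(1,3)] by blast
  have q: "q \<notin> airyZ" using assms(3) by (auto simp: airyZ_def)
  have uniq: "v = u" if "v \<in> airyZ" "p \<le> v" "v \<le> q" for v
    using airyA_zero_unique[OF assms(2) that(1) u(1)] that u by simp
  have eq: "{x \<in> airyZ. u < x} = {x \<in> airyZ. q < x}"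
  proof (rule Set.set_eqI)
    show "x \<in> {x \<in> airyZ. u < x} \<longleftrightarrow> x \<in> {x \<in> airyZ. q < x}" for x
      using uniq[of x] u q by (cases "x \<le> q") auto
  qed
  have "{x \<in> airyZ. p < x} = insert u {x \<in> airyZ. q < x}"
  proof (rule Set.set_eqI)
    show "x \<in> {x \<in> airyZ. p < x} \<longleftrightarrow> x \<in> insert u {x \<in> airyZ. q < x}" for x
      using uniq[of x] u q by (cases "x \<le> q") auto
  qed
  moreover have "u \<notin> {x \<in> airyZ. q < x}" using u by simp
  ultimately show thesis using that[OF u eq] finite_airyZ_above by simp
qed

text \<open>The last conclusion is the count required for the next index, so that zeros can be
  located one after another from the right.\<close>

lemma airy_zero_bracket:
  assumes "r \<ge> 1" "card {x \<in> airyZ. q < x} = r - 1"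
    and "p < q" "(q - p)\<^sup>2 * (- p) < 9" "airyA p * airyA q < 0"
  shows "p < airy_zero r" "airy_zero r < q" "card {x \<in> airyZ. p < x} = r"
proof -
  obtain u where u: "u \<in> airyZ" "p < u" "u < q" "{x \<in> airyZ. u < x} = {x \<in> airyZ. q < x}"
    "card {x \<in> airyZ. p < x} = Suc (card {x \<in> airyZ. q < x})"
    using airyZ_above_sign_change[OF assms(3-5)] by blast
  have "airy_zero r = u" using u assms(1,2) by (intro airy_zero_eqI) auto
  then show "p < airy_zero r" "airy_zero r < q" "card {x \<in> airyZ. p < x} = r"
    using u assms(1,2) by auto
qed

text \<open>Start of a chain through 0, -3/2, -3, -22/5, -113/20. The gaps are chosen so that (q -
  p)^2 (- p) stays below 9: the values are 3.375, 6.75, 8.624 and 8.828125.\<close>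

lemma card_airyZ_above_3_2: "card {x \<in> airyZ. - (3 / 2) < x} = 0"
proof -
  have "{x \<in> airyZ. - (3 / 2) < x} = {x \<in> airyZ. 0 < x}"
    by (rule airyZ_above_same_sign)
      (use airyA_neg_3_2 airyA_pos[of 0] in \<open>simp_all add: power2_eq_square\<close>)
  also have "\<dots> = {}" using airyZ_neg by fastforce
  finally show ?thesis by (simp only: card.empty)
qed

lemma card_airyZ_above_3: "card {x \<in> airyZ. - 3 < x} = 1"
  using airy_zero_bracket(3)[of 1 "- (3 / 2)" "- 3"] card_airyZ_above_3_2 airyA_neg_3 airyA_neg_3_2
  by (simp add: mult_neg_pos power2_eq_square)

lemma card_airyZ_above_22_5: "card {x \<in> airyZ. - (22 / 5) < x} = 2"
  using airy_zero_bracket(3)[of 2 "- 3" "- (22 / 5)"] card_airyZ_above_3 airyA_neg_22_5 airyA_neg_3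
  by (simp add: mult_pos_neg power2_eq_square)

lemma card_airyZ_above_113_20: "card {x \<in> airyZ. - (113 / 20) < x} = 3"
  using airy_zero_bracket(3)[of 3 "- (22 / 5)" "- (113 / 20)"] card_airyZ_above_22_5 airyA_neg_113_20 airyA_neg_22_5
  by (simp add: mult_neg_pos power2_eq_square)

lemma airy_zero_2: "- (40879494441310 / 10 ^ 13) < airy_zero 2" "airy_zero 2 < - (40879494441309 / 10 ^ 13)"
proof -
  have "{x \<in> airyZ. - (40879494441309 / 10 ^ 13) < x} = {x \<in> airyZ. - 3 < x}"
    by (rule airyZ_above_same_sign)
      (use airyA_zero_2_right airyA_neg_3 in \<open>simp_all add: power2_eq_square mult_neg_neg\<close>)
  then have c: "card {x \<in> airyZ. - (40879494441309 / 10 ^ 13) < x} = 1" using card_airyZ_above_3 by simp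
  have *: "airyA (- (40879494441310 / 10 ^ 13)) * airyA (- (40879494441309 / 10 ^ 13)) < 0"
    using airyA_zero_2_right airyA_zero_2_left by (rule mult_pos_neg[rotated])
  show "- (40879494441310 / 10 ^ 13) < airy_zero 2" "airy_zero 2 < - (40879494441309 / 10 ^ 13)"
    using airy_zero_bracket(1,2)[of 2, OF _ _ _ _ *] c by (simp_all add: power2_eq_square)
qed

lemma airy_zero_3: "- (5520559828095552 / 10 ^ 15) < airy_zero 3" "airy_zero 3 < - (5520559828095551 / 10 ^ 15)"
proof -
  have "{x \<in> airyZ. - (5520559828095551 / 10 ^ 15) < x} = {x \<in> airyZ. - (22 / 5) < x}"
    by (rule airyZ_above_same_sign)
      (use airyA_zero_3_right airyA_neg_22_5 in \<open>simp_all add: power2_eq_square\<close>)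
  then have c: "card {x \<in> airyZ. - (5520559828095551 / 10 ^ 15) < x} = 2" using card_airyZ_above_22_5 by simp
  have *: "airyA (- (5520559828095552 / 10 ^ 15)) * airyA (- (5520559828095551 / 10 ^ 15)) < 0"
    using airyA_zero_3_left airyA_zero_3_right by (rule mult_neg_pos)
  show "- (5520559828095552 / 10 ^ 15) < airy_zero 3" "airy_zero 3 < - (5520559828095551 / 10 ^ 15)"
    using airy_zero_bracket(1,2)[of 3, OF _ _ _ _ *] c by (simp_all add: power2_eq_square)
qed

lemma airy_zero_4: "- (678670809007175902 / 10 ^ 17) < airy_zero 4" "airy_zero 4 < - (678670809007175897 / 10 ^ 17)"
proof -
  have "{x \<in> airyZ. - (678670809007175897 / 10 ^ 17) < x} = {x \<in> airyZ. - (113 / 20) < x}"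
    by (rule airyZ_above_same_sign)
      (use airyA_zero_4_right airyA_neg_113_20 in \<open>simp_all add: power2_eq_square mult_neg_neg\<close>)
  then have c: "card {x \<in> airyZ. - (678670809007175897 / 10 ^ 17) < x} = 3" using card_airyZ_above_113_20 by simp
  have *: "airyA (- (678670809007175902 / 10 ^ 17)) * airyA (- (678670809007175897 / 10 ^ 17)) < 0"
    using airyA_zero_4_left airyA_zero_4_right by (rule mult_pos_neg)
  show "- (678670809007175902 / 10 ^ 17) < airy_zero 4" "airy_zero 4 < - (678670809007175897 / 10 ^ 17)"
    using airy_zero_bracket(1,2)[of 4, OF _ _ _ _ *] c by (simp_all add: power2_eq_square)
qed

section \<open>Numerical enclosure of the variance\<close>

text \<open>The series of A^2 at - \<alpha> begins with 1, 2 m \<alpha>, (m \<alpha>)^2. Its data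
  are known only in intervals: \<open>v1\<close>, \<open>v2\<close> and \<open>p\<close> are lower
  ends, and \<open>e1\<close>, \<open>e2\<close> and \<open>d\<close> cover the full widths.\<close>

lemma airy_integrals_fp:
  fixes \<alpha> l h m1 m2 :: real
  assumes zero: "airyA (- \<alpha>) = 0" and \<alpha>: "0 < l" "l \<le> \<alpha>" "\<alpha> \<le> h" and m: "0 < m1" "m1 \<le> airy_m" "airy_m \<le> m2"
    and res: "fp_sums N K p d 4 2 0 S 0 v1 e1 v2 e2 0 0 0 0 0 0 = ((v, e), (w, k))" and S: "S > 0" and N: "N > 0"
    and x: "of_int p \<le> - (2 ^ K * h ^ 3)" "- (2 ^ K * l ^ 3) \<le> of_int (p + d)" "32 * h ^ 3 \<le> real N ^ 2"
    and c1: "of_int v1 \<le> of_int S * (2 * m1 * l)" "of_int S * (2 * m2 * h) \<le> of_int (v1 + e1)"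
    and c2: "of_int v2 \<le> of_int S * (m1 * l)\<^sup>2" "of_int S * (m2 * h)\<^sup>2 \<le> of_int (v2 + e2)"
  shows "of_int (v - e) / of_int S \<le> airy_head_integral (- \<alpha>)" "airy_head_integral (- \<alpha>) \<le> of_int (v + e) / of_int S"
    "of_int (w - k) / of_int S \<le> (\<Sum>n. airy_sq_coeff n * (- \<alpha>) ^ n / real (Suc n))"
    "(\<Sum>n. airy_sq_coeff n * (- \<alpha>) ^ n / real (Suc n)) \<le> of_int (w + k) / of_int S"
proof -
  have m0: "airy_m > 0" "m2 > 0" "\<alpha> > 0" "h > 0" using m \<alpha> by linarith+
  have S0: "real_of_int S > 0" using S by simp
  have ml: "m1 * l \<le> airy_m * \<alpha>" "airy_m * \<alpha> \<le> m2 * h" using m \<alpha> m0 by (auto intro!: mult_mono)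
  have ml2: "(m1 * l)\<^sup>2 \<le> (airy_m * \<alpha>)\<^sup>2" "(airy_m * \<alpha>)\<^sup>2 \<le> (m2 * h)\<^sup>2"
    using ml m \<alpha> m0 by (auto intro!: power_mono)
  have c3: "l ^ 3 \<le> \<alpha> ^ 3" "\<alpha> ^ 3 \<le> h ^ 3" using \<alpha> by (auto intro!: power_mono)
  have enclosed: "fp_approx S y u f" if "of_int u \<le> a" "a \<le> of_int S * y" "of_int S * y \<le> b" "b \<le> of_int (u + f)" for y u f a b
    using that unfolding fp_approx_def of_int_add abs_le_iff by (intro conjI) linarith+
  have "fp_approx S (\<Sum>n. (\<Sum>i\<le>n. airy_sq_coeff i * (- \<alpha>) ^ i) / real (Suc n)) v e \<and>
    fp_approx S (\<Sum>n. airy_sq_coeff n * (- \<alpha>) ^ n / real (Suc n)) w k"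
  proof (rule fp_sums_correct[OF step3_series_airy_sq abs_summable_airy_sq, where n = 0])
    show "(\<Sum>n. airy_sq_coeff n * (- \<alpha>) ^ n) = 0" using airy_sq_sums[of "- \<alpha>"] zero by (simp add: sums_iff)
    show "summable (\<lambda>n. (\<Sum>i\<le>n. airy_sq_coeff i * (- \<alpha>) ^ i) / real (Suc n))"
      using airy_sq_quotient[OF zero] m0 by auto
    show "summable (\<lambda>n. airy_sq_coeff n * (- \<alpha>) ^ n / real (Suc n))" by (rule airyA'_sq_at_zero(2)[OF zero])
    have "2 ^ K * l ^ 3 \<le> 2 ^ K * \<alpha> ^ 3" "2 ^ K * \<alpha> ^ 3 \<le> 2 ^ K * h ^ 3" using c3 by simp_all
    moreover have cube: "(- \<alpha>) ^ 3 = - (\<alpha> ^ 3)" by simp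
    ultimately show "\<bar>2 ^ K * (- \<alpha>) ^ 3 - of_int p\<bar> \<le> of_int d"
      using x(1,2) unfolding cube abs_le_iff mult_minus_right of_int_add by linarith
    have "\<bar>(- \<alpha>) ^ 3\<bar> = \<alpha> ^ 3" using m0 by (simp add: power_abs)
    then show "32 * \<bar>(- \<alpha>) ^ 3\<bar> \<le> real (0 + N) ^ 2" using x(3) c3 by (simp only: add_0)
    show "0 < 0 + N" using N by simp
    show "fp_approx S (airy_sq_coeff 0 * (- \<alpha>) ^ 0) S 0" by (simp add: fp_approx_def airy_sq_coeff_0)
    have "airy_sq_coeff (0 + 1) * (- \<alpha>) ^ (0 + 1) = 2 * airy_m * \<alpha>" unfolding add_0 airy_sq_coeff_0 by simp
    then show "fp_approx S (airy_sq_coeff (0 + 1) * (- \<alpha>) ^ (0 + 1)) v1 e1"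
      using ml S0 by (intro enclosed[OF c1(1) _ _ c1(2)]) simp_all
    have "airy_sq_coeff (0 + 2) * (- \<alpha>) ^ (0 + 2) = (airy_m * \<alpha>)\<^sup>2"
      unfolding add_0 airy_sq_coeff_0 by (simp add: power_mult_distrib)
    then show "fp_approx S (airy_sq_coeff (0 + 2) * (- \<alpha>) ^ (0 + 2)) v2 e2"
      using ml2 S0 by (intro enclosed[OF c2(1) _ _ c2(2)]) (simp_all del: power_mult_distrib)
  qed (use res S in \<open>simp_all add: fp_approx_def\<close>)
  then show "of_int (v - e) / of_int S \<le> airy_head_integral (- \<alpha>)" "airy_head_integral (- \<alpha>) \<le> of_int (v + e) / of_int S"
    "of_int (w - k) / of_int S \<le> (\<Sum>n. airy_sq_coeff n * (- \<alpha>) ^ n / real (Suc n))"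
    "(\<Sum>n. airy_sq_coeff n * (- \<alpha>) ^ n / real (Suc n)) \<le> of_int (w + k) / of_int S"
    using S0 by (auto simp: fp_approx_def airy_head_integral_def abs_le_iff field_simps)
qed

text \<open>\<open>1 / (t + h)\<close> expanded at \<open>t = 1/2\<close>, where the mass of \<open>Ai\<^sup>2\<close> beyond its zero is concentrated, and truncated at odd order.\<close>
lemma inverse_cubic_lower:
  fixes t h \<beta> :: real
  assumes "t \<ge> 0" "h > 0" "\<beta> = 1 / (h + 1 / 2)"
  shows "(\<beta> + \<beta>\<^sup>2 / 2 + \<beta> ^ 3 / 4 + \<beta> ^ 4 / 8) + (- \<beta>\<^sup>2 - \<beta> ^ 3 - 3 / 4 * \<beta> ^ 4) * t + (\<beta> ^ 3 + 3 / 2 * \<beta> ^ 4) * t\<^sup>2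
    + (- (\<beta> ^ 4)) * t ^ 3 \<le> 1 / (t + h)" (is "?P \<le> _")
proof -
  define b where "b = h + 1 / 2"
  define s where "s = t - 1 / 2"
  have t: "t = s + 1 / 2" "t + h = s + b" and b: "\<beta> * b = 1" using assms by (auto simp: b_def s_def)
  have "?P = \<beta> - \<beta>\<^sup>2 * s + \<beta> ^ 3 * s\<^sup>2 - \<beta> ^ 4 * s ^ 3"
    unfolding t(1) by (simp add: field_simps power2_eq_square power3_eq_cube)
  then have "?P * (t + h) = (\<beta> * b) * (1 - \<beta> * s + \<beta>\<^sup>2 * s\<^sup>2 - \<beta> ^ 3 * s ^ 3) + (\<beta> - \<beta>\<^sup>2 * s + \<beta> ^ 3 * s\<^sup>2 - \<beta> ^ 4 * s ^ 3) * s"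
    unfolding t(2) by (simp only:) (simp add: algebra_simps power2_eq_square power3_eq_cube power4_eq_xxxx)
  also have "\<dots> = 1 - (\<beta> * s) ^ 4"
    unfolding b by (simp add: algebra_simps power2_eq_square power3_eq_cube power4_eq_xxxx)
  also have "\<dots> \<le> 1" by simp
  finally show ?thesis using assms(1,2) by (simp add: pos_le_divide_eq)
qed

text \<open>With s = t - 1/2 and b = l + 1/2, 1 / (b + s) equals \<beta> - \<beta>^2 s + \<beta>^2
  s^2 / (b + s) exactly. The last denominator is t + l >= l, and replacing it by l keeps an upper
  bound without going beyond degree two.\<close>

lemma inverse_quadratic_upper:
  fixes t l \<beta> :: real
  assumes "t \<ge> 0" "l > 0" "\<beta> = 1 / (l + 1 / 2)"
  shows "1 / (t + l) \<le> (\<beta> + \<beta>\<^sup>2 / 2 + \<beta>\<^sup>2 / (4 * l)) + (- \<beta>\<^sup>2 - \<beta>\<^sup>2 / l) * t + \<beta>\<^sup>2 / l * t\<^sup>2" (is "_ \<le> ?P")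
proof -
  define b where "b = l + 1 / 2"
  have h: "\<beta> * b = 1" using assms by (auto simp: b_def)
  have P: "?P = \<beta> - \<beta>\<^sup>2 * (t - 1 / 2) + \<beta>\<^sup>2 * (t - 1 / 2)\<^sup>2 / l"
    using assms(2) by (simp add: field_simps power2_eq_square)
  have "\<beta>\<^sup>2 * (t - 1 / 2)\<^sup>2 / l * (t + l) \<ge> \<beta>\<^sup>2 * (t - 1 / 2)\<^sup>2 / l * l"
    using assms by (intro mult_left_mono) auto
  then have "\<beta>\<^sup>2 * (t - 1 / 2)\<^sup>2 / l * (t + l) \<ge> \<beta>\<^sup>2 * (t - 1 / 2)\<^sup>2" using assms(2) by simp
  moreover have "(\<beta> - \<beta>\<^sup>2 * (t - 1 / 2)) * (t + l) = 1 - \<beta>\<^sup>2 * (t - 1 / 2)\<^sup>2"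
  proof -
    have "t + l = b + (t - 1 / 2)" by (simp add: b_def)
    then have "(\<beta> - \<beta>\<^sup>2 * (t - 1 / 2)) * (t + l) = \<beta> * b + \<beta> * (t - 1 / 2) - (\<beta> * b) * \<beta> * (t - 1 / 2) - \<beta>\<^sup>2 * (t - 1 / 2)\<^sup>2"
      by (simp only:) (simp add: field_simps power2_eq_square)
    then show ?thesis unfolding h by simp
  qed
  ultimately have "1 \<le> ?P * (t + l)" unfolding P by (simp add: distrib_right)
  then show ?thesis using assms by (simp add: pos_divide_le_eq)
qed

text \<open>Replacing \<alpha> by the larger h makes 1 / (x - \<alpha> + h) a minorant of 1 / x. The
  coefficient -17/56 is 1/8 - 3/7, the \<beta>^4 contributions of \<open>p0\<close> and of 3
  \<open>p3\<close> / 7 to the factor of m^2. Multiplying by D avoids a quotient of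
  enclosures.\<close>

lemma edge_variance_ge:
  fixes h \<beta> jl qu c m1 m2 :: real
  assumes r: "r \<ge> 1" and \<alpha>: "airy_zero r = - \<alpha>" "\<alpha> \<le> h" "1 \<le> h" and \<beta>: "\<beta> = 1 / (h + 1 / 2)"
    and m: "0 < m1" "m1 \<le> airy_m" "airy_m \<le> m2"
    and J: "jl \<le> airy_head_integral (- \<alpha>)" and Q: "(\<Sum>n. airy_sq_coeff n * (- \<alpha>) ^ n / real (Suc n)) \<le> qu" "0 \<le> qu"
    and c: "0 \<le> c" "c * (m2\<^sup>2 + h * qu) \<le> jl + (\<beta> + \<beta>\<^sup>2 / 2 + \<beta> ^ 3 / 4 - 17 / 56 * \<beta> ^ 4) * m1\<^sup>2
        - (\<beta>\<^sup>2 + \<beta> ^ 3 + 3 / 4 * \<beta> ^ 4) * m2 / 3 + (\<beta> ^ 3 + 3 / 2 * \<beta> ^ 4) / 5"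
  shows "c \<le> edge_variance r"
proof -
  define D where "D = (airyA' (- \<alpha>))\<^sup>2"
  note \<alpha>p = \<alpha>_props[OF r \<alpha>(1) D_def]
  let ?p0 = "\<beta> + \<beta>\<^sup>2 / 2 + \<beta> ^ 3 / 4 + \<beta> ^ 4 / 8" let ?p1 = "- \<beta>\<^sup>2 - \<beta> ^ 3 - 3 / 4 * \<beta> ^ 4"
  let ?p2 = "\<beta> ^ 3 + 3 / 2 * \<beta> ^ 4" let ?p3 = "- (\<beta> ^ 4)"
  let ?K = "?p0 * airy_m\<^sup>2 + ?p1 * airy_m / 3 + ?p2 / 5 + ?p3 * 3 * airy_m\<^sup>2 / 7"
  have b01: "0 < \<beta>" "\<beta> \<le> 1" using \<beta> \<alpha> by auto
  have low: "(airy_head_integral (- \<alpha>) + ?K) / D \<le> edge_variance r"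
  proof (rule edge_variance_lower[OF r \<alpha>(1) D_def])
    fix x assume x: "\<alpha> \<le> x"
    have "?p0 + ?p1 * (x - \<alpha>) + ?p2 * (x - \<alpha>)\<^sup>2 + ?p3 * (x - \<alpha>) ^ 3 \<le> 1 / (x - \<alpha> + h)"
      using x \<alpha> by (intro inverse_cubic_lower[OF _ _ \<beta>]) auto
    also have "\<dots> \<le> 1 / x" using x \<alpha> \<alpha>p by (intro divide_left_mono) auto
    finally show "?p0 + ?p1 * (x - \<alpha>) + ?p2 * (x - \<alpha>)\<^sup>2 + ?p3 * (x - \<alpha>) ^ 3 \<le> 1 / x" .
  qed
  have m0: "0 < airy_m" using m by linarith
  have m2: "m1\<^sup>2 \<le> airy_m\<^sup>2" "airy_m\<^sup>2 \<le> m2\<^sup>2" using m m0 by (auto intro!: power_mono)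
  have "D = airy_m\<^sup>2 + \<alpha> * (\<Sum>n. airy_sq_coeff n * (- \<alpha>) ^ n / real (Suc n))"
    unfolding D_def using airyA'_sq_at_zero(1)[OF \<alpha>p(2)] by simp
  also have "\<dots> \<le> airy_m\<^sup>2 + \<alpha> * qu" using Q \<alpha>p by simp
  also have "\<dots> \<le> m2\<^sup>2 + h * qu" using m2 \<alpha> Q by (intro add_mono mult_right_mono) auto
  finally have "c * D \<le> c * (m2\<^sup>2 + h * qu)" using c(1) by (intro mult_left_mono)
  also note c(2)
  also have "jl + (\<beta> + \<beta>\<^sup>2 / 2 + \<beta> ^ 3 / 4 - 17 / 56 * \<beta> ^ 4) * m1\<^sup>2
        - (\<beta>\<^sup>2 + \<beta> ^ 3 + 3 / 4 * \<beta> ^ 4) * m2 / 3 + (\<beta> ^ 3 + 3 / 2 * \<beta> ^ 4) / 5 \<le> airy_head_integral (- \<alpha>) + ?K"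
  proof -
    have "\<beta> ^ 4 \<le> \<beta> ^ 1" using b01 by (intro power_decreasing) auto
    then have "(\<beta> + \<beta>\<^sup>2 / 2 + \<beta> ^ 3 / 4 - 17 / 56 * \<beta> ^ 4) * m1\<^sup>2 \<le> (\<beta> + \<beta>\<^sup>2 / 2 + \<beta> ^ 3 / 4 - 17 / 56 * \<beta> ^ 4) * airy_m\<^sup>2"
    proof (intro mult_left_mono m2)
      have "0 \<le> \<beta>\<^sup>2" "0 \<le> \<beta> ^ 3" "0 \<le> \<beta> ^ 4" using b01 by simp_all
      then show "0 \<le> \<beta> + \<beta>\<^sup>2 / 2 + \<beta> ^ 3 / 4 - 17 / 56 * \<beta> ^ 4" using \<open>\<beta> ^ 4 \<le> \<beta> ^ 1\<close>
        unfolding power_one_right by linarith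
    qed
    moreover have "(\<beta>\<^sup>2 + \<beta> ^ 3 + 3 / 4 * \<beta> ^ 4) * airy_m \<le> (\<beta>\<^sup>2 + \<beta> ^ 3 + 3 / 4 * \<beta> ^ 4) * m2"
      using b01 m(3) by (intro mult_left_mono) auto
    moreover have "?K = (\<beta> + \<beta>\<^sup>2 / 2 + \<beta> ^ 3 / 4 - 17 / 56 * \<beta> ^ 4) * airy_m\<^sup>2
        - (\<beta>\<^sup>2 + \<beta> ^ 3 + 3 / 4 * \<beta> ^ 4) * airy_m / 3 + (\<beta> ^ 3 + 3 / 2 * \<beta> ^ 4) / 5"
      by (simp add: field_simps)
    moreover have "jl + x1 - y2 / 3 + z \<le> a + k" if "x1 \<le> x2" "y1 \<le> y2" "k = x2 - y1 / 3 + z" "jl \<le> a" for x1 x2 y1 y2 z k a :: real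
      using that by linarith
    ultimately show ?thesis using J by blast
  qed
  finally have "c \<le> (airy_head_integral (- \<alpha>) + ?K) / D" using \<alpha>p(3) by (simp add: pos_le_divide_eq)
  then show ?thesis using low by linarith
qed

text \<open>The mirror image: l below \<alpha> gives a majorant of 1 / x, the numerator is bounded
  from above and D from below.\<close>

lemma edge_variance_less:
  fixes l \<beta> ju ql c m1 m2 :: real
  assumes r: "r \<ge> 1" and \<alpha>: "airy_zero r = - \<alpha>" "l \<le> \<alpha>" "0 < l" and \<beta>: "\<beta> = 1 / (l + 1 / 2)"
    and m: "0 < m1" "m1 \<le> airy_m" "airy_m \<le> m2"
    and J: "airy_head_integral (- \<alpha>) \<le> ju" and Q: "ql \<le> (\<Sum>n. airy_sq_coeff n * (- \<alpha>) ^ n / real (Suc n))" "0 \<le> ql"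
    and c: "0 \<le> c" "ju + (\<beta> + \<beta>\<^sup>2 / 2 + \<beta>\<^sup>2 / (4 * l)) * m2\<^sup>2
        - (\<beta>\<^sup>2 + \<beta>\<^sup>2 / l) * m1 / 3 + \<beta>\<^sup>2 / l / 5 < c * (m1\<^sup>2 + l * ql)"
  shows "edge_variance r < c"
proof -
  define D where "D = (airyA' (- \<alpha>))\<^sup>2"
  note \<alpha>p = \<alpha>_props[OF r \<alpha>(1) D_def]
  let ?p0 = "\<beta> + \<beta>\<^sup>2 / 2 + \<beta>\<^sup>2 / (4 * l)" let ?p1 = "- \<beta>\<^sup>2 - \<beta>\<^sup>2 / l" let ?p2 = "\<beta>\<^sup>2 / l"
  let ?K = "?p0 * airy_m\<^sup>2 + ?p1 * airy_m / 3 + ?p2 / 5 + 0 * 3 * airy_m\<^sup>2 / 7"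
  have b01: "0 < \<beta>" using \<beta> \<alpha> by auto
  have up: "edge_variance r \<le> (airy_head_integral (- \<alpha>) + ?K) / D"
  proof (rule edge_variance_upper[OF r \<alpha>(1) D_def])
    fix x assume x: "\<alpha> \<le> x"
    have "1 / x \<le> 1 / (x - \<alpha> + l)" using x \<alpha> by (intro divide_left_mono) auto
    also have "\<dots> \<le> ?p0 + ?p1 * (x - \<alpha>) + ?p2 * (x - \<alpha>)\<^sup>2"
      using x \<alpha> by (intro inverse_quadratic_upper[OF _ _ \<beta>]) auto
    finally show "1 / x \<le> ?p0 + ?p1 * (x - \<alpha>) + ?p2 * (x - \<alpha>)\<^sup>2 + 0 * (x - \<alpha>) ^ 3" by simp
  qed
  have m0: "0 < airy_m" using m by linarith
  have m2: "m1\<^sup>2 \<le> airy_m\<^sup>2" "airy_m\<^sup>2 \<le> m2\<^sup>2" using m m0 by (auto intro!: power_mono)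
  have "?p0 * airy_m\<^sup>2 \<le> ?p0 * m2\<^sup>2" using b01 \<alpha> m2 by (intro mult_left_mono) auto
  moreover have "(\<beta>\<^sup>2 + \<beta>\<^sup>2 / l) * m1 \<le> (\<beta>\<^sup>2 + \<beta>\<^sup>2 / l) * airy_m" using b01 \<alpha> m by (intro mult_left_mono) auto
  moreover have "?K = ?p0 * airy_m\<^sup>2 - (\<beta>\<^sup>2 + \<beta>\<^sup>2 / l) * airy_m / 3 + \<beta>\<^sup>2 / l / 5" using \<alpha> by (simp add: field_simps)
  moreover have "a + k < d" if "x1 \<le> x2" "y1 \<le> y2" "k = x1 - y2 / 3 + z" "a \<le> ju" "ju + x2 - y1 / 3 + z < d" for x1 x2 y1 y2 z k a d :: real
    using that by linarith
  ultimately have "airy_head_integral (- \<alpha>) + ?K < c * (m1\<^sup>2 + l * ql)" using J c(2) by blast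
  also have "\<dots> \<le> c * D"
  proof (rule mult_left_mono[OF _ c(1)])
    have "m1\<^sup>2 + l * ql \<le> airy_m\<^sup>2 + \<alpha> * (\<Sum>n. airy_sq_coeff n * (- \<alpha>) ^ n / real (Suc n))"
      using m2 \<alpha> Q \<alpha>p by (intro add_mono mult_mono) auto
    also have "\<dots> = D" unfolding D_def using airyA'_sq_at_zero(1)[OF \<alpha>p(2)] by simp
    finally show "m1\<^sup>2 + l * ql \<le> D" .
  qed
  finally have "(airy_head_integral (- \<alpha>) + ?K) / D < c" using \<alpha>p(3) by (simp add: pos_divide_less_eq)
  then show ?thesis using up by linarith
qed

text \<open>The run is rounded to five decimals, and 511/125 and 4087/1000 are short rationals on
  either side of - a_2. The final inequalities thus involve only small fractions.\<close>

lemma edge_variance_2: "0.582 \<le> edge_variance 2" "edge_variance 2 < 0.583"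
proof -
  define \<alpha> where "\<alpha> = - airy_zero 2"
  have \<alpha>: "airy_zero 2 = - \<alpha>" by (simp add: \<alpha>_def)
  have zero: "airyA (- \<alpha>) = 0" using airy_zero_props(1)[of 2] by (simp add: \<alpha>_def airyZ_def)
  have b: "40879494441309 / 10 ^ 13 \<le> \<alpha>" "\<alpha> \<le> 40879494441310 / 10 ^ 13" using airy_zero_2 unfolding \<alpha>_def by linarith+
  have run: "fp_sums 60 44 (-1201811506806208) 89 4 2 0 10000000000000 0 59603213113937 2 88813575337635 5 0 0 0 0 0 0
      = ((28612511938788, 13106854), (11217530765686, 12979160))"
    by code_simp
  note I = airy_integrals_fp[OF zero _ b _ airy_m_bounds_num run]
  have J: "286124 / 10 ^ 5 \<le> airy_head_integral (- \<alpha>)" "airy_head_integral (- \<alpha>) \<le> 286126 / 10 ^ 5"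
    by (rule order_trans[OF _ I(1)] order_trans[OF I(2)]; simp add: power_divide power_mult_distrib)+
  have Q: "112175 / 10 ^ 5 \<le> (\<Sum>n. airy_sq_coeff n * (- \<alpha>) ^ n / real (Suc n))"
      "(\<Sum>n. airy_sq_coeff n * (- \<alpha>) ^ n / real (Suc n)) \<le> 112176 / 10 ^ 5"
    by (rule order_trans[OF _ I(3)] order_trans[OF I(4)]; simp add: power_divide power_mult_distrib)+
  have m: "0 < (72901 / 10 ^ 5 :: real)" "72901 / 10 ^ 5 \<le> airy_m" "airy_m \<le> 72902 / 10 ^ 5"
    using airy_m_bounds_num by simp_all
  show "0.582 \<le> edge_variance 2"
    by (rule edge_variance_ge[OF _ \<alpha> _ _ refl m J(1) Q(2), of "511 / 125"]) (use b in \<open>simp_all add: power_divide\<close>)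
  show "edge_variance 2 < 0.583"
    by (rule edge_variance_less[OF _ \<alpha> _ _ refl m J(2) Q(1), of "4087 / 1000"]) (use b in \<open>simp_all add: power_divide\<close>)
qed

lemma edge_variance_3: "0.472 \<le> edge_variance 3" "edge_variance 3 < 0.473"
proof -
  define \<alpha> where "\<alpha> = - airy_zero 3"
  have \<alpha>: "airy_zero 3 = - \<alpha>" by (simp add: \<alpha>_def)
  have zero: "airyA (- \<alpha>) = 0" using airy_zero_props(1)[of 3] by (simp add: \<alpha>_def airyZ_def)
  have b: "5520559828095551 / 10 ^ 15 \<le> \<alpha>" "\<alpha> \<le> 5520559828095552 / 10 ^ 15" using airy_zero_3 unfolding \<alpha>_def by linarith+
  have run: "fp_sums 86 56 (-12123530787340105708) 6590 4 2 0 10000000000000000 0 80490991495657725 15 161969992798851106 59 0 0 0 0 0 0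
      = ((27157626681192655, 11250455137), (9795239933708735, 10630770260))"
    by code_simp
  note I = airy_integrals_fp[OF zero _ b _ airy_m_bounds_num run]
  have J: "271576 / 10 ^ 5 \<le> airy_head_integral (- \<alpha>)" "airy_head_integral (- \<alpha>) \<le> 271577 / 10 ^ 5"
    by (rule order_trans[OF _ I(1)] order_trans[OF I(2)]; simp add: power_divide power_mult_distrib)+
  have Q: "97952 / 10 ^ 5 \<le> (\<Sum>n. airy_sq_coeff n * (- \<alpha>) ^ n / real (Suc n))"
      "(\<Sum>n. airy_sq_coeff n * (- \<alpha>) ^ n / real (Suc n)) \<le> 97953 / 10 ^ 5"
    by (rule order_trans[OF _ I(3)] order_trans[OF I(4)]; simp add: power_divide power_mult_distrib)+
  have m: "0 < (72901 / 10 ^ 5 :: real)" "72901 / 10 ^ 5 \<le> airy_m" "airy_m \<le> 72902 / 10 ^ 5"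
    using airy_m_bounds_num by simp_all
  show "0.472 \<le> edge_variance 3"
    by (rule edge_variance_ge[OF _ \<alpha> _ _ refl m J(1) Q(2), of "5521 / 1000"]) (use b in \<open>simp_all add: power_divide\<close>)
  show "edge_variance 3 < 0.473"
    by (rule edge_variance_less[OF _ \<alpha> _ _ refl m J(2) Q(1), of "138 / 25"]) (use b in \<open>simp_all add: power_divide\<close>)
qed

lemma edge_variance_4: "0.407 \<le> edge_variance 4" "edge_variance 4 < 0.408"
proof -
  define \<alpha> where "\<alpha> = - airy_zero 4"
  have \<alpha>: "airy_zero 4 = - \<alpha>" by (simp add: \<alpha>_def)
  have zero: "airyA (- \<alpha>) = 0" using airy_zero_props(1)[of 4] by (simp add: \<alpha>_def airyZ_def)
  have b: "678670809007175897 / 10 ^ 17 \<le> \<alpha>" "\<alpha> \<le> 678670809007175902 / 10 ^ 17" using airy_zero_4 unfolding \<alpha>_def by linarith+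
  have run: "fp_sums 113 64 (-5766299976269893951754) 127448 4 2 0 1000000000000000000 0 9895171507450647971 74 24478604790465782247 361 0 0 0 0 0 0
      = ((2606315051428798422, 2046662518279), (891553391166026161, 424225352700))"
    by code_simp
  note I = airy_integrals_fp[OF zero _ b _ airy_m_bounds_num run]
  have J: "260631 / 10 ^ 5 \<le> airy_head_integral (- \<alpha>)" "airy_head_integral (- \<alpha>) \<le> 260632 / 10 ^ 5"
    by (rule order_trans[OF _ I(1)] order_trans[OF I(2)]; simp add: power_divide power_mult_distrib)+
  have Q: "89155 / 10 ^ 5 \<le> (\<Sum>n. airy_sq_coeff n * (- \<alpha>) ^ n / real (Suc n))"
      "(\<Sum>n. airy_sq_coeff n * (- \<alpha>) ^ n / real (Suc n)) \<le> 89156 / 10 ^ 5"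
    by (rule order_trans[OF _ I(3)] order_trans[OF I(4)]; simp add: power_divide power_mult_distrib)+
  have m: "0 < (72901 / 10 ^ 5 :: real)" "72901 / 10 ^ 5 \<le> airy_m" "airy_m \<le> 72902 / 10 ^ 5"
    using airy_m_bounds_num by simp_all
  show "0.407 \<le> edge_variance 4"
    by (rule edge_variance_ge[OF _ \<alpha> _ _ refl m J(1) Q(2), of "6787 / 1000"]) (use b in \<open>simp_all add: power_divide\<close>)
  show "edge_variance 4 < 0.408"
    by (rule edge_variance_less[OF _ \<alpha> _ _ refl m J(2) Q(1), of "3393 / 500"]) (use b in \<open>simp_all add: power_divide\<close>)
qed

text \<open>Integrability is asserted separately because the integral of a non-integrable function
  is 0 by convention. The initial digits 0.582... are read as the half-open interval from 0.582 to
  0.583, and likewise for the other two.\<close>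

theorem theorem5p8:
  fixes r :: nat
  assumes "r \<ge> 1"
  shows
    "(\<forall>y\<ge>0. \<exists>e>0. uniform_limit (cball y e \<inter> {0..}) (\<lambda>N. edge_profile r N) (edge_limit r) sequentially) \<and>
     set_integrable lborel {0<..}
       (\<lambda>x. (airy (x + airy_zero r))\<^sup>2 / ((deriv airy (airy_zero r))\<^sup>2 * x)) \<and>
     (\<lambda>N. real N powr (1/3) * cov_entry N (N - r + 1) (N - r + 1)) \<longlonglongrightarrow> edge_variance r \<and>
     (r = 2 \<longrightarrow> 0.582 \<le> edge_variance r \<and> edge_variance r < 0.583) \<and>
     (r = 3 \<longrightarrow> 0.472 \<le> edge_variance r \<and> edge_variance r < 0.473) \<and>
     (r = 4 \<longrightarrow> 0.407 \<le> edge_variance r \<and> edge_variance r < 0.408)"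
proof (intro conjI)
  show "\<forall>y\<ge>0. \<exists>e>0. uniform_limit (cball y e \<inter> {0..}) (\<lambda>N. edge_profile r N) (edge_limit r) sequentially"
  proof (intro allI impI exI[of _ 1] conjI)
    fix y :: real assume "0 \<le> y"
    moreover have "cball y 1 \<inter> {0..} \<subseteq> {0..y + 1}" by (auto simp: dist_real_def)
    ultimately show "uniform_limit (cball y 1 \<inter> {0..}) (\<lambda>N. edge_profile r N) (edge_limit r) sequentially"
      by (intro uniform_limit_on_subset[OF edge_profile_uniform[OF assms]]) auto
  qed simp
  have "(\<lambda>x. (airy (x + airy_zero r))\<^sup>2 / ((deriv airy (airy_zero r))\<^sup>2 * x)) = edge_density r"
    by (intro ext) (simp add: edge_density_def[OF assms] edge_limit_eq[symmetric] edge_limit_def power_divide)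
  then show "set_integrable lborel {0<..}
      (\<lambda>x. (airy (x + airy_zero r))\<^sup>2 / ((deriv airy (airy_zero r))\<^sup>2 * x))"
    using edge_density_total(1)[OF assms] by simp
  show "(\<lambda>N. real N powr (1/3) * cov_entry N (N - r + 1) (N - r + 1)) \<longlonglongrightarrow> edge_variance r"
    by (rule variance_limit[OF assms])
qed (use edge_variance_2 edge_variance_3 edge_variance_4 in auto)

end
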